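(* Let $s\ge 1/2$, let $v$ be a submultiplicative weight on $\mathbb{R}^{2d}$ and let $m\in\mathcal{M}_v(\mathbb{R}^{2d})$. If $1/2\le s<1$, let $g\in S^s_s(\mathbb{R}^d)\setminus\{0\}$. If $s\ge 1$, assume that either $g\in\Sigma^1_1(\mathbb{R}^d)\setminus\{0\}$, or that $g\in S^s_s(\mathbb{R}^d)\setminus\{0\}$ and $v$ satisfies the following growth condition: for every $\epsilon>0$ there is a constant $c_\epsilon>0$ such that $v(z)\le c_\epsilon\exp(\epsilon|z|^{1/s})$ for all $z\in\mathbb{R}^{2d}$. Then the following properties are equivalent for $\sigma\in C^\infty(\mathbb{R}^{2d})$: (i) There exist constants $c>0$, $C>0$ such that $$|\partial^\alpha\sigma(z)|\le c\, m(z)\,C^{|\alpha|}(\alpha!)^s\qquad\text{for all } z\in\mathbb{R}^{2d},\ \alpha\in\mathbb{N}^{2d}.$$ (ii) There exist constants $c>0$, $\epsilon>0$ such that $$|\langle\sigma^w\pi(z)g,\pi(w)g\rangle|\le c\, m\Big(\frac{w+z}{2}\Big)\exp\big(-\epsilon|w-z|^{1/s}\big)\qquad\text{for all } z,w\in\mathbb{R}^{2d}.$$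
   Context: Weights: a submultiplicative weight $v$ on $\mathbb{R}^{n}$ is a continuous, positive, even function with $v(0)=1$, $v(z_1+z_2)\le v(z_1)v(z_2)$ for all $z_1,z_2$. $\mathcal{M}_v(\mathbb{R}^{n})$ is the set of $v$-moderate weights: measurable positive functions $m$ for which there is $C>0$ with $m(z+\zeta)\le C v(z)m(\zeta)$ for all $z,\zeta\in\mathbb{R}^n$. Gelfand-Shilov spaces: for $s,r\ge0$, $S^s_r(\mathbb{R}^d)$ is the space of $f\in\mathcal{S}(\mathbb{R}^d)$ such that for some $A,B,c>0$, $|x^\alpha\partial^\beta f(x)|\le c A^{|\alpha|}B^{|\beta|}(\alpha!)^r(\beta!)^s$ for all $x\in\mathbb{R}^d$, $\alpha,\beta\in\mathbb{N}^d$ (inductive limit topology over $A,B$). $\Sigma^1_1(\mathbb{R}^d)$ is the space of $f\in\mathcal{S}(\mathbb{R}^d)$ such that for every $A,B>0$ there is $c>0$ with $|x^\alpha\partial^\beta f(x)|\le cA^{|\alpha|}B^{|\beta|}\alpha!\beta!$ for all $x,\alpha,\beta$ (projective limit topology). $(S^s_s)'$ and $(\Sigma^1_1)'$ denote the strong duals. Time-frequency shifts: for $z=(x,\xi)\in\mathbb{R}^{2d}$, $\pi(z)f(t)=e^{2\pi i\xi\cdot t}f(t-x)$. Brackets $\langle\cdot,\cdot\rangle$ extend the inner product $\langle f,g\rangle=\int f(t)\overline{g(t)}\,dt$ to the dual pairs. Weyl operators: formally $\sigma^wf(x)=\int_{\mathbb{R}^d}\int_{\mathbb{R}^d}\sigma\big(\tfrac{x+y}{2},\xi\big)e^{2\pi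 i(x-y)\cdot\xi}f(y)\,dy\,d\xi$; rigorously $\langle\sigma^wf,h\rangle=\langle\sigma,W(h,f)\rangle$, where $W(f,h)(x,\xi)=\int_{\mathbb{R}^d}f(x+\tfrac t2)\overline{h(x-\tfrac t2)}e^{-2\pi it\cdot\xi}\,dt$ is the cross-Wigner distribution. For $f,h\in S^s_s(\mathbb{R}^d)$, $s\ge1/2$ (resp. $\Sigma^1_1(\mathbb{R}^d)$), $W(h,f)\in S^s_s(\mathbb{R}^{2d})$ (resp. $\Sigma^1_1(\mathbb{R}^{2d})$), so $\sigma^w$ is defined as a continuous map $S^s_s(\mathbb{R}^d)\to(S^s_s)'(\mathbb{R}^d)$ (resp. $\Sigma^1_1\to(\Sigma^1_1)'$) for $\sigma\in(S^s_s)'(\mathbb{R}^{2d})$ (resp. $(\Sigma^1_1)'(\mathbb{R}^{2d})$). Statements about $\sigma^w$ for $\sigma\in C^\infty(\mathbb{R}^{2d})$ include the assertion that $\sigma$ belongs to the relevant dual space, so that these pairings make sense. *)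

theory Defs
  imports "HOL-Analysis.Analysis"
begin

section \<open>Weights\<close>

definition submult_weight :: "('a::real_normed_vector \<Rightarrow> real) \<Rightarrow> bool" where
  "submult_weight v \<longleftrightarrow>
     continuous_on UNIV v \<and> (\<forall>z. v z > 0) \<and> (\<forall>z. v (- z) = v z) \<and> v 0 = 1 \<and>
     (\<forall>z1 z2. v (z1 + z2) \<le> v z1 * v z2)"

definition moderate_weights :: "('a::euclidean_space \<Rightarrow> real) \<Rightarrow> ('a \<Rightarrow> real) set" where
  "moderate_weights v =
     {m. m \<in> borel_measurable lebesgue \<and> (\<forall>z. m z > 0) \<and>
         (\<exists>C>0. \<forall>z \<zeta>. m (z + \<zeta>) \<le> C * v z * m \<zeta>)}"

section \<open>Multi-indices and partial derivatives\<close>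

text \<open>A multi-index on the Euclidean space \<^typ>\<open>'a\<close> is a function of type \<^typ>\<open>'a \<Rightarrow> nat\<close>, of which only
  the values on \<^const>\<open>Basis\<close> are ever used.\<close>

definition mi_size :: "('a::euclidean_space \<Rightarrow> nat) \<Rightarrow> nat" where
  "mi_size \<alpha> = (\<Sum>b\<in>Basis. \<alpha> b)"

definition mi_fact :: "('a::euclidean_space \<Rightarrow> nat) \<Rightarrow> real" where
  "mi_fact \<alpha> = (\<Prod>b\<in>Basis. fact (\<alpha> b))"

definition mi_power :: "'a::euclidean_space \<Rightarrow> ('a \<Rightarrow> nat) \<Rightarrow> real" where
  "mi_power x \<alpha> = (\<Prod>b\<in>Basis. (x \<bullet> b) ^ \<alpha> b)"

definition partial_deriv :: "'a::euclidean_space \<Rightarrow> ('a \<Rightarrow> complex) \<Rightarrow> 'a \<Rightarrow> complex" where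
  "partial_deriv b f = (\<lambda>x. frechet_derivative f (at x) b)"

definition basis_list :: "'a::euclidean_space list" where
  "basis_list = (SOME bs. distinct bs \<and> set bs = Basis)"

text \<open>The partial derivatives are composed in the order of some fixed enumeration of the basis; on smooth
  functions, the only ones it is applied to, the choice is immaterial.\<close>

definition mi_deriv :: "('a::euclidean_space \<Rightarrow> nat) \<Rightarrow> ('a \<Rightarrow> complex) \<Rightarrow> 'a \<Rightarrow> complex" where
  "mi_deriv \<beta> f = foldr (\<lambda>b h. (partial_deriv b ^^ \<beta> b) h) basis_list f"

primrec C_k :: "nat \<Rightarrow> ('a::euclidean_space \<Rightarrow> complex) \<Rightarrow> bool" where
  "C_k 0 f \<longleftrightarrow> continuous_on UNIV f"
| "C_k (Suc k) f \<longleftrightarrow> f differentiable_on UNIV \<and> (\<forall>b\<in>Basis. C_k k (partial_deriv b f))"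

definition C_infinity :: "('a::euclidean_space \<Rightarrow> complex) set" where
  "C_infinity = {f. \<forall>k. C_k k f}"

definition schwartz_space :: "('a::euclidean_space \<Rightarrow> complex) set" where
  "schwartz_space =
     {f \<in> C_infinity. \<forall>\<alpha> \<beta>. bounded (range (\<lambda>x. of_real (mi_power x \<alpha>) * mi_deriv \<beta> f x))}"

section \<open>Gelfand-Shilov spaces\<close>

text \<open>For fixed \<open>A\<close>, \<open>B\<close> the Schwartz functions satisfying the estimate below for some \<open>c\<close> form a normed space,
  the norm being the least such \<open>c\<close>. The following set is the closed ball of radius \<open>c\<close> around 0 in it.\<close>

definition gs_ball ::
  "real \<Rightarrow> real \<Rightarrow> real \<Rightarrow> real \<Rightarrow> real \<Rightarrow> ('a::euclidean_space \<Rightarrow> complex) set" where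
  "gs_ball s r A B c =
     {f \<in> schwartz_space. \<forall>x \<alpha> \<beta>.
        cmod (of_real (mi_power x \<alpha>) * mi_deriv \<beta> f x)
          \<le> c * A ^ mi_size \<alpha> * B ^ mi_size \<beta> * mi_fact \<alpha> powr r * mi_fact \<beta> powr s}"

definition GS_space :: "real \<Rightarrow> real \<Rightarrow> ('a::euclidean_space \<Rightarrow> complex) set" where
  "GS_space s r = {f. \<exists>A>0. \<exists>B>0. \<exists>c>0. f \<in> gs_ball s r A B c}"

definition Sigma11_space :: "('a::euclidean_space \<Rightarrow> complex) set" where
  "Sigma11_space = {f \<in> schwartz_space. \<forall>A>0. \<forall>B>0. \<exists>c>0. f \<in> gs_ball 1 1 A B c}"

definition abs_convex :: "('a \<Rightarrow> complex) set \<Rightarrow> bool" where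
  "abs_convex V \<longleftrightarrow>
     (\<forall>f\<in>V. \<forall>h\<in>V. \<forall>a b. cmod a + cmod b \<le> 1 \<longrightarrow> (\<lambda>x. a * f x + b * h x) \<in> V)"

text \<open>Locally convex inductive limit over \<open>A\<close>, \<open>B\<close>: the absolutely convex sets that meet every step in a
  neighbourhood of 0 form a base of neighbourhoods of 0.\<close>

definition GS_topology :: "real \<Rightarrow> real \<Rightarrow> ('a::euclidean_space \<Rightarrow> complex) topology" where
  "GS_topology s r = topology (\<lambda>U. U \<subseteq> GS_space s r \<and>
     (\<forall>f\<in>U. \<exists>V \<subseteq> GS_space s r. abs_convex V \<and>
        (\<forall>A>0. \<forall>B>0. \<exists>c>0. gs_ball s r A B c \<subseteq> V) \<and>
        (\<forall>h\<in>V. (\<lambda>x. f x + h x) \<in> U)))"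

text \<open>Projective limit over \<open>A\<close>, \<open>B\<close>. The balls increase with \<open>A\<close>, \<open>B\<close> and \<open>c\<close>, so single balls (rather than
  finite intersections) already give a base of neighbourhoods of 0.\<close>

definition Sigma11_topology :: "('a::euclidean_space \<Rightarrow> complex) topology" where
  "Sigma11_topology = topology (\<lambda>U. U \<subseteq> Sigma11_space \<and>
     (\<forall>f\<in>U. \<exists>A>0. \<exists>B>0. \<exists>c>0.
        \<forall>h \<in> Sigma11_space \<inter> gs_ball 1 1 A B c. (\<lambda>x. f x + h x) \<in> U))"

section \<open>Duality\<close>

text \<open>Since the brackets extend the inner product \<open>\<langle>f, h\<rangle> = \<integral> f(t) cnj (h(t)) dt\<close>, the elements of the dual act
  conjugate-linearly on test functions.\<close>

definition dual_space :: "('a \<Rightarrow> complex) topology \<Rightarrow> (('a \<Rightarrow> complex) \<Rightarrow> complex) set" where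
  "dual_space T =
     {u. continuous_map T euclidean u \<and>
         (\<forall>f\<in>topspace T. \<forall>h\<in>topspace T. \<forall>a b.
            u (\<lambda>x. a * f x + b * h x) = cnj a * u f + cnj b * u h)}"

definition pairing :: "('a::euclidean_space \<Rightarrow> complex) \<Rightarrow> ('a \<Rightarrow> complex) \<Rightarrow> complex" where
  "pairing \<sigma> = (\<lambda>\<phi>. \<integral>z. \<sigma> z * cnj (\<phi> z) \<partial>lborel)"

text \<open>The function \<open>\<sigma>\<close> belongs to the dual of the test function space with topology \<open>T\<close>. Integrability is
  required explicitly because the Bochner integral of a non-integrable function is 0 by convention.\<close>

definition in_dual :: "('a::euclidean_space \<Rightarrow> complex) topology \<Rightarrow> ('a \<Rightarrow> complex) \<Rightarrow> bool" where
  "in_dual T \<sigma> \<longleftrightarrow>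
     (\<forall>\<phi>\<in>topspace T. integrable lborel (\<lambda>z. \<sigma> z * cnj (\<phi> z))) \<and> pairing \<sigma> \<in> dual_space T"

section \<open>Time-frequency shifts and Weyl operators\<close>

definition tf_shift :: "'a::euclidean_space \<times> 'a \<Rightarrow> ('a \<Rightarrow> complex) \<Rightarrow> 'a \<Rightarrow> complex" where
  "tf_shift z f = (\<lambda>t. exp (2 * pi * \<i> * of_real (snd z \<bullet> t)) * f (t - fst z))"

definition cross_wigner ::
  "('a::euclidean_space \<Rightarrow> complex) \<Rightarrow> ('a \<Rightarrow> complex) \<Rightarrow> 'a \<times> 'a \<Rightarrow> complex" where
  "cross_wigner f h = (\<lambda>(x, \<xi>).
     \<integral>t. f (x + t /\<^sub>R 2) * cnj (h (x - t /\<^sub>R 2)) * exp (- 2 * pi * \<i> * of_real (t \<bullet> \<xi>)) \<partial>lborel)"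

text \<open>For a functional \<open>u\<close> on phase space, \<open>weyl_op u f\<close> is the functional \<open>h \<mapsto> \<langle>u, W(h, f)\<rangle>\<close>.\<close>

definition weyl_op ::
  "(('a::euclidean_space \<times> 'a \<Rightarrow> complex) \<Rightarrow> complex) \<Rightarrow> ('a \<Rightarrow> complex) \<Rightarrow> ('a \<Rightarrow> complex) \<Rightarrow> complex" where
  "weyl_op u f = (\<lambda>h. u (cross_wigner h f))"

section \<open>Well-definedness of the topologies\<close>

lemma abs_convex_Int: "abs_convex V \<Longrightarrow> abs_convex W \<Longrightarrow> abs_convex (V \<inter> W)"
  unfolding abs_convex_def by blast

lemma mi_fact_nonneg: "mi_fact \<alpha> \<ge> 0"
  unfolding mi_fact_def by (intro prod_nonneg) auto

lemma gs_ball_mono: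
  assumes "0 < A" "A \<le> A'" "0 < B" "B \<le> B'" "0 \<le> c" "c \<le> c'"
  shows "gs_ball s r A B c \<subseteq> gs_ball s r A' B' c'"
proof -
  have "c * A ^ mi_size \<alpha> * B ^ mi_size \<beta> * mi_fact \<alpha> powr r * mi_fact \<beta> powr s
     \<le> c' * A' ^ mi_size \<alpha> * B' ^ mi_size \<beta> * mi_fact \<alpha> powr r * mi_fact \<beta> powr s" for \<alpha> \<beta> :: "'a \<Rightarrow> nat"
    using assms by (intro mult_mono power_mono mult_nonneg_nonneg zero_le_power) auto
  then show ?thesis
    unfolding gs_ball_def by (blast intro: order_trans)
qed

lemma openin_GS_topology:
  "openin (GS_topology s r) U \<longleftrightarrow> U \<subseteq> GS_space s r \<and>
     (\<forall>f\<in>U. \<exists>V \<subseteq> GS_space s r. abs_convex V \<and>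
        (\<forall>A>0. \<forall>B>0. \<exists>c>0. gs_ball s r A B c \<subseteq> V) \<and>
        (\<forall>h\<in>V. (\<lambda>x. f x + h x) \<in> U))"
    (is "_ \<longleftrightarrow> ?open U")
proof -
  define nb where "nb V \<longleftrightarrow> V \<subseteq> GS_space s r \<and> abs_convex V \<and>
    (\<forall>A>0. \<forall>B>0. \<exists>c>0. gs_ball s r A B c \<subseteq> V)" for V :: "('a \<Rightarrow> complex) set"
  have eq: "?open U \<longleftrightarrow> U \<subseteq> GS_space s r \<and> (\<forall>f\<in>U. \<exists>V. nb V \<and> (\<forall>h\<in>V. (\<lambda>x. f x + h x) \<in> U))" for U
    by (simp only: nb_def conj_assoc)
  have nb_Int: "nb (V \<inter> W)" if "nb V" "nb W" for V W
  proof -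
    have "\<exists>c>0. gs_ball s r A B c \<subseteq> V \<inter> W" if "A > 0" "B > 0" for A B
    proof -
      obtain c where "c > 0" "gs_ball s r A B c \<subseteq> V"
        using \<open>nb V\<close> \<open>A > 0\<close> \<open>B > 0\<close> unfolding nb_def by blast
      moreover obtain d where "d > 0" "gs_ball s r A B d \<subseteq> W"
        using \<open>nb W\<close> \<open>A > 0\<close> \<open>B > 0\<close> unfolding nb_def by blast
      moreover have "gs_ball s r A B (min c d) \<subseteq> gs_ball s r A B c"
        "gs_ball s r A B (min c d) \<subseteq> gs_ball s r A B d"
        using that \<open>c > 0\<close> \<open>d > 0\<close> by (intro gs_ball_mono; simp)+
      ultimately show ?thesis
        by (intro exI[of _ "min c d"]) auto
    qed
    with that show ?thesis
      unfolding nb_def by (simp add: abs_convex_Int le_infI1)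
  qed
  have "istopology ?open"
    unfolding istopology_def eq
  proof (intro conjI allI impI)
    fix S T
    assume S: "S \<subseteq> GS_space s r \<and> (\<forall>f\<in>S. \<exists>V. nb V \<and> (\<forall>h\<in>V. (\<lambda>x. f x + h x) \<in> S))"
      and T: "T \<subseteq> GS_space s r \<and> (\<forall>f\<in>T. \<exists>V. nb V \<and> (\<forall>h\<in>V. (\<lambda>x. f x + h x) \<in> T))"
    show "S \<inter> T \<subseteq> GS_space s r" using S by blast
    show "\<forall>f\<in>S \<inter> T. \<exists>V. nb V \<and> (\<forall>h\<in>V. (\<lambda>x. f x + h x) \<in> S \<inter> T)"
    proof
      fix f assume "f \<in> S \<inter> T"
      then have "f \<in> S" "f \<in> T" by auto
      obtain V where V: "nb V" "\<forall>h\<in>V. (\<lambda>x. f x + h x) \<in> S"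
        using bspec[OF conjunct2[OF S] \<open>f \<in> S\<close>] by (elim exE conjE)
      obtain W where W: "nb W" "\<forall>h\<in>W. (\<lambda>x. f x + h x) \<in> T"
        using bspec[OF conjunct2[OF T] \<open>f \<in> T\<close>] by (elim exE conjE)
      have "\<forall>h\<in>V \<inter> W. (\<lambda>x. f x + h x) \<in> S \<inter> T"
        using V(2) W(2) by simp
      with nb_Int[OF V(1) W(1)] show "\<exists>V. nb V \<and> (\<forall>h\<in>V. (\<lambda>x. f x + h x) \<in> S \<inter> T)"
        by (intro exI[of _ "V \<inter> W"] conjI)
    qed
  next
    fix K
    assume K: "\<forall>U\<in>K. U \<subseteq> GS_space s r \<and> (\<forall>f\<in>U. \<exists>V. nb V \<and> (\<forall>h\<in>V. (\<lambda>x. f x + h x) \<in> U))"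
    then show "\<Union>K \<subseteq> GS_space s r" by blast
    show "\<forall>f\<in>\<Union>K. \<exists>V. nb V \<and> (\<forall>h\<in>V. (\<lambda>x. f x + h x) \<in> \<Union>K)"
    proof
      fix f assume "f \<in> \<Union>K"
      then obtain U where U: "U \<in> K" "f \<in> U" by blast
      obtain V where V: "nb V" "\<forall>h\<in>V. (\<lambda>x. f x + h x) \<in> U"
        using bspec[OF conjunct2[OF bspec[OF K U(1)]] U(2)] by (elim exE conjE)
      then have "\<forall>h\<in>V. (\<lambda>x. f x + h x) \<in> \<Union>K"
        using U(1) by (intro ballI UnionI) auto
      with V(1) show "\<exists>V. nb V \<and> (\<forall>h\<in>V. (\<lambda>x. f x + h x) \<in> \<Union>K)"
        by (intro exI conjI)
    qed
  qed
  then show ?thesis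
    unfolding GS_topology_def by (simp add: topology_inverse')
qed

lemma openin_Sigma11_topology:
  "openin Sigma11_topology U \<longleftrightarrow> U \<subseteq> Sigma11_space \<and>
     (\<forall>f\<in>U. \<exists>A>0. \<exists>B>0. \<exists>c>0.
        \<forall>h \<in> Sigma11_space \<inter> gs_ball 1 1 A B c. (\<lambda>x. f x + h x) \<in> U)"
    (is "_ \<longleftrightarrow> ?open U")
proof -
  have "istopology ?open"
    unfolding istopology_def
  proof (intro conjI allI impI)
    fix S T assume S: "?open S" and T: "?open T"
    show "S \<inter> T \<subseteq> Sigma11_space" using S by blast
    show "\<forall>f\<in>S \<inter> T. \<exists>A>0. \<exists>B>0. \<exists>c>0.
        \<forall>h \<in> Sigma11_space \<inter> gs_ball 1 1 A B c. (\<lambda>x. f x + h x) \<in> S \<inter> T"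
    proof
      fix f assume f: "f \<in> S \<inter> T"
      obtain A B c where 1: "A > 0" "B > 0" "c > 0"
        "\<forall>h \<in> Sigma11_space \<inter> gs_ball 1 1 A B c. (\<lambda>x. f x + h x) \<in> S"
        using S f by (meson IntD1)
      obtain A' B' c' where 2: "A' > 0" "B' > 0" "c' > 0"
        "\<forall>h \<in> Sigma11_space \<inter> gs_ball 1 1 A' B' c'. (\<lambda>x. f x + h x) \<in> T"
        using T f by (meson IntD2)
      have "gs_ball 1 1 (min A A') (min B B') (min c c') \<subseteq> gs_ball 1 1 A B c"
        "gs_ball 1 1 (min A A') (min B B') (min c c') \<subseteq> gs_ball 1 1 A' B' c'"
        using 1(1-3) 2(1-3) by (intro gs_ball_mono; simp)+
      with 1 2 show "\<exists>A>0. \<exists>B>0. \<exists>c>0.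
          \<forall>h \<in> Sigma11_space \<inter> gs_ball 1 1 A B c. (\<lambda>x. f x + h x) \<in> S \<inter> T"
        by (intro exI[of _ "min A A'"] exI[of _ "min B B'"] exI[of _ "min c c'"] conjI) auto
    qed
  next
    fix K assume K: "\<forall>U\<in>K. ?open U"
    then show "\<Union>K \<subseteq> Sigma11_space" by blast
    show "\<forall>f\<in>\<Union>K. \<exists>A>0. \<exists>B>0. \<exists>c>0.
        \<forall>h \<in> Sigma11_space \<inter> gs_ball 1 1 A B c. (\<lambda>x. f x + h x) \<in> \<Union>K"
    proof
      fix f assume "f \<in> \<Union>K"
      then obtain U where U: "U \<in> K" "f \<in> U" by blast
      with K obtain A B c where "A > 0" "B > 0" "c > 0"
        "\<forall>h \<in> Sigma11_space \<inter> gs_ball 1 1 A B c. (\<lambda>x. f x + h x) \<in> U"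
        by meson
      with U show "\<exists>A>0. \<exists>B>0. \<exists>c>0.
          \<forall>h \<in> Sigma11_space \<inter> gs_ball 1 1 A B c. (\<lambda>x. f x + h x) \<in> \<Union>K"
        by blast
    qed
  qed
  then show ?thesis
    unfolding Sigma11_topology_def by (simp add: topology_inverse')
qed

lemma partial_deriv_lincomb:
  assumes "f differentiable_on UNIV" "h differentiable_on UNIV"
  shows "partial_deriv b (\<lambda>x. a * f x + a' * h x) = (\<lambda>x. a * partial_deriv b f x + a' * partial_deriv b h x)"
proof
  fix x
  have "(f has_derivative frechet_derivative f (at x)) (at x)"
    "(h has_derivative frechet_derivative h (at x)) (at x)"
    using assms by (auto simp: differentiable_on_def frechet_derivative_works)
  then have "((\<lambda>x. a * f x + a' * h x) has_derivative
      (\<lambda>v. a * frechet_derivative f (at x) v + a' * frechet_derivative h (at x) v)) (at x)"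
    by (intro has_derivative_add has_derivative_mult_right)
  from frechet_derivative_at[OF this, symmetric]
  show "partial_deriv b (\<lambda>x. a * f x + a' * h x) x = a * partial_deriv b f x + a' * partial_deriv b h x"
    by (simp add: partial_deriv_def)
qed

lemma C_k_lincomb: "C_k k f \<Longrightarrow> C_k k h \<Longrightarrow> C_k k (\<lambda>x. a * f x + a' * h x)"
proof (induction k arbitrary: f h)
  case 0
  then show ?case by (simp add: continuous_on_add continuous_on_mult_left)
next
  case (Suc k)
  then show ?case
    by (auto simp: partial_deriv_lincomb differentiable_on_def intro!: differentiable_add differentiable_mult)
qed

lemma C_infinity_lincomb: "f \<in> C_infinity \<Longrightarrow> h \<in> C_infinity \<Longrightarrow> (\<lambda>x. a * f x + a' * h x) \<in> C_infinity"
  by (simp add: C_infinity_def C_k_lincomb)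

lemma C_infinity_differentiable: "f \<in> C_infinity \<Longrightarrow> f differentiable_on UNIV"
  unfolding C_infinity_def by (auto dest: spec[of _ "Suc 0"])

lemma C_infinity_partial_deriv:
  assumes "f \<in> C_infinity" "b \<in> Basis"
  shows "partial_deriv b f \<in> C_infinity"
proof -
  have "C_k (Suc k) f" for k
    using assms(1) unfolding C_infinity_def by blast
  then show ?thesis
    using assms(2) by (simp add: C_infinity_def)
qed

lemma basis_list: "distinct (basis_list :: 'a::euclidean_space list)" "set (basis_list :: 'a list) = Basis"
proof -
  have "\<exists>bs :: 'a list. distinct bs \<and> set bs = Basis"
    using finite_distinct_list[OF finite_Basis] by blast
  then have "distinct (basis_list :: 'a list) \<and> set (basis_list :: 'a list) = Basis"
    unfolding basis_list_def by (rule someI_ex)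
  then show "distinct (basis_list :: 'a list)" "set (basis_list :: 'a list) = Basis" by auto
qed

lemma mi_deriv_lincomb:
  assumes "f \<in> C_infinity" "h \<in> C_infinity"
  shows "mi_deriv \<beta> (\<lambda>x. a * f x + a' * h x) = (\<lambda>x. a * mi_deriv \<beta> f x + a' * mi_deriv \<beta> h x)"
proof -
  have pow: "(partial_deriv b ^^ n) f \<in> C_infinity \<and> (partial_deriv b ^^ n) h \<in> C_infinity \<and>
      (partial_deriv b ^^ n) (\<lambda>x. a * f x + a' * h x)
        = (\<lambda>x. a * (partial_deriv b ^^ n) f x + a' * (partial_deriv b ^^ n) h x)"
    if "f \<in> C_infinity" "h \<in> C_infinity" "b \<in> Basis" for b n and f h :: "'a \<Rightarrow> complex"
    using that
    by (induction n) (auto simp: C_infinity_partial_deriv partial_deriv_lincomb C_infinity_differentiable)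
  have "foldr (\<lambda>b h. (partial_deriv b ^^ \<beta> b) h) bs f \<in> C_infinity \<and>
      foldr (\<lambda>b h. (partial_deriv b ^^ \<beta> b) h) bs h \<in> C_infinity \<and>
      foldr (\<lambda>b h. (partial_deriv b ^^ \<beta> b) h) bs (\<lambda>x. a * f x + a' * h x)
        = (\<lambda>x. a * foldr (\<lambda>b h. (partial_deriv b ^^ \<beta> b) h) bs f x
             + a' * foldr (\<lambda>b h. (partial_deriv b ^^ \<beta> b) h) bs h x)"
    if "set bs \<subseteq> Basis" for bs
    using that assms by (induction bs) (auto simp: pow)
  then show ?thesis
    unfolding mi_deriv_def by (simp add: basis_list(2))
qed

lemma mi_term_lincomb:
  assumes "f \<in> C_infinity" "h \<in> C_infinity"
    and "cmod (of_real (mi_power x \<alpha>) * mi_deriv \<beta> f x) \<le> K"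
    and "cmod (of_real (mi_power x \<alpha>) * mi_deriv \<beta> h x) \<le> L"
  shows "cmod (of_real (mi_power x \<alpha>) * mi_deriv \<beta> (\<lambda>x. a * f x + a' * h x) x) \<le> cmod a * K + cmod a' * L"
proof -
  have "of_real (mi_power x \<alpha>) * mi_deriv \<beta> (\<lambda>x. a * f x + a' * h x) x =
     a * (of_real (mi_power x \<alpha>) * mi_deriv \<beta> f x) + a' * (of_real (mi_power x \<alpha>) * mi_deriv \<beta> h x)"
    using assms(1,2) by (simp add: mi_deriv_lincomb algebra_simps)
  also have "cmod \<dots> \<le> cmod a * cmod (of_real (mi_power x \<alpha>) * mi_deriv \<beta> f x)
     + cmod a' * cmod (of_real (mi_power x \<alpha>) * mi_deriv \<beta> h x)"
    by (metis norm_mult norm_triangle_ineq)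
  also have "\<dots> \<le> cmod a * K + cmod a' * L"
    using assms(3,4) by (intro add_mono mult_left_mono) auto
  finally show ?thesis .
qed

lemma schwartz_space_lincomb:
  assumes "f \<in> schwartz_space" "h \<in> schwartz_space"
  shows "(\<lambda>x. a * f x + a' * h x) \<in> schwartz_space"
proof -
  have smooth: "f \<in> C_infinity" "h \<in> C_infinity"
    using assms by (auto simp: schwartz_space_def)
  have "bounded (range (\<lambda>x. of_real (mi_power x \<alpha>) * mi_deriv \<beta> (\<lambda>x. a * f x + a' * h x) x))" for \<alpha> \<beta>
  proof -
    obtain K L where "\<And>x. cmod (of_real (mi_power x \<alpha>) * mi_deriv \<beta> f x) \<le> K"
      "\<And>x. cmod (of_real (mi_power x \<alpha>) * mi_deriv \<beta> h x) \<le> L"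
      using assms unfolding schwartz_space_def bounded_iff by (simp add: image_iff) meson
    then show ?thesis
      using mi_term_lincomb[OF smooth] unfolding bounded_iff by blast
  qed
  then show ?thesis
    using smooth by (simp add: schwartz_space_def C_infinity_lincomb)
qed

lemma gs_ball_lincomb:
  assumes "f \<in> gs_ball s r A B c" "h \<in> gs_ball s r A B d"
  shows "(\<lambda>x. a * f x + a' * h x) \<in> gs_ball s r A B (cmod a * c + cmod a' * d)"
proof -
  define N where "N \<alpha> \<beta> = A ^ mi_size \<alpha> * B ^ mi_size \<beta> * mi_fact \<alpha> powr r * mi_fact \<beta> powr s"
    for \<alpha> \<beta> :: "'a \<Rightarrow> nat"
  have ball: "k \<in> gs_ball s r A B e \<longleftrightarrow> k \<in> schwartz_space \<and>
      (\<forall>x \<alpha> \<beta>. cmod (of_real (mi_power x \<alpha>) * mi_deriv \<beta> k x) \<le> e * N \<alpha> \<beta>)" for k e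
    by (simp add: gs_ball_def N_def mult.assoc)
  have fh: "f \<in> schwartz_space" "h \<in> schwartz_space"
    using assms by (auto simp: gs_ball_def)
  then have smooth: "f \<in> C_infinity" "h \<in> C_infinity"
    by (auto simp: schwartz_space_def)
  have "cmod (of_real (mi_power x \<alpha>) * mi_deriv \<beta> (\<lambda>x. a * f x + a' * h x) x)
      \<le> cmod a * (c * N \<alpha> \<beta>) + cmod a' * (d * N \<alpha> \<beta>)" for x \<alpha> \<beta>
    using assms by (intro mi_term_lincomb smooth) (auto simp: ball)
  then show ?thesis
    using schwartz_space_lincomb[OF fh] by (simp add: ball algebra_simps)
qed

lemma gs_ball_lincomb':
  assumes "f \<in> gs_ball s r A B c" "h \<in> gs_ball s r A B d" "A > 0" "B > 0" "c > 0" "d > 0"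
  shows "\<exists>e>0. (\<lambda>x. a * f x + a' * h x) \<in> gs_ball s r A B e"
proof -
  let ?e = "cmod a * c + cmod a' * d"
  have e: "?e \<ge> 0"
    using assms(5,6) by (intro add_nonneg_nonneg mult_nonneg_nonneg) simp_all
  have "(\<lambda>x. a * f x + a' * h x) \<in> gs_ball s r A B ?e"
    using assms(1,2) by (rule gs_ball_lincomb)
  moreover have "gs_ball s r A B ?e \<subseteq> gs_ball s r A B (?e + 1)"
    by (rule gs_ball_mono) (use assms(3,4) e in linarith)+
  ultimately have "(\<lambda>x. a * f x + a' * h x) \<in> gs_ball s r A B (?e + 1)"
    by (rule rev_subsetD)
  moreover have "?e + 1 > 0" using e by linarith
  ultimately show ?thesis by blast
qed

lemma GS_space_lincomb:
  assumes "f \<in> GS_space s r" "h \<in> GS_space s r"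
  shows "(\<lambda>x. a * f x + a' * h x) \<in> GS_space s r"
proof -
  obtain A B c A' B' c' where *: "A > 0" "B > 0" "c > 0" "f \<in> gs_ball s r A B c"
    "A' > 0" "B' > 0" "c' > 0" "h \<in> gs_ball s r A' B' c'"
    using assms unfolding GS_space_def by blast
  have pos: "max A A' > 0" "max B B' > 0"
    using *(1,2) by (simp_all add: max_def)
  have f: "f \<in> gs_ball s r (max A A') (max B B') c"
    by (rule subsetD[OF gs_ball_mono *(4)]) (use *(1-3) in simp_all)
  have h: "h \<in> gs_ball s r (max A A') (max B B') c'"
    by (rule subsetD[OF gs_ball_mono *(8)]) (use *(5-7) in simp_all)
  obtain e where "e > 0" "(\<lambda>x. a * f x + a' * h x) \<in> gs_ball s r (max A A') (max B B') e"
    using gs_ball_lincomb'[OF f h pos *(3,7), of a a'] by (elim exE conjE)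
  with pos show ?thesis
    unfolding GS_space_def by (intro CollectI exI conjI)
qed

lemma Sigma11_space_lincomb:
  assumes "f \<in> Sigma11_space" "h \<in> Sigma11_space"
  shows "(\<lambda>x. a * f x + a' * h x) \<in> Sigma11_space"
proof -
  have "\<exists>e>0. (\<lambda>x. a * f x + a' * h x) \<in> gs_ball 1 1 A B e" if AB: "A > 0" "B > 0" for A B
  proof -
    obtain c d where "c > 0" "f \<in> gs_ball 1 1 A B c" "d > 0" "h \<in> gs_ball 1 1 A B d"
      using assms AB unfolding Sigma11_space_def by blast
    with AB show ?thesis by (intro gs_ball_lincomb')
  qed
  then show ?thesis
    using assms by (simp add: Sigma11_space_def schwartz_space_lincomb)
qed

lemma topspace_GS_topology: "topspace (GS_topology s r) = (GS_space s r :: ('a::euclidean_space \<Rightarrow> complex) set)"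
proof -
  let ?E = "GS_space s r :: ('a \<Rightarrow> complex) set"
  have add: "(\<lambda>x. f x + h x) \<in> ?E" if "f \<in> ?E" "h \<in> ?E" for f h
    using GS_space_lincomb[OF that, of 1 1] by simp
  have "abs_convex ?E"
    by (simp add: abs_convex_def GS_space_lincomb)
  moreover have "gs_ball s r A B 1 \<subseteq> ?E" if "A > 0" "B > 0" for A B
    using that zero_less_one unfolding GS_space_def by (intro subsetI CollectI exI conjI)
  then have "\<forall>A>0. \<forall>B>0. \<exists>c>0. gs_ball s r A B c \<subseteq> ?E"
    by (intro allI impI exI[of _ 1] conjI zero_less_one)
  ultimately have "openin (GS_topology s r) ?E"
    unfolding openin_GS_topology by (intro conjI ballI exI[of _ ?E]) (auto intro: add)
  from openin_subset[OF this] show ?thesis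
    using conjunct1[OF iffD1[OF openin_GS_topology openin_topspace]] by (intro subset_antisym)
qed

lemma topspace_Sigma11_topology:
  "topspace Sigma11_topology = (Sigma11_space :: ('a::euclidean_space \<Rightarrow> complex) set)"
proof -
  let ?E = "Sigma11_space :: ('a \<Rightarrow> complex) set"
  have "(\<lambda>x. f x + h x) \<in> ?E" if "f \<in> ?E" "h \<in> ?E" for f h
    using Sigma11_space_lincomb[OF that, of 1 1] by simp
  then have "openin Sigma11_topology ?E"
    unfolding openin_Sigma11_topology by (intro conjI ballI exI[of _ 1] zero_less_one) auto
  from openin_subset[OF this] show ?thesis
    using conjunct1[OF iffD1[OF openin_Sigma11_topology openin_topspace]] by (intro subset_antisym)
qed

end

theory Submission
  imports Defs "HOL-Probability.Probability"
begin

text \<open>Write \<open>\<Phi> = W(g,g)\<close>. By covariance of the Wigner distribution, \<open>|\<langle>\<sigma>\<^sup>w \<pi>(z)g, \<pi>(w)g\<rangle>|\<close> is the modulus of the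
  Fourier transform of the localised symbol \<open>\<sigma> \<cdot> cnj \<Phi>(\<cdot> - u)\<close>, \<open>u = (w + z)/2\<close>, at a point \<open>\<zeta>\<close> which is \<open>w - z\<close> up to
  a rotation. Given bounds on the derivatives of \<open>\<sigma>\<close>, integration by parts bounds \<open>|\<zeta>|\<^sup>k\<close> times this transform by
  \<open>c m(u) C\<^sup>k (k!)\<^sup>s\<close> for all \<open>k\<close>, which is the decay in (ii). Conversely, the decay in (ii) and Fourier inversion
  bound all derivatives of \<open>\<sigma> \<cdot> cnj \<Phi>(\<cdot> - u)\<close>, hence those of \<open>\<sigma> \<cdot> |\<Phi>(\<cdot> - u)|\<^sup>2\<close>; integrating the latter over \<open>u\<close>
  gives the derivatives of \<open>\<sigma>\<close> times \<open>\<parallel>\<Phi>\<parallel>\<^sup>2\<close>.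

  That \<open>\<Phi>\<close> inherits the Gelfand-Shilov regularity of \<open>g\<close> is seen on words in the operators \<open>x\<^sub>b\<close> and \<open>\<partial>\<^sub>b\<close>: membership in
  the space means that every word of length \<open>n\<close> maps the function to one bounded by \<open>c A\<^sup>n (n!)\<^sup>s\<close>, and each letter
  applied to \<open>W(f,h)\<close> is a combination of two terms \<open>W(f',h)\<close> and \<open>W(f,h')\<close>, with \<open>f'\<close>, \<open>h'\<close> arising from \<open>f\<close>, \<open>h\<close>
  by one letter.\<close>

section \<open>Iterated partial derivatives of smooth functions\<close>

text \<open>Exchanging \<open>m t\<close> for \<open>m z\<close> costs a factor
  \<open>v (t - z)\<close>, so the localised estimates depend on the window absorbing
  \<open>v\<close>. The hypotheses on \<open>g\<close> and \<open>v\<close> serve to secure this.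
  For s < 1 a submultiplicative weight, being at most exponential, stays below a multiple of
  exp(\<epsilon> |z|^(1/s)) for every \<epsilon>; for s \<ge> 1 this is either assumed or replaced
  by a window in \<open>Sigma11_space\<close>, which outruns every exponential. The common outcome
  is \<open>admissible_window\<close>. In the last case the rate A must be made small, so rates are
  tracked exactly instead of being enlarged at will. The passage between factorial and exponential
  bounds is elementary: bounds c A^k (k!)^s on y^k F for all k amount to F being of order
  exp(-\<epsilon> y^(1/s)), by summing an exponential series of (1/s)-th powers. The second factor
  \<Phi> in the converse avoids a division by \<Phi>, which may have zeros. It also absorbs the
  \<open>v (t - z)\<close> met in returning from the centre z to t, and leaves a function integrable
  in z. The norm of \<Phi> is positive because W(g,g) vanishes identically only for g = 0.\<close>

lemma partial_deriv_eqI: "(f has_derivative f') (at x) \<Longrightarrow> partial_deriv b f x = f' b"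
  unfolding partial_deriv_def by (metis frechet_derivative_at)

lemma C_infinity_has_derivative:
  assumes "f \<in> C_infinity"
  shows "(f has_derivative (\<lambda>v. \<Sum>b\<in>Basis. (v \<bullet> b) *\<^sub>R partial_deriv b f x)) (at x)"
proof -
  have d: "(f has_derivative frechet_derivative f (at x)) (at x)"
    using C_infinity_differentiable[OF assms] by (auto simp: differentiable_on_def frechet_derivative_works)
  then interpret bounded_linear "frechet_derivative f (at x)"
    by (rule has_derivative_bounded_linear)
  have "frechet_derivative f (at x) = (\<lambda>v. \<Sum>b\<in>Basis. (v \<bullet> b) *\<^sub>R partial_deriv b f x)"
  proof
    fix v
    have "frechet_derivative f (at x) v = frechet_derivative f (at x) (\<Sum>b\<in>Basis. (v \<bullet> b) *\<^sub>R b)"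
      by (simp add: euclidean_representation)
    then show "frechet_derivative f (at x) v = (\<Sum>b\<in>Basis. (v \<bullet> b) *\<^sub>R partial_deriv b f x)"
      by (simp add: sum scaleR partial_deriv_def)
  qed
  with d show ?thesis by simp
qed

lemma C_infinity_has_vector_derivative:
  assumes "f \<in> C_infinity" "b \<in> Basis"
  shows "((\<lambda>r. f (x + r *\<^sub>R b)) has_vector_derivative partial_deriv b f (x + r *\<^sub>R b)) (at r within S)"
proof -
  have fd: "(f has_derivative frechet_derivative f (at y)) (at y)" for y
    using C_infinity_differentiable[OF assms(1)] by (auto simp: differentiable_on_def frechet_derivative_works)
  moreover have "((\<lambda>r. x + r *\<^sub>R b) has_derivative (\<lambda>r'. r' *\<^sub>R b)) (at r)"
    by (auto intro!: derivative_eq_intros)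
  ultimately have "((\<lambda>r. f (x + r *\<^sub>R b)) has_derivative
      (\<lambda>r'. frechet_derivative f (at (x + r *\<^sub>R b)) (r' *\<^sub>R b))) (at r)"
    using has_derivative_compose by blast
  moreover have "frechet_derivative f (at y) (r' *\<^sub>R b) = r' *\<^sub>R partial_deriv b f y" for y r'
    unfolding partial_deriv_def using linear_scale[OF has_derivative_linear[OF fd]] by blast
  ultimately show ?thesis
    by (auto simp: has_vector_derivative_def intro: has_derivative_at_withinI)
qed

lemma C_infinity_continuous: "f \<in> C_infinity \<Longrightarrow> continuous_on S f"
  using C_infinity_differentiable differentiable_imp_continuous_on continuous_on_subset by blast

lemma C_infinity_isCont: "f \<in> C_infinity \<Longrightarrow> isCont f x"
  using C_infinity_continuous[of f UNIV] by (simp add: continuous_on_eq_continuous_at)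

lemma C_infinity_measurable: "f \<in> C_infinity \<Longrightarrow> f \<in> borel_measurable borel"
  by (intro borel_measurable_continuous_onI C_infinity_continuous)

section \<open>Symmetry of second derivatives\<close>

lemma scaleR_has_vector_derivative: "((\<lambda>t. t *\<^sub>R c) has_vector_derivative c) (at t within S)"
  unfolding has_vector_derivative_def by (rule has_derivative_scaleR_left, rule has_derivative_ident)

lemma mean_value_bound:
  fixes \<psi> :: "real \<Rightarrow> complex"
  assumes "\<And>r. r \<in> {0..h} \<Longrightarrow> (\<psi> has_vector_derivative \<psi>' r) (at r within {0..h})"
    and "\<And>r. r \<in> {0..h} \<Longrightarrow> cmod (\<psi>' r) \<le> K" and "h \<ge> 0"
  shows "cmod (\<psi> h - \<psi> 0) \<le> K * h"
proof -
  have "cmod (\<psi> h - \<psi> 0) \<le> K * norm (h - 0)"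
  proof (rule differentiable_bound[where S = "{0..h}" and f' = "\<lambda>r v. v *\<^sub>R \<psi>' r"])
    show "onorm (\<lambda>v. v *\<^sub>R \<psi>' r) \<le> K" if "r \<in> {0..h}" for r
      using assms(2)[OF that] by (intro onorm_le) (simp add: mult.commute[of K] mult_left_mono)
  qed (use assms in \<open>auto simp: has_vector_derivative_def\<close>)
  with assms(3) show ?thesis by simp
qed

text \<open>The mean value inequality is applied twice: in direction \<open>b\<close> to
  \<open>partial_deriv a f\<close>, then in direction \<open>a\<close> to the difference of
  \<open>f\<close> along two parallel segments, each time after subtracting the linear term that
  \<open>c\<close> predicts.\<close>

lemma second_difference_bound:
  fixes f :: "'a::euclidean_space \<Rightarrow> complex"
  assumes f: "f \<in> C_infinity" and ab: "a \<in> Basis" "b \<in> Basis" and h: "h \<ge> 0"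
    and bd: "\<And>y. norm (y - x) \<le> 2 * h \<Longrightarrow> cmod (partial_deriv b (partial_deriv a f) y - c) \<le> e"
  shows "cmod (f (x + h *\<^sub>R a + h *\<^sub>R b) - f (x + h *\<^sub>R a) - f (x + h *\<^sub>R b) + f x - of_real (h * h) * c) \<le> e * h * h"
proof -
  have fa: "partial_deriv a f \<in> C_infinity" using f ab by (simp add: C_infinity_partial_deriv)
  define \<psi> where "\<psi> r = f (x + h *\<^sub>R b + r *\<^sub>R a) - f (x + r *\<^sub>R a) - r *\<^sub>R (h *\<^sub>R c)" for r
  have inner: "cmod (partial_deriv a f (x + h *\<^sub>R b + r *\<^sub>R a) - partial_deriv a f (x + r *\<^sub>R a) - h *\<^sub>R c) \<le> e * h"
    if r: "r \<in> {0..h}" for r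
  proof -
    let ?\<chi> = "\<lambda>t. partial_deriv a f (x + r *\<^sub>R a + t *\<^sub>R b) - t *\<^sub>R c"
    have "cmod (?\<chi> h - ?\<chi> 0) \<le> e * h"
    proof (rule mean_value_bound[OF _ _ h])
      fix t assume t: "t \<in> {0..h}"
      show "(?\<chi> has_vector_derivative partial_deriv b (partial_deriv a f) (x + r *\<^sub>R a + t *\<^sub>R b) - c) (at t within {0..h})"
        by (rule has_vector_derivative_diff[OF C_infinity_has_vector_derivative[OF fa ab(2)] scaleR_has_vector_derivative])
      have "norm (r *\<^sub>R a + t *\<^sub>R b) \<le> norm (r *\<^sub>R a) + norm (t *\<^sub>R b)" by (rule norm_triangle_ineq)
      also have "\<dots> \<le> 2 * h" using r t ab by (simp)
      finally show "cmod (partial_deriv b (partial_deriv a f) (x + r *\<^sub>R a + t *\<^sub>R b) - c) \<le> e"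
        by (intro bd) (simp add: algebra_simps)
    qed
    then show ?thesis by (simp add: algebra_simps)
  qed
  have "cmod (\<psi> h - \<psi> 0) \<le> e * h * h"
  proof (rule mean_value_bound[OF _ inner h])
    fix r
    show "(\<psi> has_vector_derivative partial_deriv a f (x + h *\<^sub>R b + r *\<^sub>R a) - partial_deriv a f (x + r *\<^sub>R a) - h *\<^sub>R c) (at r within {0..h})"
      unfolding \<psi>_def
      by (rule has_vector_derivative_diff[OF has_vector_derivative_diff[OF C_infinity_has_vector_derivative[OF f ab(1)]
          C_infinity_has_vector_derivative[OF f ab(1)]] scaleR_has_vector_derivative])
  qed
  then show ?thesis by (simp add: \<psi>_def algebra_simps scaleR_conv_of_real)
qed

text \<open>The second difference is symmetric in \<open>a\<close> and \<open>b\<close>. Divided by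
  \<open>h * h\<close> it approximates either mixed derivative at \<open>x\<close>, both being
  continuous, so the two values agree.\<close>

theorem partial_deriv_commute:
  assumes f: "f \<in> C_infinity" and ab: "a \<in> Basis" "b \<in> Basis"
  shows "partial_deriv a (partial_deriv b f) = partial_deriv b (partial_deriv a f)"
proof
  fix x
  let ?c = "partial_deriv a (partial_deriv b f)" and ?d = "partial_deriv b (partial_deriv a f)"
  have cont: "continuous (at x) ?c" "continuous (at x) ?d"
    by (intro C_infinity_isCont C_infinity_partial_deriv f ab)+
  have "cmod (?c x - ?d x) \<le> 2 * e" if e: "e > 0" for e
  proof -
    obtain r1 where r1: "r1 > 0" "\<And>y. dist y x < r1 \<Longrightarrow> dist (?c y) (?c x) < e"
      using cont(1) e unfolding continuous_at_eps_delta by blast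
    obtain r2 where r2: "r2 > 0" "\<And>y. dist y x < r2 \<Longrightarrow> dist (?d y) (?d x) < e"
      using cont(2) e unfolding continuous_at_eps_delta by blast
    \<comment> \<open>One third keeps the radius \<open>2 * h\<close> of the second difference
      inside both continuity neighbourhoods.\<close>
    define h where "h = min r1 r2 / 3"
    have h: "h > 0" "2 * h < r1" "2 * h < r2" using r1 r2 by (auto simp: h_def min_def)
    let ?D = "f (x + h *\<^sub>R a + h *\<^sub>R b) - f (x + h *\<^sub>R a) - f (x + h *\<^sub>R b) + f x"
    have "cmod (?D - of_real (h * h) * ?d x) \<le> e * h * h"
    proof (rule second_difference_bound[OF f ab])
      show "cmod (?d y - ?d x) \<le> e" if "norm (y - x) \<le> 2 * h" for y
        using r2(2)[of y] h that by (simp add: dist_norm)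
    qed (use h in simp)
    moreover have "cmod (f (x + h *\<^sub>R b + h *\<^sub>R a) - f (x + h *\<^sub>R b) - f (x + h *\<^sub>R a) + f x - of_real (h * h) * ?c x) \<le> e * h * h"
    proof (rule second_difference_bound[OF f ab(2,1)])
      show "cmod (?c y - ?c x) \<le> e" if "norm (y - x) \<le> 2 * h" for y
        using r1(2)[of y] h that by (simp add: dist_norm)
    qed (use h in simp)
    then have "cmod (?D - of_real (h * h) * ?c x) \<le> e * h * h"
      by (simp add: algebra_simps)
    ultimately have "cmod ((?D - of_real (h * h) * ?d x) - (?D - of_real (h * h) * ?c x)) \<le> 2 * e * h * h"
      using norm_triangle_ineq4[of "?D - of_real (h * h) * ?d x" "?D - of_real (h * h) * ?c x"] by linarith
    also have "(?D - of_real (h * h) * ?d x) - (?D - of_real (h * h) * ?c x) = of_real (h * h) * (?c x - ?d x)"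
      by (simp add: algebra_simps)
    finally have "(h * h) * cmod (?c x - ?d x) \<le> (h * h) * (2 * e)"
      unfolding norm_mult norm_of_real using h by (simp only: abs_of_pos mult_pos_pos mult_ac)
    then show ?thesis using h by simp
  qed
  then have "cmod (?c x - ?d x) \<le> 0 + e" if "e > 0" for e
    using that[THEN half_gt_zero] by fastforce
  then have "cmod (?c x - ?d x) \<le> 0" by (rule field_le_epsilon)
  then show "?c x = ?d x" by simp
qed

text \<open>Replaces inductions over \<open>C_k\<close>: a smoothness proof only has to name a class
  of functions that partial derivatives do not leave.\<close>

lemma C_infinity_coinduct:
  assumes "P f"
    and "\<And>f. P f \<Longrightarrow> f differentiable_on UNIV \<and> (\<forall>b\<in>Basis. P (partial_deriv b f))"
  shows "f \<in> C_infinity"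
proof -
  have "P f \<Longrightarrow> C_k k f" for k f
    by (induction k arbitrary: f) (use assms(2) differentiable_imp_continuous_on in \<open>auto\<close>)
  with assms(1) show ?thesis by (simp add: C_infinity_def)
qed

section \<open>Coordinates, products, conjugates and translates of smooth functions\<close>

lemma partial_deriv_const: "partial_deriv b (\<lambda>x. c) = (\<lambda>x. 0)"
  by (rule ext) (rule partial_deriv_eqI[of _ "\<lambda>_. 0"], simp)

lemma partial_deriv_coord: "partial_deriv b (\<lambda>x. of_real (x \<bullet> a)) = (\<lambda>x. of_real (b \<bullet> a))"
  by (rule ext) (rule partial_deriv_eqI, auto intro!: derivative_eq_intros)

lemma C_infinity_coord [simp]: "(\<lambda>x. of_real (x \<bullet> a)) \<in> C_infinity"
\<comment> \<open>The constants join the class because they are the derivatives of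
  coordinates.\<close>
proof (rule C_infinity_coinduct[of "\<lambda>f. f = (\<lambda>x. of_real (x \<bullet> a)) \<or> (\<exists>c. f = (\<lambda>x. c))"], blast)
  fix f :: "'a \<Rightarrow> complex"
  have "(\<lambda>x::'a. complex_of_real (x \<bullet> a)) differentiable_on UNIV"
    by (intro differentiable_at_imp_differentiable_on differentiableI)
      (rule bounded_linear.has_derivative[OF bounded_linear_of_real], rule has_derivative_inner_left, rule has_derivative_ident)
  then show "f = (\<lambda>x. of_real (x \<bullet> a)) \<or> (\<exists>c. f = (\<lambda>x. c)) \<Longrightarrow> f differentiable_on UNIV \<and>
      (\<forall>b\<in>Basis. partial_deriv b f = (\<lambda>x. of_real (x \<bullet> a)) \<or> (\<exists>c. partial_deriv b f = (\<lambda>x. c)))"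
    by (auto simp: partial_deriv_const partial_deriv_coord)
qed

lemma partial_deriv_mult:
  assumes "f differentiable_on UNIV" "h differentiable_on UNIV"
  shows "partial_deriv b (\<lambda>x. f x * h x) = (\<lambda>x. partial_deriv b f x * h x + f x * partial_deriv b h x)"
proof
  fix x
  have "(f has_derivative frechet_derivative f (at x)) (at x)"
    "(h has_derivative frechet_derivative h (at x)) (at x)"
    using assms by (auto simp: differentiable_on_def frechet_derivative_works)
  from has_derivative_mult[OF this]
  have "partial_deriv b (\<lambda>x. f x * h x) x =
      f x * frechet_derivative h (at x) b + frechet_derivative f (at x) b * h x"
    by (rule partial_deriv_eqI)
  then show "partial_deriv b (\<lambda>x. f x * h x) x = partial_deriv b f x * h x + f x * partial_deriv b h x"
    unfolding partial_deriv_def by (simp only: add.commute)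
qed

text \<open>The Leibniz rule leaves one factor undifferentiated, and that factor has to be used at
  the lower order.\<close>

lemma C_k_Suc_imp: "C_k (Suc k) f \<Longrightarrow> C_k k f"
proof (induction k arbitrary: f)
  case 0
  then show ?case by (simp add: differentiable_imp_continuous_on)
next
  case (Suc k)
  from Suc.prems have "f differentiable_on UNIV" "\<And>b. b \<in> Basis \<Longrightarrow> C_k (Suc k) (partial_deriv b f)"
    unfolding C_k.simps(2)[of "Suc k" f] by blast+
  then show ?case unfolding C_k.simps(2)[of k f] using Suc.IH by blast
qed

lemma C_k_add: "C_k k f \<Longrightarrow> C_k k h \<Longrightarrow> C_k k (\<lambda>x. f x + h x)"
  using C_k_lincomb[of k f h 1 1] by simp

lemma C_k_mult: "C_k k f \<Longrightarrow> C_k k h \<Longrightarrow> C_k k (\<lambda>x. f x * h x)"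
proof (induction k arbitrary: f h)
  case 0
  then show ?case by (simp add: continuous_on_mult)
next
  case (Suc k)
  have "C_k k f" "C_k k h" using Suc.prems C_k_Suc_imp by blast+
  with Suc show ?case
    by (simp add: partial_deriv_mult differentiable_on_mult C_k_add)
qed

lemma C_infinity_mult: "f \<in> C_infinity \<Longrightarrow> h \<in> C_infinity \<Longrightarrow> (\<lambda>x. f x * h x) \<in> C_infinity"
  by (simp add: C_infinity_def C_k_mult)

lemma partial_deriv_cnj:
  assumes "f differentiable_on UNIV"
  shows "partial_deriv b (\<lambda>x. cnj (f x)) = (\<lambda>x. cnj (partial_deriv b f x))"
proof
  fix x
  have "(f has_derivative frechet_derivative f (at x)) (at x)"
    using assms by (auto simp: differentiable_on_def frechet_derivative_works)
  from partial_deriv_eqI[OF bounded_linear.has_derivative[OF bounded_linear_cnj this]]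
  show "partial_deriv b (\<lambda>x. cnj (f x)) x = cnj (partial_deriv b f x)"
    by (simp add: partial_deriv_def)
qed

lemma C_infinity_cnj:
  assumes "f \<in> C_infinity"
  shows "(\<lambda>x. cnj (f x)) \<in> C_infinity"
proof (rule C_infinity_coinduct[of "\<lambda>g. \<exists>f. g = (\<lambda>x. cnj (f x)) \<and> f \<in> C_infinity"])
  show "\<exists>h. (\<lambda>x. cnj (f x)) = (\<lambda>x. cnj (h x)) \<and> h \<in> C_infinity"
    using assms by (intro exI[of _ f]) simp
  fix g :: "'a \<Rightarrow> complex"
  assume "\<exists>f. g = (\<lambda>x. cnj (f x)) \<and> f \<in> C_infinity"
  then obtain f where f: "g = (\<lambda>x. cnj (f x))" "f \<in> C_infinity" by blast
  then have fd: "f differentiable_on UNIV" by (simp add: C_infinity_differentiable)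
  then have "g differentiable_on UNIV"
    unfolding f differentiable_on_def differentiable_def
    using bounded_linear.has_derivative[OF bounded_linear_cnj] by blast
  then show "g differentiable_on UNIV \<and> (\<forall>b\<in>Basis. \<exists>f. partial_deriv b g = (\<lambda>x. cnj (f x)) \<and> f \<in> C_infinity)"
    using f fd partial_deriv_cnj[OF fd] C_infinity_partial_deriv[OF f(2)] by metis
qed

lemma has_derivative_diff_const: "(f has_derivative f') F \<Longrightarrow> ((\<lambda>x. f x - c) has_derivative f') F"
  using has_derivative_diff[OF _ has_derivative_const, of f f' F c] by simp

lemma partial_deriv_translate:
  assumes "f differentiable_on UNIV"
  shows "partial_deriv b (\<lambda>x. f (x - z)) = (\<lambda>x. partial_deriv b f (x - z))"
proof
  fix x
  have "(f has_derivative frechet_derivative f (at (x - z))) (at (x - z))"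
    using assms by (auto simp: differentiable_on_def frechet_derivative_works)
  then have "((\<lambda>x. f (x - z)) has_derivative frechet_derivative f (at (x - z))) (at x)"
    by (rule has_derivative_compose[OF has_derivative_diff_const[OF has_derivative_ident]])
  from partial_deriv_eqI[OF this]
  show "partial_deriv b (\<lambda>x. f (x - z)) x = partial_deriv b f (x - z)"
    by (simp add: partial_deriv_def)
qed

lemma C_infinity_translate:
  assumes "f \<in> C_infinity"
  shows "(\<lambda>x. f (x - z)) \<in> C_infinity"
proof (rule C_infinity_coinduct[of "\<lambda>g. \<exists>f. g = (\<lambda>x. f (x - z)) \<and> f \<in> C_infinity"])
  show "\<exists>h. (\<lambda>x. f (x - z)) = (\<lambda>x. h (x - z)) \<and> h \<in> C_infinity"
    using assms by (intro exI[of _ f]) simp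
  fix g :: "'a \<Rightarrow> complex"
  assume "\<exists>f. g = (\<lambda>x. f (x - z)) \<and> f \<in> C_infinity"
  then obtain f where f: "g = (\<lambda>x. f (x - z))" "f \<in> C_infinity" by blast
  then have fd: "f differentiable_on UNIV" by (simp add: C_infinity_differentiable)
  then have "(f has_derivative frechet_derivative f (at x)) (at x)" for x
    by (auto simp: differentiable_on_def frechet_derivative_works)
  then have "((\<lambda>x. f (x - z)) has_derivative frechet_derivative f (at (x - z))) (at x)" for x
    by (rule has_derivative_compose[OF has_derivative_diff_const[OF has_derivative_ident]])
  then have "g differentiable_on UNIV"
    unfolding f differentiable_on_def differentiable_def by auto
  then show "g differentiable_on UNIV \<and> (\<forall>b\<in>Basis. \<exists>f. partial_deriv b g = (\<lambda>x. f (x - z)) \<and> f \<in> C_infinity)"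
    using f fd partial_deriv_translate[OF fd] C_infinity_partial_deriv[OF f(2)] by metis
qed

text \<open>Lists of directions compose by concatenation, so an induction can peel off a single
  derivative at either end; with \<open>mi_deriv\<close> the fixed order of the basis would be in
  the way.\<close>

definition list_deriv :: "'a::euclidean_space list \<Rightarrow> ('a \<Rightarrow> complex) \<Rightarrow> 'a \<Rightarrow> complex" where
  "list_deriv L f = foldr partial_deriv L f"

lemma list_deriv_simps [simp]:
  "list_deriv [] f = f" "list_deriv (b # L) f = partial_deriv b (list_deriv L f)"
  "list_deriv (L @ M) f = list_deriv L (list_deriv M f)"
  by (simp_all add: list_deriv_def)

lemma C_infinity_list_deriv: "f \<in> C_infinity \<Longrightarrow> L \<in> lists Basis \<Longrightarrow> list_deriv L f \<in> C_infinity"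
  by (induction L) (auto intro: C_infinity_partial_deriv)

lemma list_deriv_move:
  assumes "f \<in> C_infinity" "L \<in> lists Basis" "b \<in> Basis"
  shows "list_deriv L (partial_deriv b f) = partial_deriv b (list_deriv L f)"
  using assms(2)
proof (induction L)
  case (Cons a L)
  then have L: "a \<in> Basis" "L \<in> lists Basis" by auto
  have "partial_deriv a (partial_deriv b (list_deriv L f)) = partial_deriv b (partial_deriv a (list_deriv L f))"
    by (intro partial_deriv_commute C_infinity_list_deriv assms L)
  with Cons.IH show ?case by simp
qed simp

text \<open>The head of \<open>L\<close> occurs somewhere in \<open>M\<close> and, by commutation,
  can be pulled to the front there.\<close>

lemma list_deriv_mset:
  assumes "f \<in> C_infinity" "L \<in> lists Basis" "mset L = mset M"
  shows "list_deriv L f = list_deriv M f"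
  using assms(2,3)
proof (induction L arbitrary: M rule: list.induct)
  case (Cons b L)
  from Cons.prems have "b \<in> set M" using mset_eq_setD by fastforce
  then obtain M1 M2 where M: "M = M1 @ b # M2" by (meson split_list)
  have "set M \<subseteq> Basis"
    using Cons.prems mset_eq_setD[OF Cons.prems(2)] by (auto simp: in_lists_conv_set)
  then have M12: "M1 \<in> lists Basis" "M2 \<in> lists Basis" "b \<in> Basis"
    by (auto simp: M in_lists_conv_set)
  have "list_deriv M f = partial_deriv b (list_deriv (M1 @ M2) f)"
    using M12 assms(1) by (simp add: M list_deriv_move C_infinity_list_deriv)
  also have "list_deriv (M1 @ M2) f = list_deriv L f"
    using Cons.prems by (intro Cons.IH[symmetric]) (simp_all add: M)
  finally show ?case by simp
qed auto

text \<open>The sorted word of a multi-index; \<open>count_list\<close> leads back. Up to a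
  permutation of letters the two maps are inverse to each other, which translates every estimate
  between the two notations.\<close>

definition mi_list :: "('a::euclidean_space \<Rightarrow> nat) \<Rightarrow> 'a list" where
  "mi_list \<alpha> = concat (map (\<lambda>b. replicate (\<alpha> b) b) basis_list)"

lemma mi_list_in_lists: "mi_list \<alpha> \<in> lists Basis"
  by (auto simp: mi_list_def in_lists_conv_set basis_list)

lemma mi_deriv_eq_list_deriv: "mi_deriv \<alpha> f = list_deriv (mi_list \<alpha>) f"
proof -
  have rep: "list_deriv (replicate n b) h = (partial_deriv b ^^ n) h" for n b and h :: "'a \<Rightarrow> complex"
    by (induction n) auto
  have "foldr (\<lambda>b h. (partial_deriv b ^^ \<alpha> b) h) bs f
      = list_deriv (concat (map (\<lambda>b. replicate (\<alpha> b) b) bs)) f" for bs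
    by (induction bs) (simp_all add: rep)
  then show ?thesis
    unfolding mi_deriv_def mi_list_def .
qed

lemma length_mi_list: "length (mi_list \<alpha>) = mi_size \<alpha>"
proof -
  have "length (mi_list \<alpha>) = sum_list (map \<alpha> basis_list)"
    by (simp add: mi_list_def length_concat comp_def)
  also have "\<dots> = mi_size \<alpha>"
    by (simp add: mi_size_def basis_list sum_list_distinct_conv_sum_set)
  finally show ?thesis .
qed

lemma count_mi_list:
  assumes "b \<in> Basis"
  shows "count_list (mi_list \<alpha>) b = \<alpha> b"
proof -
  have rep: "count_list (replicate n c) b = (if c = b then n else 0)" for n c
    by (induction n) auto
  have "count_list (concat (map (\<lambda>b. replicate (\<alpha> b) b) bs)) b = (if b \<in> set bs then \<alpha> b else 0)"
    if "distinct bs" for bs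
    using that by (induction bs) (auto simp: count_list_append rep)
  then show ?thesis using assms by (simp add: mi_list_def basis_list)
qed

lemma mset_mi_list_count:
  assumes "L \<in> lists Basis"
  shows "mset (mi_list (count_list L)) = mset L"
proof (rule multiset_eqI)
  fix b
  show "count (mset (mi_list (count_list L))) b = count (mset L) b"
  proof (cases "b \<in> Basis")
    case True
    then show ?thesis by (simp add: count_mset count_mi_list)
  next
    case False
    then have "b \<notin> set (mi_list (count_list L))" "b \<notin> set L"
      using mi_list_in_lists[of "count_list L"] assms by (auto simp: in_lists_conv_set)
    then show ?thesis by (metis set_mset_mset not_in_iff)
  qed
qed

lemma list_deriv_eq_mi_deriv:
  assumes "f \<in> C_infinity" "L \<in> lists Basis"
  shows "list_deriv L f = mi_deriv (count_list L) f"
  unfolding mi_deriv_eq_list_deriv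
  by (rule list_deriv_mset[OF assms]) (simp add: mset_mi_list_count assms)

lemma mi_size_count: "L \<in> lists Basis \<Longrightarrow> mi_size (count_list L) = length L"
  by (metis length_mi_list mset_mi_list_count size_mset)

lemma mi_power_eq_prod_list: "mi_power x \<alpha> = (\<Prod>b\<leftarrow>mi_list \<alpha>. x \<bullet> b)"
proof -
  have "(\<Prod>b\<leftarrow>concat (map (\<lambda>b. replicate (\<alpha> b) b) bs). x \<bullet> b) = (\<Prod>b\<leftarrow>bs. (x \<bullet> b) ^ \<alpha> b)" for bs
    by (induction bs) (auto simp: prod_list_replicate)
  then show ?thesis
    unfolding mi_list_def mi_power_def
    by (simp add: basis_list flip: prod.distinct_set_conv_list)
qed

lemma mi_power_count: "L \<in> lists Basis \<Longrightarrow> mi_power x (count_list L) = (\<Prod>b\<leftarrow>L. x \<bullet> b)"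
  unfolding mi_power_eq_prod_list by (metis mset_mi_list_count prod_mset_prod_list mset_map)

section \<open>Gelfand-Shilov estimates for words in coordinates and derivatives\<close>

definition op_letter :: "bool \<times> 'a::euclidean_space \<Rightarrow> ('a \<Rightarrow> complex) \<Rightarrow> 'a \<Rightarrow> complex" where
  "op_letter l f = (if fst l then (\<lambda>x. of_real (x \<bullet> snd l) * f x) else partial_deriv (snd l) f)"

definition word_op :: "(bool \<times> 'a::euclidean_space) list \<Rightarrow> ('a \<Rightarrow> complex) \<Rightarrow> 'a \<Rightarrow> complex" where
  "word_op w f = foldr op_letter w f"

abbreviation words :: "(bool \<times> 'a::euclidean_space) list set" where
  "words \<equiv> lists (UNIV \<times> Basis)"

text \<open>Coordinates and derivatives may come in any order and only the length counts. This makes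
  the notion stable under applying further letters, a stability that bounds on x^\<alpha>
  \<partial>^\<beta> f alone do not display.\<close>

definition word_bounded :: "(nat \<Rightarrow> real) \<Rightarrow> ('a::euclidean_space \<Rightarrow> complex) \<Rightarrow> bool" where
  "word_bounded h f \<longleftrightarrow> f \<in> C_infinity \<and> (\<forall>w\<in>words. \<forall>x. cmod (word_op w f x) \<le> h (length w))"

lemma word_op_simps [simp]:
  "word_op [] f = f" "word_op (l # w) f = op_letter l (word_op w f)"
  "word_op (w @ u) f = word_op w (word_op u f)"
  by (simp_all add: word_op_def)

lemma op_letter_simps [simp]:
  "op_letter (True, b) f = (\<lambda>x. of_real (x \<bullet> b) * f x)" "op_letter (False, b) f = partial_deriv b f"
  by (simp_all add: op_letter_def)

lemma C_infinity_op_letter: "f \<in> C_infinity \<Longrightarrow> l \<in> UNIV \<times> Basis \<Longrightarrow> op_letter l f \<in> C_infinity"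
  by (auto simp: op_letter_def C_infinity_mult C_infinity_partial_deriv)

lemma C_infinity_word_op: "f \<in> C_infinity \<Longrightarrow> w \<in> words \<Longrightarrow> word_op w f \<in> C_infinity"
  by (induction w rule: list.induct) (simp_all add: C_infinity_op_letter del: mem_Sigma_iff)

lemma op_letter_lincomb:
  assumes "f \<in> C_infinity" "h \<in> C_infinity"
  shows "op_letter l (\<lambda>x. a * f x + a' * h x) = (\<lambda>x. a * op_letter l f x + a' * op_letter l h x)"
  using assms by (simp add: op_letter_def partial_deriv_lincomb C_infinity_differentiable algebra_simps)

lemma word_op_lincomb:
  assumes "f \<in> C_infinity" "h \<in> C_infinity" "w \<in> words"
  shows "word_op w (\<lambda>x. a * f x + a' * h x) = (\<lambda>x. a * word_op w f x + a' * word_op w h x)"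
  using assms(3)
proof (induction w rule: list.induct)
  case (Cons l w)
  then have "w \<in> words" by simp
  with Cons.IH assms show ?case
    by (simp add: op_letter_lincomb C_infinity_word_op)
qed simp

lemma word_bounded_word_op:
  assumes "word_bounded h f" "u \<in> words"
  shows "word_bounded (\<lambda>n. h (n + length u)) (word_op u f)"
  unfolding word_bounded_def
proof (intro conjI ballI allI)
  show "word_op u f \<in> C_infinity" using assms by (simp add: C_infinity_word_op word_bounded_def)
  fix w :: "(bool \<times> 'a) list" and x assume "w \<in> words"
  with assms have "w @ u \<in> words" by simp
  with assms have "cmod (word_op (w @ u) f x) \<le> h (length (w @ u))"
    unfolding word_bounded_def by blast
  then show "cmod (word_op w (word_op u f) x) \<le> h (length w + length u)" by simp
qed

definition mon_mult :: "'a::euclidean_space list \<Rightarrow> ('a \<Rightarrow> complex) \<Rightarrow> 'a \<Rightarrow> complex" where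
  "mon_mult J f = (\<lambda>x. of_real (\<Prod>b\<leftarrow>J. x \<bullet> b) * f x)"

lemma mon_mult_simps [simp]: "mon_mult [] f = f" "mon_mult (b # J) f = (\<lambda>x. of_real (x \<bullet> b) * mon_mult J f x)"
  by (auto simp: mon_mult_def)

lemma word_op_mon: "word_op (map (Pair True) J) f = mon_mult J f"
  by (induction J) auto

lemma word_op_deriv: "word_op (map (Pair False) L) f = list_deriv L f"
  by (induction L) auto

lemma C_infinity_mon_mult: "f \<in> C_infinity \<Longrightarrow> mon_mult J f \<in> C_infinity"
  by (induction J) (auto intro: C_infinity_mult)

text \<open>The derivative is moved past the coordinates one at a time. Each commutator deletes one
  coordinate and has coefficient 0 or 1, so it costs at most \<open>K\<close>. The list
  \<open>I\<close> collects the coordinates already passed, which the induction needs in general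
  position.\<close>

lemma word_op_partial_deriv_mon_mult:
  fixes K :: real
  assumes f: "f \<in> C_infinity" and b: "b \<in> Basis" and w: "w \<in> words" and J: "J \<in> lists Basis" and I: "I \<in> lists Basis"
    and K: "\<And>J'. J' \<in> lists Basis \<Longrightarrow> Suc (length J') = length I + length J \<Longrightarrow> cmod (word_op w (mon_mult J' f) x) \<le> K"
  shows "cmod (word_op w (mon_mult I (partial_deriv b (mon_mult J f))) x)
    \<le> cmod (word_op w (mon_mult (I @ J) (partial_deriv b f)) x) + length J * K"
  using J I K
proof (induction J arbitrary: I rule: list.induct)
  case (Cons a J)
  have aJ: "a \<in> Basis" "J \<in> lists Basis" using Cons.prems by auto
  have mJ: "mon_mult J f \<in> C_infinity" using f by (rule C_infinity_mon_mult)
  have "partial_deriv b (mon_mult (a # J) f)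
      = (\<lambda>x. of_real (b \<bullet> a) * mon_mult J f x + of_real (x \<bullet> a) * partial_deriv b (mon_mult J f) x)"
    using mJ by (simp add: partial_deriv_mult partial_deriv_coord C_infinity_differentiable)
  then have "mon_mult I (partial_deriv b (mon_mult (a # J) f)) =
      (\<lambda>x. of_real (b \<bullet> a) * mon_mult (I @ J) f x + 1 * mon_mult (I @ [a]) (partial_deriv b (mon_mult J f)) x)"
    by (auto simp: mon_mult_def algebra_simps)
  then have "word_op w (mon_mult I (partial_deriv b (mon_mult (a # J) f))) x =
      of_real (b \<bullet> a) * word_op w (mon_mult (I @ J) f) x
      + 1 * word_op w (mon_mult (I @ [a]) (partial_deriv b (mon_mult J f))) x"
    using f mJ b w
    by (simp only:) (subst word_op_lincomb, auto intro: C_infinity_mon_mult C_infinity_partial_deriv)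
  also have "cmod \<dots> \<le> cmod (of_real (b \<bullet> a) * word_op w (mon_mult (I @ J) f) x)
      + cmod (word_op w (mon_mult (I @ [a]) (partial_deriv b (mon_mult J f))) x)"
    using norm_triangle_ineq by (metis mult_1)
  also have "cmod (of_real (b \<bullet> a) * word_op w (mon_mult (I @ J) f) x) \<le> 1 * K"
    unfolding norm_mult
    using aJ b Cons.prems by (intro mult_mono Cons.prems(3)) (auto simp: inner_Basis)
  also have "cmod (word_op w (mon_mult (I @ [a]) (partial_deriv b (mon_mult J f))) x)
      \<le> cmod (word_op w (mon_mult ((I @ [a]) @ J) (partial_deriv b f)) x) + length J * K"
    using aJ Cons.prems by (intro Cons.IH) auto
  finally show ?case by (simp add: algebra_simps)
qed simp

text \<open>The growth condition on \<open>h\<close> pays for the commutators \<open>[\<partial>\<^sub>b, x\<^sub>b] = 1\<close>; for \<open>h n = c A\<^sup>n (n!)\<^sup>s\<close> with \<open>A \<ge> 1\<close> it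
  is where \<open>s \<ge> 1/2\<close> is needed.\<close>

lemma normal_ordering:
  assumes f: "f \<in> C_infinity"
    and nb: "\<And>J L x. J \<in> lists Basis \<Longrightarrow> L \<in> lists Basis \<Longrightarrow>
      cmod (mon_mult J (list_deriv L f) x) \<le> h (length J + length L)"
    and h: "\<And>n. real (Suc n) * h n \<le> h (n + 2)"
  shows "word_bounded (\<lambda>n. 2 ^ n * h n) f"
proof -
  \<comment> \<open>Nonnegativity of \<open>h n\<close> is read off from \<open>nb\<close> for a
    monomial of degree n.\<close>
  have h0: "0 \<le> h n" for n
  proof -
    have "J \<in> lists Basis" if "J = replicate n (SOME b. b \<in> Basis)" for J :: "'a list"
      using that some_in_eq[of "Basis :: 'a set"] by (auto simp: in_lists_conv_set)
    from nb[OF this[OF refl] lists.Nil, of undefined] show ?thesis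
      by (simp, smt (verit) norm_ge_zero)
  qed
  have "cmod (word_op w (mon_mult J (list_deriv L f)) x) \<le> 2 ^ length w * h (length w + length J + length L)"
    if "w \<in> words" "J \<in> lists Basis" "L \<in> lists Basis" for w J L x
    using that
  \<comment> \<open>The last letter of \<open>w\<close> is the one adjacent to the normally ordered
    part x^J \<partial>^L. A coordinate simply joins J, a derivative first crosses J; either way at
    most a factor 2 is lost per letter.\<close>
  proof (induction w arbitrary: J L rule: rev_induct)
    case Nil
    then show ?case using nb by simp
  next
    case (snoc l w)
    then have w: "w \<in> words" and l: "snd l \<in> Basis" by auto
    note JL = snoc.prems(2,3)
    let ?n = "length w + length J + length L"
    obtain d b where lb: "l = (d, b)" "b \<in> Basis" using l by (cases l) auto
    show ?case
    proof (cases d)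
      case True
      have "cmod (word_op w (mon_mult (b # J) (list_deriv L f)) x) \<le> 2 ^ length w * h (length w + length (b # J) + length L)"
        using w lb JL by (intro snoc.IH) auto
      also have "\<dots> \<le> 2 ^ length (w @ [l]) * h (length (w @ [l]) + length J + length L)"
        using h0 by (simp add: mult_right_mono)
      finally show ?thesis using True lb by simp
    next
      case False
      \<comment> \<open>For empty \<open>J\<close> there are no commutators; the value 0 keeps the
        truncated difference \<open>?n - 1\<close> out of that case.\<close>
      define K where "K = (if J = [] then 0 else 2 ^ length w * h (?n - 1))"
      have "cmod (word_op w (mon_mult [] (partial_deriv b (mon_mult J (list_deriv L f)))) x)
        \<le> cmod (word_op w (mon_mult ([] @ J) (partial_deriv b (list_deriv L f))) x) + length J * K"
      proof (rule word_op_partial_deriv_mon_mult)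
        fix J' :: "'a list" assume J': "J' \<in> lists Basis" "Suc (length J') = length ([]::'a list) + length J"
        then have "cmod (word_op w (mon_mult J' (list_deriv L f)) x) \<le> 2 ^ length w * h (length w + length J' + length L)"
          using w JL by (intro snoc.IH) auto
        moreover have "J \<noteq> []" "length w + length J' + length L = ?n - 1" using J' by auto
        ultimately show "cmod (word_op w (mon_mult J' (list_deriv L f)) x) \<le> K" by (simp add: K_def)
      qed (use w JL lb f C_infinity_list_deriv in auto)
      also have "cmod (word_op w (mon_mult ([] @ J) (partial_deriv b (list_deriv L f))) x)
          \<le> 2 ^ length w * h (length w + length J + length (b # L))"
        using snoc.IH[of J "b # L"] w JL lb by simp
      also have "length J * K \<le> 2 ^ length w * h (?n + 1)"
      proof (cases "J = []")
        case False
        have "real (length J) * h (?n - 1) \<le> real (Suc (?n - 1)) * h (?n - 1)"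
          using h0 False by (intro mult_right_mono) auto
        also have "\<dots> \<le> h (?n - 1 + 2)" by (rule h)
        also have "?n - 1 + 2 = ?n + 1" using False by (cases J) auto
        finally show ?thesis using False by (simp add: K_def mult.left_commute)
      qed (simp add: K_def h0)
      finally show ?thesis using False lb by simp
    qed
  qed
  from this[of _ "[]" "[]"] f show ?thesis by (simp add: word_bounded_def)
qed

section \<open>Powers of factorials, of integers and of multi-indices\<close>

definition fact_pow :: "real \<Rightarrow> nat \<Rightarrow> real" where
  "fact_pow s n = fact n powr s"

lemma fact_pow_pos [simp]: "fact_pow s n > 0" "fact_pow s n \<ge> 0" "fact_pow s n \<noteq> 0"
  by (simp_all add: fact_pow_def)

lemma fact_pow_0 [simp]: "fact_pow s 0 = 1" by (simp add: fact_pow_def)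

lemma fact_pow_1 [simp]: "fact_pow 1 n = fact n" by (simp add: fact_pow_def)

lemma fact_mult_le: "fact a * fact b \<le> (fact (a + b) :: real)"
proof -
  have "fact a * fact b \<le> (fact (a + b) :: nat)"
    by (intro dvd_imp_le fact_fact_dvd_fact) simp
  then show ?thesis by (metis of_nat_fact of_nat_le_iff of_nat_mult)
qed

text \<open>The binomial coefficient is at most 2^(a + b). Factorials are thus multiplicative up to
  a geometric factor, which the base of an estimate can absorb.\<close>

lemma fact_add_le: "fact (a + b) \<le> (2 ^ (a + b) * (fact a * fact b) :: real)"
proof -
  have "(fact (a + b) :: nat) = ((a + b) choose a) * (fact a * fact b)"
    using binomial_fact_lemma[of a "a + b"] by (simp add: mult_ac)
  also have "\<dots> \<le> 2 ^ (a + b) * (fact a * fact b)"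
    by (intro mult_right_mono binomial_le_pow2) auto
  finally show ?thesis
    by (metis (mono_tags, lifting) of_nat_fact of_nat_le_iff of_nat_mult of_nat_numeral of_nat_power)
qed

lemma fact_pow_mult_le: "s \<ge> 0 \<Longrightarrow> fact_pow s a * fact_pow s b \<le> fact_pow s (a + b)"
  unfolding fact_pow_def using fact_mult_le[of a b] by (simp add: powr_mono2 flip: powr_mult)

lemma fact_pow_add_le:
  assumes "s \<ge> 0"
  shows "fact_pow s (a + b) \<le> (2 powr s) ^ (a + b) * (fact_pow s a * fact_pow s b)"
proof -
  have "fact_pow s (a + b) \<le> (2 ^ (a + b) * (fact a * fact b)) powr s"
    unfolding fact_pow_def using assms fact_add_le by (intro powr_mono2) auto
  also have "\<dots> = (2 powr s) ^ (a + b) * (fact_pow s a * fact_pow s b)"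
    by (simp add: fact_pow_def powr_mult powr_power powr_powr mult.commute flip: powr_realpow)
  finally show ?thesis .
qed

lemma fact_pow_mono: "s \<ge> 0 \<Longrightarrow> a \<le> b \<Longrightarrow> fact_pow s a \<le> fact_pow s b"
  unfolding fact_pow_def by (intro powr_mono2 fact_mono) auto

lemma mi_fact_le: "mi_fact \<alpha> \<le> fact (mi_size \<alpha>)"
proof -
  have "(\<Prod>b\<in>S. fact (\<alpha> b)) \<le> (fact (\<Sum>b\<in>S. \<alpha> b) :: real)" if "finite S" for S
    using that
  proof (induction S)
    case (insert a S)
    then have "(\<Prod>b\<in>insert a S. fact (\<alpha> b)) \<le> fact (\<alpha> a) * (fact (\<Sum>b\<in>S. \<alpha> b) :: real)"
      by (simp add: mult_left_mono)
    also have "\<dots> \<le> fact (\<Sum>b\<in>insert a S. \<alpha> b)"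
      using insert by (simp add: fact_mult_le)
    finally show ?case .
  qed simp
  then show ?thesis by (simp add: mi_fact_def mi_size_def)
qed

text \<open>One application of \<open>fact_add_le\<close> per coordinate, hence one factor 2 in the
  base for each dimension.\<close>

lemma fact_mi_size_le:
  fixes \<alpha> :: "'a::euclidean_space \<Rightarrow> nat"
  shows "fact (mi_size \<alpha>) \<le> (2 ^ DIM('a)) ^ mi_size \<alpha> * mi_fact \<alpha>"
proof -
  have "fact (\<Sum>b\<in>S. \<alpha> b) \<le> ((2 ^ card S) ^ (\<Sum>b\<in>S. \<alpha> b) * (\<Prod>b\<in>S. fact (\<alpha> b)) :: real)" if "finite S" for S
    using that
  proof (induction S)
    case (insert a S)
    let ?n = "\<Sum>b\<in>S. \<alpha> b"
    have "fact (\<Sum>b\<in>insert a S. \<alpha> b) = (fact (\<alpha> a + ?n) :: real)" using insert by simp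
    also have "\<dots> \<le> 2 ^ (\<alpha> a + ?n) * (fact (\<alpha> a) * fact ?n)" by (rule fact_add_le)
    also have "\<dots> \<le> 2 ^ (\<alpha> a + ?n) * (fact (\<alpha> a) * ((2 ^ card S) ^ ?n * (\<Prod>b\<in>S. fact (\<alpha> b))))"
      using insert.IH by (intro mult_left_mono) auto
    also have "\<dots> \<le> 2 ^ (\<alpha> a + ?n) * (fact (\<alpha> a) * ((2 ^ card S) ^ (\<alpha> a + ?n) * (\<Prod>b\<in>S. fact (\<alpha> b))))"
      by (intro mult_left_mono mult_right_mono power_increasing prod_nonneg) auto
    also have "\<dots> = (2 ^ card (insert a S)) ^ (\<Sum>b\<in>insert a S. \<alpha> b) * (\<Prod>b\<in>insert a S. fact (\<alpha> b))"
      using insert by (simp add: power_mult_distrib)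
    finally show ?case .
  qed simp
  then show ?thesis by (simp add: mi_fact_def mi_size_def)
qed

lemma fact_pow_mi_size_le:
  fixes \<alpha> :: "'a::euclidean_space \<Rightarrow> nat"
  assumes "s \<ge> 0"
  shows "fact_pow s (mi_size \<alpha>) \<le> ((2 ^ DIM('a)) powr s) ^ mi_size \<alpha> * mi_fact \<alpha> powr s"
proof -
  have "fact_pow s (mi_size \<alpha>) \<le> ((2 ^ DIM('a)) ^ mi_size \<alpha> * mi_fact \<alpha>) powr s"
    unfolding fact_pow_def using assms fact_mi_size_le by (intro powr_mono2) auto
  also have "\<dots> = ((2 ^ DIM('a)) powr s) ^ mi_size \<alpha> * mi_fact \<alpha> powr s"
    using mi_fact_nonneg[of \<alpha>] by (simp add: powr_mult powr_power powr_powr mult_ac flip: powr_realpow)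
  finally show ?thesis .
qed

lemma mi_fact_powr_le:
  assumes "s \<ge> 0" "L \<in> lists Basis"
  shows "mi_fact (count_list L) powr s \<le> fact_pow s (length L)"
  using mi_fact_le[of "count_list L"] mi_fact_nonneg[of "count_list L"] assms(1)
  by (simp add: fact_pow_def mi_size_count[OF assms(2)] powr_mono2)

section \<open>Passing between Gelfand-Shilov bounds and word bounds\<close>

lemma gs_ball_mon_mult:
  assumes "f \<in> gs_ball s s A B c" "A > 0" "B > 0" "c \<ge> 0" "s \<ge> 0" "J \<in> lists Basis" "L \<in> lists Basis"
  shows "cmod (mon_mult J (list_deriv L f) x)
    \<le> c * (A ^ length J * fact_pow s (length J)) * (B ^ length L * fact_pow s (length L))"
proof -
  have f: "f \<in> C_infinity" using assms by (simp add: gs_ball_def schwartz_space_def)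
  have "mon_mult J (list_deriv L f) x
      = of_real (mi_power x (count_list J)) * mi_deriv (count_list L) f x"
    using assms f by (simp add: mon_mult_def mi_power_count list_deriv_eq_mi_deriv)
  also have "cmod \<dots> \<le> c * A ^ mi_size (count_list J) * B ^ mi_size (count_list L) *
      mi_fact (count_list J) powr s * mi_fact (count_list L) powr s"
    using assms(1) unfolding gs_ball_def by blast
  also have "\<dots> = c * A ^ length J * B ^ length L * mi_fact (count_list J) powr s * mi_fact (count_list L) powr s"
    using assms by (simp add: mi_size_count)
  also have "\<dots> \<le> c * A ^ length J * B ^ length L * fact_pow s (length J) * fact_pow s (length L)"
    using assms by (intro mult_mono mi_fact_powr_le) auto
  finally show ?thesis by (simp add: mult_ac)
qed

text \<open>The rates may be enlarged freely here: at least 1 lets the base grow by two powers in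
  the growth condition of \<open>normal_ordering\<close>, and at least \<open>\<kappa>\<close> is
  what translation by a vector of norm \<open>\<kappa>\<close> asks for.\<close>

lemma GS_space_word_bounded:
  fixes f :: "'a::euclidean_space \<Rightarrow> complex"
  assumes "f \<in> GS_space s s" "s \<ge> 1 / 2"
  obtains A c where "A > 0" "A \<ge> \<kappa>" "c > 0" "word_bounded (\<lambda>n. c * A ^ n * fact_pow s n) f"
proof -
  obtain A B c where *: "A > 0" "B > 0" "c > 0" "f \<in> gs_ball s s A B c"
    using assms unfolding GS_space_def by blast
  define M where "M = max (max 1 \<kappa>) (max A B)"
  have M: "M \<ge> 1" "M \<ge> \<kappa>" "M \<ge> A" "M \<ge> B" by (auto simp: M_def)
  have "f \<in> gs_ball s s M M c"
    by (rule subsetD[OF gs_ball_mono *(4)]) (use * M in auto)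
  define h where "h n = c * M ^ n * fact_pow s n" for n
  have "word_bounded (\<lambda>n. 2 ^ n * h n) f"
  proof (rule normal_ordering)
    show "f \<in> C_infinity" using * by (simp add: gs_ball_def schwartz_space_def)
    fix J L :: "'a list" and x assume JL: "J \<in> lists Basis" "L \<in> lists Basis"
    have "cmod (mon_mult J (list_deriv L f) x)
        \<le> c * (M ^ length J * fact_pow s (length J)) * (M ^ length L * fact_pow s (length L))"
      using JL * M assms by (intro gs_ball_mon_mult \<open>f \<in> gs_ball s s M M c\<close>) auto
    also have "\<dots> = c * M ^ (length J + length L) * (fact_pow s (length J) * fact_pow s (length L))"
      by (simp add: power_add)
    also have "\<dots> \<le> h (length J + length L)"
      unfolding h_def using assms * M by (intro mult_left_mono fact_pow_mult_le) auto
    finally show "cmod (mon_mult J (list_deriv L f) x) \<le> h (length J + length L)" .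
  next
    fix n
    \<comment> \<open>The factorial part of the growth condition: n + 1 is the square root of (n +
      1)^2, hence at most ((n + 1) (n + 2))^s, the quotient of \<open>fact_pow s (n + 2)\<close> and
      \<open>fact_pow s n\<close>.\<close>
    have "real (Suc n) = (real (Suc n) * real (Suc n)) powr (1 / 2)"
      by (simp add: powr_half_sqrt)
    also have "\<dots> \<le> (real (Suc n) * real (Suc n)) powr s"
      using assms(2) by (intro powr_mono) (auto simp: field_simps)
    also have "\<dots> \<le> (real (Suc (Suc n)) * real (Suc n)) powr s"
      using assms(2) by (intro powr_mono2 mult_right_mono) auto
    finally have 1: "real (Suc n) * fact_pow s n \<le> (real (Suc (Suc n)) * real (Suc n)) powr s * fact_pow s n"
      by (intro mult_right_mono) auto
    also have "\<dots> = fact_pow s (n + 2)"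
      by (simp add: fact_pow_def powr_mult)
    finally have 2: "real (Suc n) * fact_pow s n \<le> fact_pow s (n + 2)" .
    have "real (Suc n) * h n = c * M ^ n * (real (Suc n) * fact_pow s n)" by (simp add: h_def)
    also have "\<dots> \<le> c * M ^ (n + 2) * fact_pow s (n + 2)"
      using 2 M * by (intro mult_mono power_increasing) auto
    finally show "real (Suc n) * h n \<le> h (n + 2)" by (simp add: h_def)
  qed
  moreover have "2 ^ n * h n = c * (2 * M) ^ n * fact_pow s n" for n
    by (simp add: h_def power_mult_distrib)
  ultimately have "word_bounded (\<lambda>n. c * (2 * M) ^ n * fact_pow s n) f" by simp
  with M * show ?thesis by (intro that[of "2 * M" c]) auto
qed

lemma word_bounded_mono: "word_bounded h f \<Longrightarrow> (\<And>n. h n \<le> h' n) \<Longrightarrow> word_bounded h' f"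
  unfolding word_bounded_def by (meson order_trans)

text \<open>The division of \<open>A\<close> by 4 is consumed by two powers of 2: the loss
  \<open>2 ^ n\<close> of normal ordering or of a translation, and the one from splitting
  \<open>fact (n + q)\<close>.\<close>

lemma fact_shift_le:
  fixes A c :: real
  assumes "A > 0" "c > 0"
  shows "2 ^ n * (c * (A / 4) ^ n * fact (n + q)) \<le> (c * 2 ^ q * fact q) * A ^ n * fact n"
proof -
  have "2 ^ n * (c * (A / 4) ^ n * fact (n + q)) \<le> 2 ^ n * (c * (A / 4) ^ n * (2 ^ (n + q) * (fact n * fact q)))"
    using assms by (intro mult_left_mono fact_add_le) auto
  also have "\<dots> = (c * 2 ^ q * fact q) * (2 * (A / 4) * 2) ^ n * fact n"
    by (simp only: power_mult_distrib power_add mult_ac)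
  finally show ?thesis by simp
qed

lemma Sigma11_space_word_bounded:
  fixes f :: "'a::euclidean_space \<Rightarrow> complex"
  assumes "f \<in> Sigma11_space" "A > 0"
  obtains c where "c > 0" "word_bounded (\<lambda>n. c * A ^ n * fact n) f"
proof -
  define M where "M = A / 4"
  have M: "M > 0" using assms by (simp add: M_def)
  obtain c where *: "c > 0" "f \<in> gs_ball 1 1 M M c"
    using assms M unfolding Sigma11_space_def by blast
  obtain q :: nat where q: "real q \<ge> 1 / M ^ 2" using real_arch_simple by blast
  \<comment> \<open>\<open>M\<close> may be small; shifting the factorial by \<open>q\<close> restores the growth condition at the cost of a constant factor.\<close>
  define h where "h n = c * M ^ n * fact (n + q)" for n
  have "word_bounded (\<lambda>n. 2 ^ n * h n) f"
  proof (rule normal_ordering)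
    show "f \<in> C_infinity" using * by (simp add: gs_ball_def schwartz_space_def)
    fix J L :: "'a list" and x assume JL: "J \<in> lists Basis" "L \<in> lists Basis"
    have "cmod (mon_mult J (list_deriv L f) x)
        \<le> c * (M ^ length J * fact_pow 1 (length J)) * (M ^ length L * fact_pow 1 (length L))"
      using JL * M assms by (intro gs_ball_mon_mult) auto
    also have "\<dots> = c * M ^ (length J + length L) * (fact (length J) * fact (length L))"
      by (simp add: power_add)
    also have "\<dots> \<le> c * M ^ (length J + length L) * fact (length J + length L)"
      using assms * M by (intro mult_left_mono fact_mult_le) auto
    also have "\<dots> \<le> h (length J + length L)"
      unfolding h_def using * M by (intro mult_left_mono fact_mono) auto
    finally show "cmod (mon_mult J (list_deriv L f) x) \<le> h (length J + length L)" .
  next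
    fix n
    \<comment> \<open>Two further letters contribute M^2 (n + q + 1) (n + q + 2); by the size of
      \<open>q\<close> the first two factors give at least 1, and the last exceeds n + 1.\<close>
    have "1 \<le> M ^ 2 * real (n + q + 1)"
      using q M by (simp add: field_simps) (smt (verit, best) of_nat_0_le_iff mult_nonneg_nonneg zero_le_power2)
    then have "real (Suc n) * 1 \<le> real (n + q + 2) * (M ^ 2 * real (n + q + 1))"
      by (intro mult_mono) auto
    then have "(c * M ^ n * fact (n + q)) * (real (Suc n) * 1) \<le>
        (c * M ^ n * fact (n + q)) * (real (n + q + 2) * (M ^ 2 * real (n + q + 1)))"
      using * M by (intro mult_left_mono) auto
    also have "\<dots> = h (n + 2)"
      by (simp add: h_def power2_eq_square mult_ac)
    finally show "real (Suc n) * h n \<le> h (n + 2)" by (simp add: h_def mult_ac)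
  qed
  then have "word_bounded (\<lambda>n. (c * 2 ^ q * fact q) * A ^ n * fact n) f"
    by (rule word_bounded_mono) (use fact_shift_le[OF assms(2) *(1)] in \<open>simp add: h_def M_def\<close>)
  with * show ?thesis by (intro that[of "c * 2 ^ q * fact q"]) auto
qed

text \<open>Two losses make up \<open>K\<close>: \<open>2 powr s\<close> for splitting the factorial
  of the joint length, and \<open>(2 ^ DIM('a)) powr s\<close> for passing from the factorial of a
  size to that of a multi-index.\<close>

lemma word_bounded_gs_ball:
  fixes f :: "'a::euclidean_space \<Rightarrow> complex"
  assumes f: "word_bounded (\<lambda>n. c * A ^ n * fact_pow s n) f" and "A > 0" "c > 0" "s \<ge> 0"
  defines "K \<equiv> 2 powr s * (2 ^ DIM('a)) powr s"
  shows "f \<in> gs_ball s s (K * A) (K * A) c"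
proof -
  have bd: "cmod (of_real (mi_power x \<alpha>) * mi_deriv \<beta> f x)
      \<le> c * (K * A) ^ mi_size \<alpha> * (K * A) ^ mi_size \<beta> * mi_fact \<alpha> powr s * mi_fact \<beta> powr s" for x \<alpha> \<beta>
  proof -
    let ?w = "map (Pair True) (mi_list \<alpha>) @ map (Pair False) (mi_list \<beta>)"
    let ?a = "mi_size \<alpha>" and ?b = "mi_size \<beta>"
    have w: "?w \<in> words"
      using mi_list_in_lists[of \<alpha>] mi_list_in_lists[of \<beta>] by (auto simp: in_lists_conv_set)
    have "of_real (mi_power x \<alpha>) * mi_deriv \<beta> f x = word_op ?w f x"
      by (simp add: word_op_mon word_op_deriv mi_deriv_eq_list_deriv mi_power_eq_prod_list mon_mult_def)
    also have "cmod \<dots> \<le> c * A ^ length ?w * fact_pow s (length ?w)"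
      using f w unfolding word_bounded_def by blast
    also have "length ?w = ?a + ?b" by (simp add: length_mi_list)
    also have "c * A ^ (?a + ?b) * fact_pow s (?a + ?b) \<le>
        c * A ^ (?a + ?b) * ((2 powr s) ^ (?a + ?b) * (fact_pow s ?a * fact_pow s ?b))"
      using assms by (intro mult_left_mono fact_pow_add_le) auto
    also have "\<dots> \<le> c * A ^ (?a + ?b) * ((2 powr s) ^ (?a + ?b) *
        ((((2 ^ DIM('a)) powr s) ^ ?a * mi_fact \<alpha> powr s) * (((2 ^ DIM('a)) powr s) ^ ?b * mi_fact \<beta> powr s)))"
      using assms by (intro mult_left_mono mult_mono fact_pow_mi_size_le) auto
    also have "\<dots> = c * (K * A) ^ ?a * (K * A) ^ ?b * mi_fact \<alpha> powr s * mi_fact \<beta> powr s"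
      unfolding K_def by (simp only: power_mult_distrib power_add mult_ac)
    finally show ?thesis .
  qed
  have "f \<in> schwartz_space"
    unfolding schwartz_space_def bounded_iff using f bd by (auto simp: word_bounded_def intro!: exI)
  with bd show ?thesis by (simp add: gs_ball_def)
qed

lemma word_bounded_GS_space:
  fixes f :: "'a::euclidean_space \<Rightarrow> complex"
  assumes "word_bounded (\<lambda>n. c * A ^ n * fact_pow s n) f" "A > 0" "c > 0" "s \<ge> 0"
  shows "f \<in> GS_space s s"
proof -
  have "2 powr s * (2 ^ DIM('a)) powr s * A > 0" using assms by simp
  with word_bounded_gs_ball[OF assms] assms show ?thesis
    unfolding GS_space_def by blast
qed

lemma word_bounded_Sigma11_space:
  fixes f :: "'a::euclidean_space \<Rightarrow> complex"
  assumes "\<And>A. A > 0 \<Longrightarrow> \<exists>c>0. word_bounded (\<lambda>n. c * A ^ n * fact n) f"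
  shows "f \<in> Sigma11_space"
proof -
  define K :: real where "K = 2 powr 1 * (2 ^ DIM('a)) powr 1"
  have K: "K > 0" by (simp add: K_def)
  have *: "\<exists>c>0. f \<in> gs_ball 1 1 A A c" if A: "A > 0" for A
  proof -
    \<comment> \<open>Word bounds are available at every rate, so the loss \<open>K\<close> is
      compensated in advance.\<close>
    obtain c where c: "c > 0" "word_bounded (\<lambda>n. c * (A / K) ^ n * fact n) f"
      using assms[of "A / K"] A K by auto
    then have "f \<in> gs_ball 1 1 (K * (A / K)) (K * (A / K)) c"
      unfolding K_def using A K by (intro word_bounded_gs_ball) (auto simp: K_def)
    then show ?thesis using K c by auto
  qed
  have "\<exists>c>0. f \<in> gs_ball 1 1 A B c" if AB: "A > 0" "B > 0" for A B
  proof -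
    obtain c where c: "c > 0" "f \<in> gs_ball 1 1 (min A B) (min A B) c"
      using *[of "min A B"] AB by auto
    moreover have "gs_ball 1 1 (min A B) (min A B) c \<subseteq> gs_ball 1 1 A B c"
      using AB c by (intro gs_ball_mono) auto
    ultimately show ?thesis by blast
  qed
  moreover have "f \<in> schwartz_space" using *[of 1] by (auto simp: gs_ball_def)
  ultimately show ?thesis by (simp add: Sigma11_space_def)
qed

text \<open>The coordinate of x is that of x - z plus the constant z_b, so each coordinate letter
  produces two terms. The hypothesis on \<open>h\<close> lets the second, shorter one be charged as
  if its word had one letter more. The word \<open>u\<close> consists of the letters already moved
  inside the translation.\<close>

lemma word_bounded_translate:
  assumes f: "word_bounded h f" and h: "\<And>n. norm z * h n \<le> h (Suc n)"
  shows "word_bounded (\<lambda>n. 2 ^ n * h n) (\<lambda>x. f (x - z))"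
proof -
  have fs: "f \<in> C_infinity" using f by (simp add: word_bounded_def)
  have "cmod (word_op w (\<lambda>x. word_op u f (x - z)) x) \<le> 2 ^ length w * h (length w + length u)"
    if "w \<in> words" "u \<in> words" for w u x
    using that
  proof (induction w arbitrary: u rule: rev_induct)
    case Nil
    then show ?case using f by (simp add: word_bounded_def)
  next
    case (snoc l w)
    then have w: "w \<in> words" and l: "l \<in> UNIV \<times> Basis" by auto
    obtain d b where lb: "l = (d, b)" "b \<in> Basis" using l by (cases l) auto
    have us: "word_op u f \<in> C_infinity" using fs snoc.prems by (simp add: C_infinity_word_op)
    have IH: "cmod (word_op w (\<lambda>x. word_op (l # u) f (x - z)) x) \<le> 2 ^ length w * h (length w + length (l # u))"
      using snoc.prems w l by (intro snoc.IH) auto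
    have IH2: "cmod (word_op w (\<lambda>x. word_op u f (x - z)) x) \<le> 2 ^ length w * h (length w + length u)"
      using snoc.prems w by (intro snoc.IH)
    have h0: "0 \<le> h (length w + length (l # u))"
    proof -
      have "0 \<le> 2 ^ length w * h (length w + length (l # u))" by (rule order_trans[OF norm_ge_zero IH])
      moreover have "(0::real) < 2 ^ length w" by simp
      ultimately show ?thesis by (metis mult_pos_neg not_le)
    qed
    show ?case
    proof (cases d)
      case True
      have "op_letter l (\<lambda>x. word_op u f (x - z))
          = (\<lambda>x. 1 * word_op (l # u) f (x - z) + of_real (z \<bullet> b) * word_op u f (x - z))"
        using True lb by (auto simp: algebra_simps)
      then have "word_op (w @ [l]) (\<lambda>x. word_op u f (x - z)) x =
          1 * word_op w (\<lambda>x. word_op (l # u) f (x - z)) x + of_real (z \<bullet> b) * word_op w (\<lambda>x. word_op u f (x - z)) x"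
        using us w l
        by (simp only: word_op_simps) (subst word_op_lincomb, auto intro!: C_infinity_translate C_infinity_op_letter)
      also have "cmod \<dots> \<le> cmod (word_op w (\<lambda>x. word_op (l # u) f (x - z)) x)
          + \<bar>z \<bullet> b\<bar> * cmod (word_op w (\<lambda>x. word_op u f (x - z)) x)"
        by (rule order_trans[OF norm_triangle_ineq]) (simp add: norm_mult)
      also have "\<dots> \<le> 2 ^ length w * h (length w + length (l # u)) + norm z * (2 ^ length w * h (length w + length u))"
        using lb by (intro add_mono mult_mono IH IH2) (auto simp: Basis_le_norm)
      also have "norm z * (2 ^ length w * h (length w + length u)) \<le> 2 ^ length w * h (Suc (length w + length u))"
        using h[of "length w + length u"] by (simp add: mult.left_commute)
      finally show ?thesis by simp
    next
      case False
      have "op_letter l (\<lambda>x. word_op u f (x - z)) = (\<lambda>x. word_op (l # u) f (x - z))"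
        using False lb us by (simp add: partial_deriv_translate C_infinity_differentiable)
      then have "cmod (word_op (w @ [l]) (\<lambda>x. word_op u f (x - z)) x) \<le> 2 ^ length w * h (length w + length (l # u))"
        using IH by simp
      also have "\<dots> \<le> 2 ^ length (w @ [l]) * h (length (w @ [l]) + length u)"
        using h0 by (simp add: mult_right_mono)
      finally show ?thesis .
    qed
  qed
  from this[of _ "[]"] fs show ?thesis by (simp add: word_bounded_def C_infinity_translate)
qed

lemma GS_space_translate:
  fixes f :: "'a::euclidean_space \<Rightarrow> complex"
  assumes "f \<in> GS_space s s" "s \<ge> 1 / 2"
  shows "(\<lambda>x. f (x - z)) \<in> GS_space s s"
proof -
  obtain A c where *: "A > 0" "A \<ge> norm z" "c > 0" "word_bounded (\<lambda>n. c * A ^ n * fact_pow s n) f"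
    using GS_space_word_bounded[OF assms, of "norm z"] by blast
  have "word_bounded (\<lambda>n. 2 ^ n * (c * A ^ n * fact_pow s n)) (\<lambda>x. f (x - z))"
  proof (rule word_bounded_translate[OF *(4)])
    fix n
    have "norm z * (c * A ^ n * fact_pow s n) = c * A ^ n * (norm z * fact_pow s n)" by simp
    also have "\<dots> \<le> c * A ^ n * (A * fact_pow s (Suc n))"
      using * assms by (intro mult_left_mono mult_mono fact_pow_mono) auto
    finally show "norm z * (c * A ^ n * fact_pow s n) \<le> c * A ^ Suc n * fact_pow s (Suc n)" by (simp add: mult_ac)
  qed
  moreover have "2 ^ n * (c * A ^ n * fact_pow s n) = c * (2 * A) ^ n * fact_pow s n" for n
    by (simp add: power_mult_distrib)
  ultimately have "word_bounded (\<lambda>n. c * (2 * A) ^ n * fact_pow s n) (\<lambda>x. f (x - z))" by simp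
  then show ?thesis by (rule word_bounded_GS_space) (use * assms in auto)
qed

lemma Sigma11_space_translate:
  fixes f :: "'a::euclidean_space \<Rightarrow> complex"
  assumes f: "f \<in> Sigma11_space"
  shows "(\<lambda>x. f (x - z)) \<in> Sigma11_space"
proof (rule word_bounded_Sigma11_space)
  fix A :: real assume "A > 0"
  define M where "M = A / 4"
  have M: "M > 0" using \<open>A > 0\<close> by (simp add: M_def)
  obtain c where *: "c > 0" "word_bounded (\<lambda>n. c * M ^ n * fact n) f"
    using Sigma11_space_word_bounded[OF f M] by blast
  \<comment> \<open>The rate \<open>M\<close> cannot be raised to the norm of \<open>z\<close>;
    shifting the factorial makes M (n + q + 1) exceed that norm instead.\<close>
  obtain q :: nat where q: "real q \<ge> norm z / M" using real_arch_simple by blast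
  define h where "h n = c * M ^ n * fact (n + q)" for n
  have "c * M ^ n * fact n \<le> h n" for n
    unfolding h_def using * M by (intro mult_left_mono fact_mono) auto
  with *(2) have "word_bounded h f" by (rule word_bounded_mono)
  then have "word_bounded (\<lambda>n. 2 ^ n * h n) (\<lambda>x. f (x - z))"
  proof (rule word_bounded_translate)
    fix n
    have "norm z \<le> M * real q" using q M by (simp add: field_simps)
    also have "\<dots> \<le> M * real (Suc (n + q))" using M by (intro mult_left_mono) auto
    finally have "norm z * (c * M ^ n * fact (n + q)) \<le> M * real (Suc (n + q)) * (c * M ^ n * fact (n + q))"
      using * M by (intro mult_right_mono) auto
    then show "norm z * h n \<le> h (Suc n)" by (simp add: h_def algebra_simps)
  qed
  then have "word_bounded (\<lambda>n. (c * 2 ^ q * fact q) * A ^ n * fact n) (\<lambda>x. f (x - z))"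
    by (rule word_bounded_mono) (use fact_shift_le[OF \<open>A > 0\<close> *(1)] in \<open>simp add: h_def M_def\<close>)
  then show "\<exists>c>0. word_bounded (\<lambda>n. c * A ^ n * fact n) (\<lambda>x. f (x - z))"
    using * by (intro exI[of _ "c * 2 ^ q * fact q"]) auto
qed

text \<open>The norm is at most DIM times the largest coordinate, so powers of single coordinates
  suffice and mixed monomials can be avoided.\<close>

lemma norm_power_le:
  fixes x :: "'a::euclidean_space"
  assumes "\<And>b. b \<in> Basis \<Longrightarrow> \<bar>x \<bullet> b\<bar> ^ k * F \<le> K" "F \<ge> 0"
  shows "norm x ^ k * F \<le> real DIM('a) ^ k * K"
proof -
  obtain b where b: "b \<in> Basis" "\<And>a. a \<in> Basis \<Longrightarrow> \<bar>x \<bullet> a\<bar> \<le> \<bar>x \<bullet> b\<bar>"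
    using Max_in[of "(\<lambda>b. \<bar>x \<bullet> b\<bar>) ` Basis"] Max_ge[of "(\<lambda>b. \<bar>x \<bullet> b\<bar>) ` Basis"]
    by (auto simp: image_iff) (metis finite_Basis finite_imageI imageI Max_ge)
  have "norm x \<le> (\<Sum>a\<in>Basis. \<bar>x \<bullet> a\<bar>)" by (rule norm_le_l1)
  also have "\<dots> \<le> real DIM('a) * \<bar>x \<bullet> b\<bar>"
    using b sum_bounded_above[of Basis "\<lambda>a. \<bar>x \<bullet> a\<bar>"] by simp
  finally have "norm x ^ k * F \<le> (real DIM('a) * \<bar>x \<bullet> b\<bar>) ^ k * F"
    using assms by (intro mult_right_mono power_mono) auto
  also have "\<dots> = real DIM('a) ^ k * (\<bar>x \<bullet> b\<bar> ^ k * F)" by (simp add: power_mult_distrib)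
  also have "\<dots> \<le> real DIM('a) ^ k * K" using b assms by (intro mult_left_mono) auto
  finally show ?thesis .
qed

lemma mon_mult_replicate: "mon_mult (replicate k b) f x = of_real ((x \<bullet> b) ^ k) * f x"
  by (simp add: mon_mult_def prod_list_replicate)

lemma word_bounded_norm_power:
  fixes f :: "'a::euclidean_space \<Rightarrow> complex"
  assumes "word_bounded h f" "w \<in> words"
  shows "norm x ^ k * cmod (word_op w f x) \<le> real DIM('a) ^ k * h (k + length w)"
proof (rule norm_power_le)
  fix b :: 'a assume b: "b \<in> Basis"
  then have "map (Pair True) (replicate k b) @ w \<in> words"
    using assms by (auto simp: in_lists_conv_set)
  then have "cmod (word_op (map (Pair True) (replicate k b) @ w) f x) \<le> h (length (map (Pair True) (replicate k b) @ w))"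
    using assms unfolding word_bounded_def by blast
  then show "\<bar>x \<bullet> b\<bar> ^ k * cmod (word_op w f x) \<le> h (k + length w)"
    by (simp add: word_op_mon[of "replicate k b", simplified] mon_mult_replicate norm_mult norm_power)
qed simp

lemma gs_ball_norm_power:
  fixes f :: "'a::euclidean_space \<Rightarrow> complex"
  assumes "f \<in> gs_ball s s A B c" "A > 0" "B > 0" "c \<ge> 0" "s \<ge> 0"
  shows "norm x ^ k * cmod (f x) \<le> c * (real DIM('a) * A) ^ k * fact_pow s k"
proof -
  have "norm x ^ k * cmod (f x) \<le> real DIM('a) ^ k * (c * A ^ k * fact_pow s k)"
  proof (rule norm_power_le)
    fix b :: 'a assume b: "b \<in> Basis"
    have "cmod (mon_mult (replicate k b) (list_deriv [] f) x)
      \<le> c * (A ^ length (replicate k b) * fact_pow s (length (replicate k b))) * (B ^ length ([]::'a list) * fact_pow s (length ([]::'a list)))"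
      using assms b by (intro gs_ball_mon_mult) (auto simp: in_lists_conv_set)
    then show "\<bar>x \<bullet> b\<bar> ^ k * cmod (f x) \<le> c * A ^ k * fact_pow s k"
      by (simp add: mon_mult_replicate norm_mult norm_power)
  qed simp
  then show ?thesis by (simp add: power_mult_distrib mult_ac)
qed

section \<open>Integration on Euclidean spaces\<close>

text \<open>A universal integrable majorant. The exponent provides (1 + |x|)^2 for each dimension,
  enough to dominate the product of the 1 + x_b^2.\<close>

definition decay :: "'a::euclidean_space \<Rightarrow> real" where
  "decay x = inverse ((1 + norm x) ^ (2 * DIM('a)))"

lemma decay_pos [simp]: "decay x > 0" "decay x \<ge> 0"
  by (simp_all add: decay_def add_pos_nonneg zero_le_power)

lemma decay_bound_nonneg:
  assumes "cmod a \<le> C * decay x"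
  shows "C \<ge> 0"
  using order_trans[OF norm_ge_zero assms] by (metis decay_pos(1) not_le zero_le_mult_iff)

lemma decay_measurable [measurable]: "decay \<in> borel_measurable borel"
  unfolding decay_def[abs_def] by measurable

text \<open>Peetre's inequality: 1 + |x| \<le> (1 + |y|) (1 + |x + y|), raised to the power in
  \<open>decay\<close>.\<close>

lemma decay_Peetre:
  fixes x y :: "'a::euclidean_space"
  shows "decay (x + y) \<le> (1 + norm y) ^ (2 * DIM('a)) * decay x"
proof -
  have "norm x \<le> norm (x + y) + norm y" by (metis add_diff_cancel_right' norm_triangle_ineq4)
  then have "1 + norm x \<le> (1 + norm y) * (1 + norm (x + y))"
    using mult_nonneg_nonneg[OF norm_ge_zero[of y] norm_ge_zero[of "x + y"]] unfolding distrib_left distrib_right mult_1 mult_1_right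
    by linarith
  then have "(1 + norm x) ^ (2 * DIM('a)) \<le> (1 + norm y) ^ (2 * DIM('a)) * (1 + norm (x + y)) ^ (2 * DIM('a))"
    by (simp add: power_mono flip: power_mult_distrib)
  then show ?thesis
    by (simp add: decay_def divide_simps add_pos_nonneg mult.commute)
qed

lemma decay_half: "decay (x /\<^sub>R 2) \<le> 2 ^ (2 * DIM('a)) * decay (x :: 'a::euclidean_space)"
proof -
  have "(1 + norm x) ^ (2 * DIM('a)) \<le> (2 * (1 + norm (x /\<^sub>R 2))) ^ (2 * DIM('a))"
    by (intro power_mono) auto
  then show ?thesis
    unfolding power_mult_distrib
    by (simp add: decay_def divide_simps add_pos_nonneg mult.commute)
qed

text \<open>\<open>lborel\<close> is the image of the product of one-dimensional Lebesgue measures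
  under the map from coordinates to vectors, so Fubini for finite products applies.\<close>

lemma lborel_prod_integral:
  fixes \<phi> :: "'a::euclidean_space \<Rightarrow> real \<Rightarrow> 'c::{real_normed_field,banach,second_countable_topology}"
  assumes "\<And>b. b \<in> Basis \<Longrightarrow> integrable lborel (\<phi> b)"
  shows "integrable lborel (\<lambda>x. \<Prod>b\<in>Basis. \<phi> b (x \<bullet> b))"
    and "(\<integral>x. (\<Prod>b\<in>Basis. \<phi> b (x \<bullet> b)) \<partial>lborel) = (\<Prod>b\<in>Basis. \<integral>r. \<phi> b r \<partial>lborel)"
proof -
  interpret product_sigma_finite "\<lambda>_::'a. lborel :: real measure" by standard
  have [measurable]: "\<phi> b \<in> borel_measurable borel" if "b \<in> Basis" for b
    using assms[OF that] by auto
  let ?T = "\<lambda>f. \<Sum>b\<in>Basis. f b *\<^sub>R (b :: 'a)"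
  have T: "(\<Prod>b\<in>Basis. \<phi> b (?T f \<bullet> b)) = (\<Prod>b\<in>Basis. \<phi> b (f b))" for f
    by (intro prod.cong) auto
  have [measurable]: "?T \<in> borel_measurable (\<Pi>\<^sub>M b\<in>Basis. lborel)" by measurable
  have [measurable]: "(\<lambda>x. \<Prod>b\<in>Basis. \<phi> b (x \<bullet> b)) \<in> borel_measurable borel" by measurable
  have int: "integrable (\<Pi>\<^sub>M b\<in>Basis. lborel) (\<lambda>f. \<Prod>b\<in>Basis. \<phi> b (f b))"
    using assms by (intro product_integrable_prod) auto
  then show "integrable lborel (\<lambda>x. \<Prod>b\<in>Basis. \<phi> b (x \<bullet> b))"
    by (subst lborel_eq) (simp add: integrable_distr_eq T del: inner_sum_left_Basis)
  show "(\<integral>x. (\<Prod>b\<in>Basis. \<phi> b (x \<bullet> b)) \<partial>lborel) = (\<Prod>b\<in>Basis. \<integral>r. \<phi> b r \<partial>lborel)"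
    using product_integral_prod[of Basis \<phi>] assms
    by (subst lborel_eq) (simp add: integral_distr T del: inner_sum_left_Basis)
qed

lemma integrable_decay: "integrable lborel (decay :: 'a::euclidean_space \<Rightarrow> real)"
proof (rule Bochner_Integration.integrable_bound)
  have "integrable lborel (\<lambda>x::real. inverse (1 + x\<^sup>2))"
    using integrable_inverse_1_plus_square by (simp add: set_integrable_def)
  then show "integrable lborel (\<lambda>x::'a. \<Prod>b\<in>Basis. inverse (1 + (x \<bullet> b)\<^sup>2))"
    by (rule lborel_prod_integral(1))
  show "AE x::'a in lborel. norm (decay x) \<le> norm (\<Prod>b\<in>Basis. inverse (1 + (x \<bullet> b)\<^sup>2))"
  proof (rule AE_I2)
    fix x :: 'a
    have "(\<Prod>b\<in>Basis. 1 + (x \<bullet> b)\<^sup>2) \<le> (\<Prod>b\<in>(Basis::'a set). (1 + norm x)\<^sup>2)"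
    proof (intro prod_mono conjI)
      fix b :: 'a assume "b \<in> Basis"
      then have "\<bar>x \<bullet> b\<bar>\<^sup>2 \<le> (norm x)\<^sup>2" by (intro power_mono Basis_le_norm) auto
      then show "1 + (x \<bullet> b)\<^sup>2 \<le> (1 + norm x)\<^sup>2" by (simp add: power2_sum add_increasing2)
    qed auto
    also have "\<dots> = (1 + norm x) ^ (2 * DIM('a))" by (simp add: power_mult)
    finally have "decay x \<le> inverse (\<Prod>b\<in>Basis. 1 + (x \<bullet> b)\<^sup>2)"
      unfolding decay_def by (intro le_imp_inverse_le prod_pos) (auto simp: add_pos_nonneg)
    moreover have "0 \<le> (\<Prod>b\<in>Basis. inverse (1 + (x \<bullet> b)\<^sup>2))" by (intro prod_nonneg) auto
    ultimately show "norm (decay x) \<le> norm (\<Prod>b\<in>Basis. inverse (1 + (x \<bullet> b)\<^sup>2))"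
      by (simp flip: prod_inversef)
  qed
qed simp

lemma lborel_affine_integral:
  fixes f :: "'a::euclidean_space \<Rightarrow> 'c::{banach,second_countable_topology}"
  assumes [measurable]: "f \<in> borel_measurable borel" and "c \<noteq> 0"
  shows "(\<integral>x. f x \<partial>lborel) = \<bar>c\<bar> ^ DIM('a) *\<^sub>R (\<integral>x. f (t + c *\<^sub>R x) \<partial>lborel)"
    and "integrable lborel f \<longleftrightarrow> integrable lborel (\<lambda>x. f (t + c *\<^sub>R x))"
proof -
  have eq: "lborel = density (distr lborel borel (\<lambda>x. t + c *\<^sub>R x)) (\<lambda>_. ennreal (\<bar>c\<bar> ^ DIM('a)))"
    using lborel_affine[OF assms(2), of t] by simp
  have "(\<integral>x. f x \<partial>lborel) = (\<integral>x. f x \<partial>density (distr lborel borel (\<lambda>x. t + c *\<^sub>R x)) (\<lambda>_. ennreal (\<bar>c\<bar> ^ DIM('a))))"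
    by (rule arg_cong[where f = "\<lambda>M. integral\<^sup>L M f"], rule eq)
  then show "(\<integral>x. f x \<partial>lborel) = \<bar>c\<bar> ^ DIM('a) *\<^sub>R (\<integral>x. f (t + c *\<^sub>R x) \<partial>lborel)"
    by (simp add: integral_density integral_distr)
  have "integrable lborel f \<longleftrightarrow> integrable (density (distr lborel borel (\<lambda>x. t + c *\<^sub>R x)) (\<lambda>_. ennreal (\<bar>c\<bar> ^ DIM('a)))) f"
    by (rule arg_cong[where f = "\<lambda>M. integrable M f"], rule eq)
  then show "integrable lborel f \<longleftrightarrow> integrable lborel (\<lambda>x. f (t + c *\<^sub>R x))"
    using assms(2) integrable_scaleR_right[of "inverse (\<bar>c\<bar> ^ DIM('a))" lborel "\<lambda>x. \<bar>c\<bar> ^ DIM('a) *\<^sub>R f (t + c *\<^sub>R x)"]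
      integrable_scaleR_right[of "\<bar>c\<bar> ^ DIM('a)" lborel "\<lambda>x. f (t + c *\<^sub>R x)"]
    by (auto simp: integrable_density integrable_distr_eq)
qed

lemma lborel_translate_integral:
  fixes f :: "'a::euclidean_space \<Rightarrow> 'c::{banach,second_countable_topology}"
  assumes "f \<in> borel_measurable borel"
  shows "(\<integral>x. f (x - t) \<partial>lborel) = (\<integral>x. f x \<partial>lborel)" "(\<integral>x. f (t - x) \<partial>lborel) = (\<integral>x. f x \<partial>lborel)"
    and "integrable lborel (\<lambda>x. f (x - t)) \<longleftrightarrow> integrable lborel f"
    and "integrable lborel (\<lambda>x. f (t - x)) \<longleftrightarrow> integrable lborel f"
  using lborel_affine_integral[OF assms, of 1 "- t"] lborel_affine_integral[OF assms, of "-1" t]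
  by auto

lemma integrable_decay_translate: "integrable lborel (\<lambda>x. decay (x - z))"  "integrable lborel (\<lambda>x. decay (z - x))"
  using integrable_decay by (simp_all add: lborel_translate_integral)

text \<open>Dominated convergence for the remainder quotients: the mean value inequality on the ball
  bounds an increment by \<open>K t * norm h\<close>, and together with the linear term this gives
  the majorant \<open>2 * K t\<close>. A local hypothesis lets the majorant depend on the base
  point.\<close>

lemma has_derivative_integral:
  fixes f :: "'a::euclidean_space \<Rightarrow> 'b \<Rightarrow> complex"
  assumes r: "r > 0"
    and d: "\<And>x t. dist x x0 < r \<Longrightarrow> ((\<lambda>x. f x t) has_derivative f' x t) (at x)"
    and bd: "\<And>x t v. dist x x0 < r \<Longrightarrow> cmod (f' x t v) \<le> K t * norm v"
    and K: "integrable M K"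
    and int: "\<And>x. dist x x0 < r \<Longrightarrow> integrable M (f x)"
    and meas: "\<And>v. (\<lambda>t. f' x0 t v) \<in> borel_measurable M"
  shows "((\<lambda>x. \<integral>t. f x t \<partial>M) has_derivative (\<lambda>v. \<integral>t. f' x0 t v \<partial>M)) (at x0)"
proof -
  have K0: "K t \<ge> 0" for t
  proof -
    obtain b :: 'a where "b \<in> Basis" using nonempty_Basis by blast
    with bd[of x0 t b] r show ?thesis by (auto intro: order_trans[OF norm_ge_zero])
  qed
  have int': "integrable M (\<lambda>t. f' x0 t v)" for v
    by (rule Bochner_Integration.integrable_bound[of M "\<lambda>t. K t * norm v"])
      (use K meas bd[of x0 _ v] r K0 in auto)
  have lin: "linear (f' x0 t)" for t
    using d[of x0 t] r has_derivative_linear by auto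
  have mv: "cmod (f (x0 + h) t - f x0 t) \<le> K t * norm h" if "norm h < r" for h t
  proof -
    have "cmod (f (x0 + h) t - f x0 t) \<le> K t * norm (x0 + h - x0)"
    proof (rule differentiable_bound[where S = "ball x0 r" and f' = "\<lambda>x. f' x t"])
      show "((\<lambda>x. f x t) has_derivative f' x t) (at x within ball x0 r)" if "x \<in> ball x0 r" for x
        using d[of x t] that by (auto simp: dist_commute intro: has_derivative_at_withinI)
      show "onorm (f' x t) \<le> K t" if "x \<in> ball x0 r" for x
        using bd[of x t] that by (intro onorm_le) (auto simp: dist_commute)
    qed (use that r in \<open>auto simp: dist_norm\<close>)
    then show ?thesis by simp
  qed
  have "bounded_linear (\<lambda>v. \<integral>t. f' x0 t v \<partial>M)"
  proof (rule bounded_linear_intro[where K = "integral\<^sup>L M K"])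
    show "(\<integral>t. f' x0 t (x + y) \<partial>M) = (\<integral>t. f' x0 t x \<partial>M) + (\<integral>t. f' x0 t y \<partial>M)" for x y
      using int' by (simp add: linear_add[OF lin])
    show "(\<integral>t. f' x0 t (c *\<^sub>R x) \<partial>M) = c *\<^sub>R (\<integral>t. f' x0 t x \<partial>M)" for c x
      using int' by (simp add: linear_scale[OF lin])
    show "norm (\<integral>t. f' x0 t v \<partial>M) \<le> norm v * integral\<^sup>L M K" for v
    proof -
      have "norm (\<integral>t. f' x0 t v \<partial>M) \<le> (\<integral>t. norm (f' x0 t v) \<partial>M)" by (rule integral_norm_bound)
      also have "\<dots> \<le> (\<integral>t. K t * norm v \<partial>M)"
        using int' K bd[of x0 _ v] r by (intro integral_mono) auto
      finally show ?thesis by (simp add: mult.commute)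
    qed
  qed
  moreover have "(\<lambda>h. norm ((\<integral>t. f (x0 + h) t \<partial>M) - (\<integral>t. f x0 t \<partial>M) - (\<integral>t. f' x0 t h \<partial>M)) / norm h) \<midarrow>0\<rightarrow> 0"
    unfolding tendsto_at_iff_sequentially
  proof (intro allI impI)
    fix X :: "nat \<Rightarrow> 'a" assume X: "\<forall>i. X i \<in> UNIV - {0}" "X \<longlonglongrightarrow> 0"
    \<comment> \<open>Only a tail of the sequence is certain to lie in the ball of radius
      \<open>r\<close>, hence the shift by \<open>N\<close>, undone at the end.\<close>
    obtain N where N: "\<And>n. n \<ge> N \<Longrightarrow> norm (X n) < r"
      using X(2) r by (auto simp: LIMSEQ_iff)
    define q where "q n t = (f (x0 + X (n + N)) t - f x0 t - f' x0 t (X (n + N))) /\<^sub>R norm (X (n + N))" for n t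
    have Xn: "norm (X (n + N)) < r" "X (n + N) \<noteq> 0" for n using N X by auto
    have "(\<lambda>n. \<integral>t. q n t \<partial>M) \<longlonglongrightarrow> (\<integral>t. 0 \<partial>M)"
    proof (rule integral_dominated_convergence)
      show "integrable M (\<lambda>t. 2 * K t)" using K by simp
      show "q n \<in> borel_measurable M" for n
        using int[of "x0 + X (n + N)"] int[of x0] int' Xn r unfolding q_def
        by (intro borel_measurable_scaleR borel_measurable_diff) (auto simp: dist_norm)
      show "AE t in M. norm (q n t) \<le> 2 * K t" for n
      proof (rule AE_I2)
        fix t
        have "norm (f (x0 + X (n + N)) t - f x0 t - f' x0 t (X (n + N)))
            \<le> K t * norm (X (n + N)) + K t * norm (X (n + N))"
          by (rule order_trans[OF norm_triangle_ineq4 add_mono])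
            (use mv[of "X (n + N)" t] bd[of x0 t "X (n + N)"] Xn[of n] r in auto)
        then show "norm (q n t) \<le> 2 * K t"
          using Xn[of n] by (simp add: q_def divide_simps mult_ac)
      qed
      show "AE t in M. (\<lambda>n. q n t) \<longlonglongrightarrow> 0"
      proof (rule AE_I2)
        fix t
        have "((\<lambda>x. f x t) has_derivative f' x0 t) (at x0)" using d r by auto
        then have "(\<lambda>h. norm (f (x0 + h) t - f x0 t - f' x0 t h) / norm h) \<midarrow>0\<rightarrow> 0"
          unfolding has_derivative_at by blast
        then have "((\<lambda>h. norm (f (x0 + h) t - f x0 t - f' x0 t h) / norm h) \<circ> (\<lambda>n. X (n + N))) \<longlonglongrightarrow> 0"
          using X LIMSEQ_ignore_initial_segment[OF X(2), of N] unfolding tendsto_at_iff_sequentially by auto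
        then have "(\<lambda>n. norm (q n t)) \<longlonglongrightarrow> 0"
          by (simp add: q_def comp_def divide_inverse mult.commute)
        then show "(\<lambda>n. q n t) \<longlonglongrightarrow> 0" by (rule tendsto_norm_zero_cancel)
      qed
    qed auto
    then have "(\<lambda>n. norm (\<integral>t. q n t \<partial>M)) \<longlonglongrightarrow> 0"
      by (simp add: tendsto_norm_zero)
    moreover have "(\<integral>t. q n t \<partial>M) = ((\<integral>t. f (x0 + X (n + N)) t \<partial>M) - (\<integral>t. f x0 t \<partial>M)
        - (\<integral>t. f' x0 t (X (n + N)) \<partial>M)) /\<^sub>R norm (X (n + N))" for n
      unfolding q_def using int[of "x0 + X (n + N)"] int[of x0] int' Xn[of n] r by (simp add: dist_norm)
    ultimately have "(\<lambda>n. norm ((\<integral>t. f (x0 + X (n + N)) t \<partial>M) - (\<integral>t. f x0 t \<partial>M)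
        - (\<integral>t. f' x0 t (X (n + N)) \<partial>M)) / norm (X (n + N))) \<longlonglongrightarrow> 0"
      by (simp add: divide_inverse mult.commute)
    then show "((\<lambda>h. norm ((\<integral>t. f (x0 + h) t \<partial>M) - (\<integral>t. f x0 t \<partial>M) - (\<integral>t. f' x0 t h \<partial>M)) / norm h) \<circ> X) \<longlonglongrightarrow> 0"
      unfolding comp_def by (rule LIMSEQ_offset)
  qed
  ultimately show ?thesis unfolding has_derivative_at by blast
qed

text \<open>The integral of G(t + r b) is constant in r by translation invariance, and its
  derivative at r = 0 is the integral of \<open>G'\<close>. This is the form in which integration by
  parts is used: no boundary terms arise.\<close>

lemma integral_directional_deriv_eq_0:
  fixes G G' :: "'a::euclidean_space \<Rightarrow> complex"
  assumes G: "integrable lborel G" and b: "norm b \<le> 1"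
    and d: "\<And>t r. ((\<lambda>r. G (t + r *\<^sub>R b)) has_vector_derivative G' (t + r *\<^sub>R b)) (at r)"
    and [measurable]: "G' \<in> borel_measurable borel"
    and bd: "\<And>x. cmod (G' x) \<le> C * decay (x - z)"
  shows "(\<integral>x. G' x \<partial>lborel) = 0"
proof -
  have [measurable]: "G \<in> borel_measurable borel" using G by auto
  have C: "C \<ge> 0" by (rule decay_bound_nonneg[OF bd])
  \<comment> \<open>The power of 2 is the Peetre factor for shifts of norm at most 1.\<close>
  define D where "D = C * 2 ^ (2 * DIM('a))"
  have "((\<lambda>r. \<integral>t. G (t + r *\<^sub>R b) \<partial>lborel) has_derivative
      (\<lambda>v. \<integral>t. v *\<^sub>R G' (t + 0 *\<^sub>R b) \<partial>lborel)) (at (0::real))"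
  proof (rule has_derivative_integral[where r = 1 and K = "\<lambda>t. D * decay (t - z)"
        and f' = "\<lambda>r t v. v *\<^sub>R G' (t + r *\<^sub>R b)"])
    show "((\<lambda>r. G (t + r *\<^sub>R b)) has_derivative (\<lambda>v. v *\<^sub>R G' (t + r *\<^sub>R b))) (at r)" for r t
      using d by (simp add: has_vector_derivative_def)
    show "integrable lborel (\<lambda>t. D * decay (t - z))"
      by (intro integrable_mult_right integrable_decay_translate)
    show "integrable lborel (\<lambda>t. G (t + r *\<^sub>R b))" for r
      using G lborel_translate_integral(3)[of G "- (r *\<^sub>R b)"] by simp
    fix r :: real and t :: 'a and v :: real assume "dist r 0 < 1"
    then have r: "norm (r *\<^sub>R b) \<le> 1" using b mult_mono[of "\<bar>r\<bar>" 1 "norm b" 1] by simp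
    have "cmod (G' (t + r *\<^sub>R b)) \<le> C * decay (t + r *\<^sub>R b - z)" by (rule bd)
    also have "decay (t + r *\<^sub>R b - z) = decay ((t - z) + r *\<^sub>R b)" by (simp add: algebra_simps)
    also have "\<dots> \<le> (1 + norm (r *\<^sub>R b)) ^ (2 * DIM('a)) * decay (t - z)" by (rule decay_Peetre)
    also have "\<dots> \<le> 2 ^ (2 * DIM('a)) * decay (t - z)"
      using r by (intro mult_right_mono power_mono) auto
    finally have "cmod (G' (t + r *\<^sub>R b)) \<le> D * decay (t - z)"
      using C by (simp add: D_def mult_left_mono mult.assoc)
    then show "cmod (v *\<^sub>R G' (t + r *\<^sub>R b)) \<le> D * decay (t - z) * norm v"
      by (simp add: mult.commute[of _ "\<bar>v\<bar>"] mult_left_mono)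
  qed auto
  moreover have "(\<lambda>r. \<integral>t. G (t + r *\<^sub>R b) \<partial>lborel) = (\<lambda>r::real. \<integral>t. G t \<partial>lborel)"
    using lborel_translate_integral(1)[of G "- (_ *\<^sub>R b)"] by (intro ext) simp
  ultimately have "((\<lambda>r::real. \<integral>t. G t \<partial>lborel) has_derivative (\<lambda>v. \<integral>t. v *\<^sub>R G' t \<partial>lborel)) (at 0)"
    by simp
  then have "(\<lambda>v. \<integral>t. v *\<^sub>R G' t \<partial>lborel) = (\<lambda>v::real. 0)"
    by (rule has_derivative_unique) (rule has_derivative_const)
  from fun_cong[OF this, of 1] show ?thesis by simp
qed

lemma integral_partial_deriv_eq_0:
  fixes G :: "'a::euclidean_space \<Rightarrow> complex"
  assumes G: "G \<in> C_infinity" "integrable lborel G" and b: "b \<in> Basis"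
    and bd: "\<And>x. cmod (partial_deriv b G x) \<le> C * decay (x - z)"
  shows "(\<integral>x. partial_deriv b G x \<partial>lborel) = 0"
  using G b by (intro integral_directional_deriv_eq_0[OF _ _ C_infinity_has_vector_derivative _ bd])
    (auto intro: C_infinity_measurable C_infinity_partial_deriv)

section \<open>Fourier inversion\<close>

definition chr :: "real \<Rightarrow> complex" where
  "chr x = cis (2 * pi * x)"

lemma chr_eq_exp: "chr x = exp (2 * pi * \<i> * of_real x)"
  by (simp add: chr_def cis_conv_exp mult_ac)

lemma norm_chr [simp]: "cmod (chr x) = 1" by (simp add: chr_def)

lemma chr_add: "chr (x + y) = chr x * chr y" by (simp add: chr_def cis_mult algebra_simps)

lemma chr_0 [simp]: "chr 0 = 1" by (simp add: chr_def)

lemma cnj_chr: "cnj (chr x) = chr (- x)" by (simp add: chr_def cis_cnj)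

lemma continuous_on_chr [continuous_intros]: "continuous_on S f \<Longrightarrow> continuous_on S (\<lambda>x. chr (f x))"
  unfolding chr_def by (intro continuous_intros)

lemma chr_measurable [measurable]: "chr \<in> borel_measurable borel"
  by (intro borel_measurable_continuous_onI continuous_intros)

definition fourier :: "('a::euclidean_space \<Rightarrow> complex) \<Rightarrow> 'a \<Rightarrow> complex" where
  "fourier F \<zeta> = (\<integral>t. F t * chr (- (t \<bullet> \<zeta>)) \<partial>lborel)"

section \<open>Gaussians and the approximate identity they form\<close>

lemma power_div_fact_le_exp:
  assumes "(x::real) \<ge> 0"
  shows "x ^ n / fact n \<le> exp x"
proof -
  have "(\<Sum>i\<in>{n}. x ^ i /\<^sub>R fact i) \<le> (\<Sum>i. x ^ i /\<^sub>R fact i)"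
    using assms by (intro sum_le_suminf summable_exp_generic) auto
  then show ?thesis by (simp add: exp_def divide_inverse mult.commute)
qed

text \<open>Written as a product of standard normal densities, so that total mass and Fourier
  transform reduce to one-dimensional probability.\<close>

definition gauss :: "'a::euclidean_space \<Rightarrow> real" where
  "gauss x = (\<Prod>b\<in>Basis. std_normal_density (x \<bullet> b))"

lemma gauss_eq: "gauss (x::'a::euclidean_space) = gauss (0::'a) * exp (- ((norm x)\<^sup>2 / 2))"
proof -
  have "gauss x = (\<Prod>b\<in>(Basis::'a set). (1 / sqrt (2 * pi)) * exp (- ((x \<bullet> b)\<^sup>2 / 2)))"
    by (simp add: gauss_def std_normal_density_def)
  also have "\<dots> = (1 / sqrt (2 * pi)) ^ DIM('a) * exp (\<Sum>b\<in>(Basis::'a set). - ((x \<bullet> b)\<^sup>2 / 2))"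
    by (simp add: prod_dividef power_divide exp_sum)
  also have "(\<Sum>b\<in>(Basis::'a set). - ((x \<bullet> b)\<^sup>2 / 2)) = - ((norm x)\<^sup>2 / 2)"
    by (simp add: sum_negf power2_norm_eq_inner euclidean_inner[of x x] flip: power2_eq_square sum_divide_distrib)
  finally show ?thesis by (simp add: gauss_def std_normal_density_def)
qed

lemma gauss_0: "gauss (0::'a::euclidean_space) > 0" "gauss (0::'a) * gauss (0::'a) = inverse ((2 * pi) ^ DIM('a))"
proof -
  have eq: "gauss (0::'a) = (1 / sqrt (2 * pi)) ^ DIM('a)"
    by (simp add: gauss_def std_normal_density_def)
  then show "gauss (0::'a) > 0" by simp
  show "gauss (0::'a) * gauss (0::'a) = inverse ((2 * pi) ^ DIM('a))"
  proof -
    have "1 / sqrt (2 * pi) * (1 / sqrt (2 * pi)) = inverse (2 * pi)" by (simp add: divide_inverse flip: inverse_mult_distrib)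
    then show ?thesis unfolding eq power_mult_distrib[symmetric] by (simp only: power_inverse)
  qed
qed

lemma gauss_pos: "gauss (x::'a::euclidean_space) > 0"
  using gauss_0(1)[where 'a='a] by (subst gauss_eq) simp

lemma gauss_le: "gauss (x::'a) \<le> gauss (0::'a::euclidean_space)"
proof -
  have "gauss (0::'a) * exp (- ((norm x)\<^sup>2 / 2)) \<le> gauss (0::'a) * 1"
    by (intro mult_left_mono) (auto simp: gauss_pos less_imp_le)
  then show ?thesis using gauss_eq[of x] by linarith
qed

lemma gauss_minus: "gauss (- x) = gauss x"
  by (subst (1 2) gauss_eq) simp

lemma continuous_gauss: "continuous_on S (gauss :: 'a::euclidean_space \<Rightarrow> real)"
proof -
  have "gauss = (\<lambda>x::'a. gauss (0::'a) * exp (- ((norm x)\<^sup>2 / 2)))" by (rule ext) (rule gauss_eq)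
  moreover have "continuous_on S (\<lambda>x::'a. gauss (0::'a) * exp (- ((norm x)\<^sup>2 / 2)))"
    by (intro continuous_intros) auto
  ultimately show ?thesis by metis
qed

lemma gauss_measurable [measurable]: "gauss \<in> borel_measurable borel"
  by (intro borel_measurable_continuous_onI continuous_gauss)

lemma integrable_gauss: "integrable lborel (gauss :: 'a::euclidean_space \<Rightarrow> real)" and integral_gauss: "(\<integral>x. gauss (x::'a::euclidean_space) \<partial>lborel) = 1"
  unfolding gauss_def[abs_def]
  using lborel_prod_integral[of "\<lambda>_::'a. std_normal_density"] by auto

text \<open>Both sides factor over the coordinates, and each factor is the characteristic function
  of the standard normal distribution.\<close>

lemma gauss_fourier: "(\<integral>u. gauss u *\<^sub>R cis (\<eta> \<bullet> u) \<partial>lborel) = of_real (exp (- ((norm (\<eta>::'a::euclidean_space))\<^sup>2 / 2)))"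
proof -
  have one: "(\<integral>r. std_normal_density r *\<^sub>R cis (a * r) \<partial>lborel) = of_real (exp (- (a\<^sup>2 / 2)))" for a
  proof -
    have "char std_normal_distribution a = (\<integral>r. std_normal_density r *\<^sub>R iexp (a * r) \<partial>lborel)"
      unfolding char_def by (subst integral_density) auto
    then show ?thesis by (simp add: char_std_normal_distribution cis_conv_exp)
  qed
  have int: "integrable lborel (\<lambda>r. std_normal_density r *\<^sub>R cis (a * r))" for a
    by (rule Bochner_Integration.integrable_bound[of lborel std_normal_density])
      (auto simp: cis_conv_exp)
  have "gauss u *\<^sub>R cis (\<eta> \<bullet> u) = (\<Prod>b\<in>Basis. std_normal_density (u \<bullet> b) *\<^sub>R cis ((\<eta> \<bullet> b) * (u \<bullet> b)))" for u
  proof -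
    have "cis (\<eta> \<bullet> u) = (\<Prod>b\<in>Basis. cis ((\<eta> \<bullet> b) * (u \<bullet> b)))"
      unfolding euclidean_inner[of \<eta> u] by (simp add: cis_conv_exp exp_sum sum_distrib_left)
    then show ?thesis by (simp add: gauss_def scaleR_conv_of_real prod.distrib)
  qed
  then have "(\<integral>u. gauss u *\<^sub>R cis (\<eta> \<bullet> u) \<partial>lborel) = (\<Prod>b\<in>Basis. of_real (exp (- ((\<eta> \<bullet> b)\<^sup>2 / 2))))"
    using lborel_prod_integral(2)[of "\<lambda>b r. std_normal_density r *\<^sub>R cis ((\<eta> \<bullet> b) * r)"] int one by simp
  also have "\<dots> = of_real (exp (\<Sum>b\<in>Basis. - ((\<eta> \<bullet> b)\<^sup>2 / 2)))"
    by (simp add: exp_sum)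
  also have "(\<Sum>b\<in>(Basis::'a set). - ((\<eta> \<bullet> b)\<^sup>2 / 2)) = - ((norm \<eta>)\<^sup>2 / 2)"
    by (simp add: sum_negf power2_norm_eq_inner euclidean_inner[of \<eta> \<eta>] flip: power2_eq_square sum_divide_distrib)
  finally show ?thesis .
qed

text \<open>\<open>F\<close> is integrable but possibly unbounded away from \<open>t\<close>, so it
  is cut at the sphere of radius \<open>r\<close>. Near \<open>t\<close> continuity bounds it and
  dominated convergence applies after rescaling; far from \<open>t\<close> the kernel itself tends
  to 0 uniformly, against the fixed L^1 norm.\<close>

lemma gauss_approx_identity:
  fixes F :: "'a::euclidean_space \<Rightarrow> complex"
  assumes F: "integrable lborel F" "isCont F t" and \<rho>: "\<And>n. \<rho> n > 0" "\<rho> \<longlonglongrightarrow> 0"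
  shows "(\<lambda>n. \<integral>y. (gauss ((t - y) /\<^sub>R \<rho> n) / \<rho> n ^ DIM('a)) *\<^sub>R F y \<partial>lborel) \<longlonglongrightarrow> F t"
proof -
  let ?N = "DIM('a)"
  have [measurable]: "F \<in> borel_measurable borel" using F by auto
  obtain r where r: "r > 0" "\<And>y. dist y t < r \<Longrightarrow> dist (F y) (F t) < 1"
    using F(2) unfolding continuous_at_eps_delta by (meson zero_less_one)
  define F1 where "F1 y = indicator (ball t r) y *\<^sub>R F y" for y
  define F2 where "F2 y = indicator (- ball t r) y *\<^sub>R F y" for y
  have [measurable]: "F1 \<in> borel_measurable borel" "F2 \<in> borel_measurable borel"
    unfolding F1_def[abs_def] F2_def[abs_def]
    by (intro borel_measurable_scaleR borel_measurable_indicator; simp)+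
  define k where "k n y = gauss ((t - y) /\<^sub>R \<rho> n) / \<rho> n ^ ?N" for n y
  have [measurable]: "k n \<in> borel_measurable borel" for n
    unfolding k_def[abs_def] by measurable
  have k_pos: "k n y \<ge> 0" for n y
    using \<rho>(1)[of n] gauss_pos[of "(t - y) /\<^sub>R \<rho> n"] by (simp add: k_def)
  have k_bd: "k n y \<le> gauss (0::'a) / \<rho> n ^ ?N" for n y
    unfolding k_def using \<rho>(1)[of n] gauss_le by (intro divide_right_mono) auto
  have int: "integrable lborel (\<lambda>y. k n y *\<^sub>R G y)" if "integrable lborel G" for n and G :: "'a \<Rightarrow> complex"
  proof (rule Bochner_Integration.integrable_bound[of lborel "\<lambda>y. (gauss (0::'a) / \<rho> n ^ ?N) *\<^sub>R G y"])
    show "AE y in lborel. norm (k n y *\<^sub>R G y) \<le> norm ((gauss (0::'a) / \<rho> n ^ ?N) *\<^sub>R G y)"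
      unfolding norm_scaleR
      using k_bd[of n] k_pos[of n] order_trans[OF k_pos k_bd, of n] by (intro AE_I2 mult_right_mono) (simp_all add: abs_of_pos[OF gauss_pos] abs_of_pos[OF zero_less_power[OF \<rho>(1)]])
    show "(\<lambda>y. k n y *\<^sub>R G y) \<in> borel_measurable lborel"
      using that by (intro borel_measurable_scaleR) auto
  qed (use that in simp)
  have int1: "integrable lborel F1" unfolding F1_def[abs_def] using F by (intro integrable_mult_indicator) auto
  have int2: "integrable lborel F2" unfolding F2_def[abs_def] using F by (intro integrable_mult_indicator) auto
  have lim1: "(\<lambda>n. \<integral>y. k n y *\<^sub>R F1 y \<partial>lborel) \<longlonglongrightarrow> F t"
  proof -
    have "(\<integral>y. k n y *\<^sub>R F1 y \<partial>lborel) = (\<integral>u. gauss u *\<^sub>R F1 (t + \<rho> n *\<^sub>R u) \<partial>lborel)" for n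
    proof -
      have "(\<integral>y. k n y *\<^sub>R F1 y \<partial>lborel) = \<bar>\<rho> n\<bar> ^ ?N *\<^sub>R (\<integral>u. k n (t + \<rho> n *\<^sub>R u) *\<^sub>R F1 (t + \<rho> n *\<^sub>R u) \<partial>lborel)"
        using \<rho>(1)[of n] by (intro lborel_affine_integral(1)) auto
      also have "\<dots> = (\<integral>u. (\<bar>\<rho> n\<bar> ^ ?N * k n (t + \<rho> n *\<^sub>R u)) *\<^sub>R F1 (t + \<rho> n *\<^sub>R u) \<partial>lborel)"
        by (simp flip: integral_scaleR_right)
      also have "(\<lambda>u. \<bar>\<rho> n\<bar> ^ ?N * k n (t + \<rho> n *\<^sub>R u)) = gauss"
        using \<rho>(1)[of n] by (auto simp: k_def gauss_minus)
      finally show ?thesis .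
    qed
    moreover have "(\<lambda>n. \<integral>u. gauss u *\<^sub>R F1 (t + \<rho> n *\<^sub>R u) \<partial>lborel) \<longlonglongrightarrow> (\<integral>u. gauss (u::'a) *\<^sub>R F t \<partial>lborel)"
    proof (rule integral_dominated_convergence)
      show "integrable lborel (\<lambda>u::'a. gauss u * (cmod (F t) + 1))"
        by (intro integrable_mult_left integrable_gauss)
      have F1_bd: "cmod (F1 y) \<le> cmod (F t) + 1" for y
      proof (cases "dist y t < r")
        case True
        then have "cmod (F y) \<le> cmod (F t) + 1"
          using r(2)[OF True] norm_triangle_ineq2[of "F y" "F t"] by (simp add: dist_norm)
        then show ?thesis by (simp add: F1_def indicator_def)
      qed (simp add: F1_def dist_commute)
      show "AE u in lborel. norm (gauss u *\<^sub>R F1 (t + \<rho> n *\<^sub>R u)) \<le> gauss u * (cmod (F t) + 1)" for n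
        using F1_bd by (intro AE_I2) (auto simp: less_imp_le[OF gauss_pos] intro!: mult_mono)
      show "AE u in lborel. (\<lambda>n. gauss u *\<^sub>R F1 (t + \<rho> n *\<^sub>R u)) \<longlonglongrightarrow> gauss u *\<^sub>R F t"
      proof (intro AE_I2 tendsto_intros)
        fix u
        have lim: "(\<lambda>n. t + \<rho> n *\<^sub>R u) \<longlonglongrightarrow> t + 0 *\<^sub>R u" by (intro tendsto_intros \<rho>)
        then have "(\<lambda>n. F (t + \<rho> n *\<^sub>R u)) \<longlonglongrightarrow> F t"
          using isCont_tendsto_compose[OF F(2), of "\<lambda>n. t + \<rho> n *\<^sub>R u" sequentially] by simp
        moreover have "eventually (\<lambda>n. dist (t + \<rho> n *\<^sub>R u) t < r) sequentially"
          using lim r(1) by (simp add: tendstoD)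
        then have "eventually (\<lambda>n. F (t + \<rho> n *\<^sub>R u) = F1 (t + \<rho> n *\<^sub>R u)) sequentially"
          by eventually_elim (simp add: F1_def dist_commute)
        ultimately show "(\<lambda>n. F1 (t + \<rho> n *\<^sub>R u)) \<longlonglongrightarrow> F t"
          by (simp cong: tendsto_cong)
      qed
    qed auto
    moreover have "(\<integral>u. gauss (u::'a) *\<^sub>R F t \<partial>lborel) = F t"
      by (subst integral_scaleR_left) (simp_all add: integrable_gauss integral_gauss)
    ultimately show ?thesis by simp
  qed
  have lim2: "(\<lambda>n. \<integral>y. k n y *\<^sub>R F2 y \<partial>lborel) \<longlonglongrightarrow> 0"
  proof (rule Lim_null_comparison)
    \<comment> \<open>With x = |t - y|^2 / (2 \<rho>^2) \<ge> r^2 / (2 \<rho>^2) and exp(-x) \<le>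
      N! / x^N, the kernel outside the ball is at most gauss(0) N! (2 / r^2)^N \<rho>^(2N) /
      \<rho>^N.\<close>
    define C where "C = gauss (0::'a) * fact ?N * (2 / r\<^sup>2) ^ ?N * (\<integral>y. cmod (F2 y) \<partial>lborel)"
    show "eventually (\<lambda>n. norm (\<integral>y. k n y *\<^sub>R F2 y \<partial>lborel) \<le> C * \<rho> n ^ ?N) sequentially"
    proof (intro always_eventually allI)
      fix n
      have "norm (k n y *\<^sub>R F2 y) \<le> (gauss (0::'a) * fact ?N * (2 / r\<^sup>2) ^ ?N * \<rho> n ^ ?N) * cmod (F2 y)" for y
      proof (cases "y \<in> ball t r")
        case False
        define x where "x = (norm ((t - y) /\<^sub>R \<rho> n))\<^sup>2 / 2"
        have "r / \<rho> n \<le> norm ((t - y) /\<^sub>R \<rho> n)"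
          using False \<rho>(1)[of n] by (simp add: dist_norm divide_inverse mult.commute)
        then have "(r / \<rho> n)\<^sup>2 / 2 \<le> x"
          unfolding x_def using r(1) \<rho>(1)[of n] by (intro divide_right_mono power_mono) auto
        then have x: "r\<^sup>2 / (2 * (\<rho> n)\<^sup>2) \<le> x" by (simp add: power_divide)
        have x0: "0 < r\<^sup>2 / (2 * (\<rho> n)\<^sup>2)" using r(1) \<rho>(1)[of n] by simp
        have "x ^ ?N / fact ?N \<le> exp x"
          using x x0 by (intro power_div_fact_le_exp) linarith
        moreover have "x ^ ?N > 0" using x x0 by (intro zero_less_power) linarith
        ultimately have "exp (- x) \<le> fact ?N / x ^ ?N"
          by (simp add: exp_minus divide_simps mult.commute)
        also have "\<dots> \<le> fact ?N / (r\<^sup>2 / (2 * (\<rho> n)\<^sup>2)) ^ ?N"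
          using x x0 by (intro divide_left_mono power_mono mult_pos_pos zero_less_power) auto
        also have "\<dots> = fact ?N * (2 / r\<^sup>2) ^ ?N * (\<rho> n ^ ?N * \<rho> n ^ ?N)"
          by (simp add: power_divide power_mult_distrib power2_eq_square)
        finally have "gauss (0::'a) * exp (- x) / \<rho> n ^ ?N \<le> gauss (0::'a) * (fact ?N * (2 / r\<^sup>2) ^ ?N * (\<rho> n ^ ?N * \<rho> n ^ ?N)) / \<rho> n ^ ?N"
          using \<rho>(1)[of n] gauss_0(1)[where 'a='a] by (intro divide_right_mono mult_left_mono) auto
        then have "k n y \<le> gauss (0::'a) * fact ?N * (2 / r\<^sup>2) ^ ?N * \<rho> n ^ ?N"
          using \<rho>(1)[of n] gauss_eq[of "(t - y) /\<^sub>R \<rho> n"] by (simp add: k_def x_def mult_ac)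
        then show ?thesis using k_pos[of n y] by (simp add: mult_right_mono)
      qed (simp add: F2_def)
      then have "(\<integral>y. norm (k n y *\<^sub>R F2 y) \<partial>lborel) \<le> (\<integral>y. (gauss (0::'a) * fact ?N * (2 / r\<^sup>2) ^ ?N * \<rho> n ^ ?N) * cmod (F2 y) \<partial>lborel)"
        by (intro integral_mono integrable_norm[OF int[OF int2]] integrable_mult_right integrable_norm[OF int2])
      then show "norm (\<integral>y. k n y *\<^sub>R F2 y \<partial>lborel) \<le> C * \<rho> n ^ ?N"
        using integral_norm_bound[of lborel "\<lambda>y. k n y *\<^sub>R F2 y"] by (simp add: C_def mult_ac)
    qed
    have "(\<lambda>n. C * \<rho> n ^ ?N) \<longlonglongrightarrow> C * 0 ^ ?N" by (intro tendsto_intros \<rho>)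
    then show "(\<lambda>n. C * \<rho> n ^ ?N) \<longlonglongrightarrow> 0" by (simp add: zero_power)
  qed
  have "(\<integral>y. k n y *\<^sub>R F y \<partial>lborel) = (\<integral>y. k n y *\<^sub>R F1 y \<partial>lborel) + (\<integral>y. k n y *\<^sub>R F2 y \<partial>lborel)" for n
  proof -
    have "F y = F1 y + F2 y" for y by (simp add: F1_def F2_def indicator_def)
    then show ?thesis using int[OF int1, of n] int[OF int2, of n] by (simp add: scaleR_add_right)
  qed
  with tendsto_add[OF lim1 lim2] show ?thesis by (simp add: k_def)
qed

lemma fourier_measurable [measurable]:
  assumes [measurable]: "F \<in> borel_measurable borel"
  shows "fourier F \<in> borel_measurable borel"
  unfolding fourier_def[abs_def] by measurable

text \<open>Gaussian summation: the frequency integral with a Gaussian cutoff is computed in two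
  ways. Removing the cutoff gives \<open>g0\<close> times the inversion integral; Fubini and
  \<open>gauss_fourier\<close> give a multiple of a Gaussian mean of \<open>F\<close>, which tends
  to F(t). The constants match since \<open>g0 * g0\<close> is (2 \<pi>)^(-N).\<close>

theorem fourier_inversion:
  fixes F :: "'a::euclidean_space \<Rightarrow> complex"
  assumes F: "integrable lborel F" "isCont F t" "integrable lborel (fourier F)"
  shows "F t = (\<integral>\<zeta>. fourier F \<zeta> * chr (t \<bullet> \<zeta>) \<partial>lborel)"
proof -
  let ?N = "DIM('a)" and ?I = "\<integral>\<zeta>. fourier F \<zeta> * chr (t \<bullet> \<zeta>) \<partial>lborel"
  have [measurable]: "F \<in> borel_measurable borel" using F by auto
  define \<rho> where "\<rho> n = inverse (real (Suc n))" for n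
  have \<rho>: "\<rho> n > 0" "\<rho> \<longlonglongrightarrow> 0" for n
    using LIMSEQ_inverse_real_of_nat by (simp_all add: \<rho>_def[abs_def])
  define g0 where "g0 = gauss (0::'a)"
  have g0: "g0 > 0" "g0 * g0 = inverse ((2 * pi) ^ ?N)" using gauss_0[where 'a='a] by (auto simp: g0_def)
  \<comment> \<open>The dilation by \<open>2 * pi * \<rho> n\<close> turns, after substitution, the
    phase \<open>chr\<close> into the phase of \<open>gauss_fourier\<close> at the point (t - y) /
    \<rho>.\<close>
  define I where "I n = (\<integral>\<zeta>. gauss ((2 * pi * \<rho> n) *\<^sub>R \<zeta>) *\<^sub>R (fourier F \<zeta> * chr (t \<bullet> \<zeta>)) \<partial>lborel)" for n
  have gauss_le: "gauss x \<le> g0" for x :: 'a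
    unfolding g0_def by (rule gauss_le)
  have "I \<longlonglongrightarrow> (\<integral>\<zeta>. g0 *\<^sub>R (fourier F \<zeta> * chr (t \<bullet> \<zeta>)) \<partial>lborel)"
    unfolding I_def
  proof (rule integral_dominated_convergence)
    show "integrable lborel (\<lambda>\<zeta>. g0 * cmod (fourier F \<zeta>))" using F(3) by simp
    show "AE \<zeta> in lborel. norm (gauss ((2 * pi * \<rho> n) *\<^sub>R \<zeta>) *\<^sub>R (fourier F \<zeta> * chr (t \<bullet> \<zeta>))) \<le> g0 * cmod (fourier F \<zeta>)" for n
      using gauss_le gauss_pos by (intro AE_I2) (auto simp: norm_mult abs_of_pos[OF gauss_pos] intro!: mult_right_mono)
    show "AE \<zeta> in lborel. (\<lambda>n. gauss ((2 * pi * \<rho> n) *\<^sub>R \<zeta>) *\<^sub>R (fourier F \<zeta> * chr (t \<bullet> \<zeta>))) \<longlonglongrightarrow> g0 *\<^sub>R (fourier F \<zeta> * chr (t \<bullet> \<zeta>))"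
    proof (intro AE_I2 tendsto_intros)
      fix \<zeta> :: 'a
      have "(\<lambda>n. (2 * pi * \<rho> n) *\<^sub>R \<zeta>) \<longlonglongrightarrow> (2 * pi * 0) *\<^sub>R \<zeta>" by (intro tendsto_intros \<rho>)
      moreover have "isCont (gauss :: 'a \<Rightarrow> real) 0"
        using continuous_gauss[of "UNIV :: 'a set"] by (simp add: continuous_on_eq_continuous_at)
      ultimately show "(\<lambda>n. gauss ((2 * pi * \<rho> n) *\<^sub>R \<zeta>)) \<longlonglongrightarrow> g0"
        unfolding g0_def by (intro isCont_tendsto_compose[of _ gauss]) auto
    qed
  qed auto
  also have "(\<integral>\<zeta>. g0 *\<^sub>R (fourier F \<zeta> * chr (t \<bullet> \<zeta>)) \<partial>lborel) = g0 *\<^sub>R ?I" by simp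
  finally have lim: "I \<longlonglongrightarrow> g0 *\<^sub>R ?I" .
  have I_eq: "I n = (inverse ((2 * pi) ^ ?N) / g0) *\<^sub>R (\<integral>y. (gauss ((t - y) /\<^sub>R \<rho> n) / \<rho> n ^ ?N) *\<^sub>R F y \<partial>lborel)" for n
  proof -
    let ?c = "2 * pi * \<rho> n"
    have c: "?c > 0" using \<rho>(1)[of n] by simp
    let ?H = "\<lambda>\<zeta> y. gauss (?c *\<^sub>R \<zeta>) *\<^sub>R (F y * chr ((t - y) \<bullet> \<zeta>))"
    have gint: "integrable lborel (\<lambda>\<zeta>::'a. gauss (?c *\<^sub>R \<zeta>))"
      using lborel_affine_integral(2)[of "gauss :: 'a \<Rightarrow> real" ?c 0] \<rho>(1)[of n] integrable_gauss[where 'a='a] by simp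
    have "I n = (\<integral>\<zeta>. (\<integral>y. ?H \<zeta> y \<partial>lborel) \<partial>lborel)"
    proof -
      have "gauss (?c *\<^sub>R \<zeta>) *\<^sub>R (fourier F \<zeta> * chr (t \<bullet> \<zeta>)) = (\<integral>y. ?H \<zeta> y \<partial>lborel)" for \<zeta>
      proof -
        have "fourier F \<zeta> * chr (t \<bullet> \<zeta>) = (\<integral>y. F y * chr (- (y \<bullet> \<zeta>)) * chr (t \<bullet> \<zeta>) \<partial>lborel)"
          unfolding fourier_def by (rule integral_mult_left_zero[symmetric])
        also have "(\<lambda>y. F y * chr (- (y \<bullet> \<zeta>)) * chr (t \<bullet> \<zeta>)) = (\<lambda>y. F y * chr ((t - y) \<bullet> \<zeta>))"
          by (simp add: mult.assoc inner_diff_left flip: chr_add)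
        finally show ?thesis by (simp flip: integral_scaleR_right)
      qed
      then show ?thesis by (simp only: I_def)
    qed
    also have "\<dots> = (\<integral>y. (\<integral>\<zeta>. ?H \<zeta> y \<partial>lborel) \<partial>lborel)"
    proof (rule lborel_pair.Fubini_integral[symmetric])
      show "integrable (lborel \<Otimes>\<^sub>M lborel) (\<lambda>(\<zeta>, y). ?H \<zeta> y)"
      proof (rule lborel_pair.Fubini_integrable)
        have "(\<lambda>\<zeta>. \<integral>y. norm (?H \<zeta> y) \<partial>lborel) = (\<lambda>\<zeta>. gauss (?c *\<^sub>R \<zeta>) * (\<integral>y. cmod (F y) \<partial>lborel))"
          by (simp add: norm_mult abs_of_pos[OF gauss_pos])
        then show "integrable lborel (\<lambda>\<zeta>. \<integral>y. norm (case (\<zeta>, y) of (\<zeta>, y) \<Rightarrow> ?H \<zeta> y) \<partial>lborel)"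
          using gint by simp
        have "integrable lborel (?H \<zeta>)" for \<zeta>
          by (intro integrable_scaleR_right Bochner_Integration.integrable_bound[OF F(1)])
            (auto simp: norm_mult)
        then show "AE \<zeta> in lborel. integrable lborel (\<lambda>y. case (\<zeta>, y) of (\<zeta>, y) \<Rightarrow> ?H \<zeta> y)" by simp
      qed measurable
    qed
    also have "(\<lambda>y. \<integral>\<zeta>. ?H \<zeta> y \<partial>lborel) = (\<lambda>y. (inverse ((2 * pi) ^ ?N) / g0) *\<^sub>R ((gauss ((t - y) /\<^sub>R \<rho> n) / \<rho> n ^ ?N) *\<^sub>R F y))"
    proof
      fix y
      have fac: "(\<integral>\<zeta>. ?H \<zeta> y \<partial>lborel) = F y * (\<integral>\<zeta>. gauss (?c *\<^sub>R \<zeta>) *\<^sub>R chr ((t - y) \<bullet> \<zeta>) \<partial>lborel)"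
        by (simp flip: integral_mult_right_zero)
      have aux: "X = of_real (q / a)" if "a > 0" "a *\<^sub>R X = of_real q" for a q and X :: complex
        using that by (auto simp: scaleR_conv_of_real field_simps)
      have phase: "cis (((t - y) /\<^sub>R \<rho> n) \<bullet> (?c *\<^sub>R \<zeta>)) = chr ((t - y) \<bullet> \<zeta>)" for \<zeta>
      proof -
        have "?c * (inverse (\<rho> n) * ((t - y) \<bullet> \<zeta>)) = 2 * pi * ((t - y) \<bullet> \<zeta>)"
          using \<rho>(1)[of n] by (simp add: field_simps)
        then show ?thesis
          by (simp only: chr_def inner_scaleR_left inner_scaleR_right)
      qed
      have "(\<integral>u. gauss u *\<^sub>R cis (((t - y) /\<^sub>R \<rho> n) \<bullet> u) \<partial>lborel)
          = \<bar>?c\<bar> ^ ?N *\<^sub>R (\<integral>\<zeta>. gauss (0 + ?c *\<^sub>R \<zeta>) *\<^sub>R cis (((t - y) /\<^sub>R \<rho> n) \<bullet> (0 + ?c *\<^sub>R \<zeta>)) \<partial>lborel)"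
        using c by (intro lborel_affine_integral(1)) (auto simp: cis_conv_exp)
      then have "\<bar>?c\<bar> ^ ?N *\<^sub>R (\<integral>\<zeta>. gauss (?c *\<^sub>R \<zeta>) *\<^sub>R chr ((t - y) \<bullet> \<zeta>) \<partial>lborel)
          = (\<integral>u. gauss u *\<^sub>R cis (((t - y) /\<^sub>R \<rho> n) \<bullet> u) \<partial>lborel)"
        by (simp only: phase add_0_left abs_of_pos[OF c])
      also have "\<dots> = of_real (gauss ((t - y) /\<^sub>R \<rho> n) / g0)"
        unfolding gauss_fourier using g0(1) gauss_eq[of "(t - y) /\<^sub>R \<rho> n"] by (simp add: g0_def)
      finally have val: "(\<integral>\<zeta>. gauss (?c *\<^sub>R \<zeta>) *\<^sub>R chr ((t - y) \<bullet> \<zeta>) \<partial>lborel) = of_real (gauss ((t - y) /\<^sub>R \<rho> n) / g0 / ?c ^ ?N)"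
        using aux[of "?c ^ ?N" _ "gauss ((t - y) /\<^sub>R \<rho> n) / g0"] c by (simp only: abs_of_pos[OF c] zero_less_power)
      show "(\<integral>\<zeta>. ?H \<zeta> y \<partial>lborel) = (inverse ((2 * pi) ^ ?N) / g0) *\<^sub>R ((gauss ((t - y) /\<^sub>R \<rho> n) / \<rho> n ^ ?N) *\<^sub>R F y)"
        unfolding fac val by (simp add: scaleR_conv_of_real field_simps power_mult_distrib)
    qed
    also have "(\<integral>y. (inverse ((2 * pi) ^ ?N) / g0) *\<^sub>R ((gauss ((t - y) /\<^sub>R \<rho> n) / \<rho> n ^ ?N) *\<^sub>R F y) \<partial>lborel)
      = (inverse ((2 * pi) ^ ?N) / g0) *\<^sub>R (\<integral>y. (gauss ((t - y) /\<^sub>R \<rho> n) / \<rho> n ^ ?N) *\<^sub>R F y \<partial>lborel)"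
      by (rule integral_scaleR_right)
    finally show ?thesis .
  qed
  have "I \<longlonglongrightarrow> (inverse ((2 * pi) ^ ?N) / g0) *\<^sub>R F t"
    unfolding I_eq by (intro tendsto_scaleR tendsto_const gauss_approx_identity F \<rho>)
  then have "(inverse ((2 * pi) ^ ?N) / g0) *\<^sub>R F t = g0 *\<^sub>R ?I"
    using lim LIMSEQ_unique by blast
  moreover have "inverse ((2 * pi) ^ ?N) / g0 = g0" using g0 by (simp add: field_simps)
  ultimately show ?thesis using g0(1) by simp
qed

section \<open>The cross-Wigner distribution\<close>

text \<open>The Frechet derivative of a smooth function, as an explicit finite sum so that its
  measurability in the base point is evident.\<close>

definition total_deriv :: "('a::euclidean_space \<Rightarrow> complex) \<Rightarrow> 'a \<Rightarrow> 'a \<Rightarrow> complex" where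
  "total_deriv f x v = (\<Sum>b\<in>Basis. (v \<bullet> b) *\<^sub>R partial_deriv b f x)"

lemma decay_le_1: "decay x \<le> 1"
  by (simp add: decay_def inverse_le_1_iff)

lemma one_plus_power_le:
  assumes "(y::real) \<ge> 0"
  shows "(1 + y) ^ n \<le> 2 ^ n * (1 + y ^ n)"
proof -
  have "(1 + y) ^ n \<le> (2 * max 1 y) ^ n" using assms by (intro power_mono) auto
  also have "\<dots> \<le> 2 ^ n * (1 + y ^ n)" using assms by (simp add: power_mult_distrib max_def)
  finally show ?thesis .
qed

text \<open>By \<open>one_plus_power_le\<close> only the powers 0 and \<open>2 * DIM('a)\<close> of
  the norm have to be controlled, which is the origin of the two values of \<open>H\<close>.\<close>

lemma word_bounded_decay:
  fixes f :: "'a::euclidean_space \<Rightarrow> complex"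
  assumes f: "word_bounded H f"
  shows "cmod (f x) \<le> 2 ^ (2 * DIM('a)) * (H 0 + real DIM('a) ^ (2 * DIM('a)) * H (2 * DIM('a))) * decay x"
proof -
  let ?M = "2 * DIM('a)"
  have "(1 + norm x) ^ ?M * cmod (f x) \<le> 2 ^ ?M * (1 + norm x ^ ?M) * cmod (f x)"
    by (intro mult_right_mono one_plus_power_le) auto
  also have "\<dots> = 2 ^ ?M * (norm x ^ 0 * cmod (word_op [] f x) + norm x ^ ?M * cmod (word_op [] f x))"
    by (simp add: algebra_simps)
  also have "\<dots> \<le> 2 ^ ?M * (real DIM('a) ^ 0 * H (0 + length ([]::(bool\<times>'a) list)) + real DIM('a) ^ ?M * H (?M + length ([]::(bool\<times>'a) list)))"
    by (intro mult_left_mono add_mono word_bounded_norm_power[OF f]) auto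
  finally show ?thesis
    by (simp add: decay_def divide_simps add_pos_nonneg mult_ac)
qed

text \<open>There are finitely many words of each length, so this is the Schwartz class: every word
  yields a bounded function. It is the qualitative notion for which integrals and derivatives are
  justified, rates being tracked separately.\<close>

definition rapid :: "('a::euclidean_space \<Rightarrow> complex) \<Rightarrow> bool" where
  "rapid f \<longleftrightarrow> (\<exists>H. word_bounded H f)"

lemma rapid_C_infinity: "rapid f \<Longrightarrow> f \<in> C_infinity"
  by (auto simp: rapid_def word_bounded_def)

lemma rapid_word_op: "rapid f \<Longrightarrow> w \<in> words \<Longrightarrow> rapid (word_op w f)"
  unfolding rapid_def using word_bounded_word_op by blast

lemma rapid_op_letter: "rapid f \<Longrightarrow> l \<in> UNIV \<times> Basis \<Longrightarrow> rapid (op_letter l f)"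
  using rapid_word_op[of f "[l]"] by simp

lemma rapid_partial_deriv: "rapid f \<Longrightarrow> b \<in> Basis \<Longrightarrow> rapid (partial_deriv b f)"
  using rapid_op_letter[of f "(False, b)"] by simp

lemma rapid_coord_mult: "rapid f \<Longrightarrow> b \<in> Basis \<Longrightarrow> rapid (\<lambda>x. of_real (x \<bullet> b) * f x)"
  using rapid_op_letter[of f "(True, b)"] by simp

lemma rapid_decay:
  assumes "rapid f"
  obtains K where "K > 0" "\<And>x. cmod (f x) \<le> K * decay x"
proof -
  obtain H where H: "word_bounded H f" using assms by (auto simp: rapid_def)
  let ?K = "2 ^ (2 * DIM('a)) * (H 0 + real DIM('a) ^ (2 * DIM('a)) * H (2 * DIM('a)))"
  have "cmod (f x) \<le> (max ?K 1) * decay x" for x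
    by (rule order_trans[OF word_bounded_decay[OF H]]) (intro mult_right_mono, auto)
  then show ?thesis by (intro that[of "max ?K 1"]) auto
qed

text \<open>One constant for the three kinds of factors that occur when the Wigner integrand is
  differentiated.\<close>

lemma rapid_bounds:
  fixes f :: "'a::euclidean_space \<Rightarrow> complex"
  assumes f: "rapid f"
  obtains K where "K > 0" "\<And>x. cmod (f x) \<le> K * decay x" "\<And>x. norm x * cmod (f x) \<le> K * decay x"
    "\<And>x v. cmod (total_deriv f x v) \<le> K * decay x * norm v"
proof -
  obtain K0 where K0: "K0 > 0" "\<And>x. cmod (f x) \<le> K0 * decay x" using rapid_decay[OF f] by blast
  have ex: "\<exists>K. K > 0 \<and> (\<forall>x. cmod (k x) \<le> K * decay x)" if "rapid k" for k :: "'a \<Rightarrow> complex"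
    using rapid_decay[OF that] by blast
  have "\<exists>K. \<forall>b\<in>Basis. K b > 0 \<and> (\<forall>x. cmod (partial_deriv b f x) \<le> K b * decay x)"
    by (intro bchoice ballI ex rapid_partial_deriv f)
  then obtain K1 where K1: "\<And>b. b \<in> Basis \<Longrightarrow> K1 b > 0" "\<And>b x. b \<in> Basis \<Longrightarrow> cmod (partial_deriv b f x) \<le> K1 b * decay x"
    by blast
  have "\<exists>K. \<forall>b\<in>Basis. K b > 0 \<and> (\<forall>x. cmod (of_real (x \<bullet> b) * f x) \<le> K b * decay x)"
    by (intro bchoice ballI ex rapid_coord_mult f)
  then obtain K2 where K2: "\<And>b. b \<in> Basis \<Longrightarrow> K2 b > 0" "\<And>b x. b \<in> Basis \<Longrightarrow> cmod (of_real (x \<bullet> b) * f x) \<le> K2 b * decay x"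
    by blast
  define K where "K = K0 + (\<Sum>b\<in>Basis. K1 b) + (\<Sum>b\<in>Basis. K2 b)"
  have s: "(\<Sum>b\<in>Basis. K1 b) \<ge> 0" "(\<Sum>b\<in>Basis. K2 b) \<ge> 0"
    using K1(1) K2(1) by (meson less_imp_le sum_nonneg)+
  show ?thesis
  proof (rule that[of K])
    show "K > 0" using K0 s by (simp add: K_def)
    show "cmod (f x) \<le> K * decay x" for x
      by (rule order_trans[OF K0(2)], intro mult_right_mono) (use s in \<open>auto simp: K_def\<close>)
    show "norm x * cmod (f x) \<le> K * decay x" for x
    proof -
      have "norm x * cmod (f x) \<le> (\<Sum>b\<in>Basis. \<bar>x \<bullet> b\<bar>) * cmod (f x)"
        by (intro mult_right_mono norm_le_l1) auto
      also have "\<dots> = (\<Sum>b\<in>Basis. cmod (of_real (x \<bullet> b) * f x))"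
        by (simp add: sum_distrib_right norm_mult)
      also have "\<dots> \<le> (\<Sum>b\<in>Basis. K2 b * decay x)" by (intro sum_mono K2)
      also have "\<dots> = (\<Sum>b\<in>Basis. K2 b) * decay x" by (simp add: sum_distrib_right)
      also have "\<dots> \<le> K * decay x" using s K0 by (intro mult_right_mono) (auto simp: K_def)
      finally show ?thesis .
    qed
    show "cmod (total_deriv f x v) \<le> K * decay x * norm v" for x v
    proof -
      have "cmod (total_deriv f x v) \<le> (\<Sum>b\<in>Basis. cmod ((v \<bullet> b) *\<^sub>R partial_deriv b f x))"
        unfolding total_deriv_def by (rule norm_sum)
      also have "\<dots> \<le> (\<Sum>b\<in>Basis. norm v * (K1 b * decay x))"
        unfolding norm_scaleR by (intro sum_mono mult_mono K1) (auto simp: Basis_le_norm)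
      also have "\<dots> = (\<Sum>b\<in>Basis. K1 b) * decay x * norm v" by (simp add: sum_distrib_left sum_distrib_right mult_ac)
      also have "\<dots> \<le> K * decay x * norm v" using s K0 by (intro mult_right_mono) (auto simp: K_def)
      finally show ?thesis .
    qed
  qed
qed

definition wigner_integrand :: "('a::euclidean_space \<Rightarrow> complex) \<Rightarrow> ('a \<Rightarrow> complex) \<Rightarrow> 'a \<times> 'a \<Rightarrow> 'a \<Rightarrow> complex" where
  "wigner_integrand f h p t = f (fst p + t /\<^sub>R 2) * cnj (h (fst p - t /\<^sub>R 2)) * chr (- (t \<bullet> snd p))"

lemma cross_wigner_eq: "cross_wigner f h p = (\<integral>t. wigner_integrand f h p t \<partial>lborel)"
  by (cases p) (simp add: cross_wigner_def wigner_integrand_def chr_eq_exp)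

lemma cnj_measurable [measurable]: "cnj \<in> borel_measurable borel"
  by (intro borel_measurable_continuous_onI continuous_intros)

lemma wigner_integrand_measurable:
  assumes "f \<in> C_infinity" "h \<in> C_infinity"
  shows "wigner_integrand f h p \<in> borel_measurable borel"
proof -
  have [measurable]: "f \<in> borel_measurable borel" "h \<in> borel_measurable borel"
    using assms by (auto intro: C_infinity_measurable)
  obtain a b where p: "p = (a, b)" by fastforce
  show ?thesis unfolding p wigner_integrand_def[abs_def] fst_conv snd_conv by measurable
qed

lemma decay_shift_half:
  fixes x :: "'a::euclidean_space"
  shows "decay (x + t /\<^sub>R 2) \<le> (1 + norm x) ^ (2 * DIM('a)) * 2 ^ (2 * DIM('a)) * decay t"
proof -
  have "decay (t /\<^sub>R 2 + x) \<le> (1 + norm x) ^ (2 * DIM('a)) * decay (t /\<^sub>R 2)" by (rule decay_Peetre)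
  also have "\<dots> \<le> (1 + norm x) ^ (2 * DIM('a)) * (2 ^ (2 * DIM('a)) * decay t)"
    by (intro mult_left_mono decay_half) auto
  finally show ?thesis by (simp add: add.commute mult.assoc)
qed

lemma wigner_integrand_bound:
  fixes f h :: "'a::euclidean_space \<Rightarrow> complex"
  assumes f: "rapid f" and h: "rapid h"
  obtains C where "\<And>t. cmod (wigner_integrand f h p t) \<le> C * decay t"
proof -
  obtain K where K: "K > 0" "\<And>x. cmod (f x) \<le> K * decay x" using rapid_decay[OF f] by blast
  obtain K' where K': "K' > 0" "\<And>x. cmod (h x) \<le> K' * decay x" using rapid_decay[OF h] by blast
  show ?thesis
  proof (rule that)
    fix t
    have "cmod (h x) \<le> K' * 1" for x
      using K' decay_le_1 by (intro order_trans[OF K'(2)] mult_left_mono) (auto simp: less_imp_le)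
    then have "cmod (wigner_integrand f h p t) \<le> K * decay (fst p + t /\<^sub>R 2) * K'"
      unfolding wigner_integrand_def norm_mult norm_chr complex_mod_cnj mult_1_right
      using K K' by (intro mult_mono) auto
    also have "\<dots> \<le> K * ((1 + norm (fst p)) ^ (2 * DIM('a)) * 2 ^ (2 * DIM('a)) * decay t) * K'"
      using K K' by (intro mult_right_mono mult_left_mono decay_shift_half) auto
    finally show "cmod (wigner_integrand f h p t) \<le> (K * ((1 + norm (fst p)) ^ (2 * DIM('a)) * 2 ^ (2 * DIM('a))) * K') * decay t"
      by (simp add: mult_ac)
  qed
qed

lemma integrable_wigner_integrand:
  assumes f: "rapid f" and h: "rapid h"
  shows "integrable lborel (wigner_integrand f h p)"
proof -
  obtain C where C: "\<And>t. cmod (wigner_integrand f h p t) \<le> C * decay t"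
    using wigner_integrand_bound[OF assms] by blast
  show ?thesis
  proof (rule Bochner_Integration.integrable_bound[of lborel "\<lambda>t. C * decay t"])
    show "AE t in lborel. norm (wigner_integrand f h p t) \<le> norm (C * decay t)"
      by (intro AE_I2) (auto intro: order_trans[OF C abs_ge_self])
  qed (use assms in \<open>auto intro!: integrable_decay wigner_integrand_measurable rapid_C_infinity\<close>)
qed

text \<open>Uniform in \<open>p\<close>: the integral of
  \<open>decay (fst p + t /\<^sub>R 2)\<close> over t does not depend on the base point, and the
  substitution contributes \<open>2 ^ DIM('a)\<close>. The decay comes from the first factor, the
  second enters through its supremum.\<close>

lemma cross_wigner_bound:
  fixes f h :: "'a::euclidean_space \<Rightarrow> complex"
  assumes f: "rapid f" "\<And>x. cmod (f x) \<le> K * decay x" and h: "rapid h" "\<And>x. cmod (h x) \<le> K'"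
  shows "cmod (cross_wigner f h p) \<le> 2 ^ DIM('a) * (\<integral>x. decay (x::'a) \<partial>lborel) * K * K'"
proof -
  have K0: "K' \<ge> 0" using order_trans[OF norm_ge_zero h(2)] .
  have int: "integrable lborel (\<lambda>t. decay (fst p + t /\<^sub>R 2))"
    and eq: "(\<integral>t. decay (fst p + t /\<^sub>R 2) \<partial>lborel) = 2 ^ DIM('a) * (\<integral>x. decay (x::'a) \<partial>lborel)"
    using lborel_affine_integral[of "decay :: 'a \<Rightarrow> real" "1/2" "fst p"] integrable_decay[where 'a='a]
    by (auto simp: power_divide inverse_eq_divide)
  have "cmod (cross_wigner f h p) \<le> (\<integral>t. cmod (wigner_integrand f h p t) \<partial>lborel)"
    unfolding cross_wigner_eq by (rule integral_norm_bound)
  also have "\<dots> \<le> (\<integral>t. (K * K') * decay (fst p + t /\<^sub>R 2) \<partial>lborel)"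
  proof (intro integral_mono)
    show "integrable lborel (\<lambda>t. cmod (wigner_integrand f h p t))"
      by (intro integrable_norm integrable_wigner_integrand f h)
    show "integrable lborel (\<lambda>t. K * K' * decay (fst p + t /\<^sub>R 2))"
      by (intro integrable_mult_right int)
    fix t
    have "cmod (wigner_integrand f h p t) \<le> (K * decay (fst p + t /\<^sub>R 2)) * K'"
      unfolding wigner_integrand_def norm_mult norm_chr complex_mod_cnj mult_1_right
      using K0 by (intro mult_mono f h order_trans[OF norm_ge_zero f(2)]) auto
    then show "cmod (wigner_integrand f h p t) \<le> K * K' * decay (fst p + t /\<^sub>R 2)" by (simp add: mult_ac)
  qed
  also have "\<dots> = 2 ^ DIM('a) * (\<integral>x. decay (x::'a) \<partial>lborel) * K * K'"
    unfolding integral_mult_right_zero eq by (simp add: mult_ac)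
  finally show ?thesis .
qed

lemma chr_has_derivative:
  assumes "(g has_derivative g') (at x)"
  shows "((\<lambda>x. chr (g x)) has_derivative (\<lambda>v. of_real (g' v) * (2 * pi * \<i>) * chr (g x))) (at x)"
proof -
  have "((\<lambda>r. exp ((2 * pi * \<i>) * of_real r)) has_vector_derivative (2 * pi * \<i>) * exp ((2 * pi * \<i>) * of_real r)) (at r)" for r
  proof -
    have "((\<lambda>z. exp ((2 * pi * \<i>) * z)) has_field_derivative (2 * pi * \<i>) * exp ((2 * pi * \<i>) * of_real r)) (at (of_real r))"
      by (auto intro!: derivative_eq_intros)
    then show ?thesis by (rule has_vector_derivative_real_field)
  qed
  then have "(chr has_derivative (\<lambda>v. v *\<^sub>R ((2 * pi * \<i>) * chr r))) (at r)" for r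
    unfolding has_vector_derivative_def by (simp add: chr_eq_exp[abs_def])
  from has_derivative_compose[OF assms this] show ?thesis
    by (simp add: scaleR_conv_of_real mult_ac)
qed

lemma total_deriv_has_derivative: "f \<in> C_infinity \<Longrightarrow> (f has_derivative total_deriv f x) (at x)"
  using C_infinity_has_derivative[of f x] by (simp add: total_deriv_def[abs_def])

definition wigner_integrand_deriv where
  "wigner_integrand_deriv f h p t v =
     (total_deriv f (fst p + t /\<^sub>R 2) (fst v) * cnj (h (fst p - t /\<^sub>R 2))
      + f (fst p + t /\<^sub>R 2) * cnj (total_deriv h (fst p - t /\<^sub>R 2) (fst v))
      - of_real (t \<bullet> snd v) * (2 * pi * \<i>) * (f (fst p + t /\<^sub>R 2) * cnj (h (fst p - t /\<^sub>R 2)))) * chr (- (t \<bullet> snd p))"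

lemma wigner_integrand_has_derivative:
  assumes "f \<in> C_infinity" "h \<in> C_infinity"
  shows "((\<lambda>p. wigner_integrand f h p t) has_derivative wigner_integrand_deriv f h p t) (at p)"
proof -
  have a: "((\<lambda>p::'a\<times>'a. fst p + t /\<^sub>R 2) has_derivative fst) (at p)"
    "((\<lambda>p::'a\<times>'a. fst p - t /\<^sub>R 2) has_derivative fst) (at p)"
    "((\<lambda>p::'a\<times>'a. - (t \<bullet> snd p)) has_derivative (\<lambda>v. - (t \<bullet> snd v))) (at p)"
    by (auto intro!: derivative_eq_intros)
  note 1 = has_derivative_compose[OF a(1) total_deriv_has_derivative[OF assms(1)]]
  note 2 = bounded_linear.has_derivative[OF bounded_linear_cnj has_derivative_compose[OF a(2) total_deriv_has_derivative[OF assms(2)]]]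
  have "((\<lambda>p. wigner_integrand f h p t) has_derivative
     (\<lambda>v. f (fst p + t /\<^sub>R 2) * cnj (h (fst p - t /\<^sub>R 2)) * (of_real (- (t \<bullet> snd v)) * (2 * pi * \<i>) * chr (- (t \<bullet> snd p)))
       + (f (fst p + t /\<^sub>R 2) * cnj (total_deriv h (fst p - t /\<^sub>R 2) (fst v))
         + total_deriv f (fst p + t /\<^sub>R 2) (fst v) * cnj (h (fst p - t /\<^sub>R 2))) * chr (- (t \<bullet> snd p)))) (at p)"
    unfolding wigner_integrand_def
    by (rule has_derivative_mult[OF has_derivative_mult[OF 1 2] chr_has_derivative[OF a(3)]])
  then show ?thesis
    by (rule has_derivative_eq_rhs) (simp add: wigner_integrand_deriv_def[abs_def] algebra_simps)
qed

text \<open>The frequency derivative brings down a factor t. It is controlled because t is the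
  difference of the two arguments x + t/2 and x - t/2, so |t| can be shared out between
  \<open>f\<close> and \<open>h\<close>.\<close>

lemma cross_wigner_has_derivative:
  fixes f h :: "'a::euclidean_space \<Rightarrow> complex"
  assumes f: "rapid f" and h: "rapid h"
  shows "(cross_wigner f h has_derivative (\<lambda>v. \<integral>t. wigner_integrand_deriv f h p t v \<partial>lborel)) (at p)"
proof -
  have [measurable]: "f \<in> borel_measurable borel" "h \<in> borel_measurable borel"
    "\<And>b. b \<in> Basis \<Longrightarrow> partial_deriv b f \<in> borel_measurable borel"
    "\<And>b. b \<in> Basis \<Longrightarrow> partial_deriv b h \<in> borel_measurable borel"
    using f h by (auto intro!: C_infinity_measurable rapid_partial_deriv rapid_C_infinity)
  obtain K where K: "K > 0" "\<And>x. cmod (f x) \<le> K * decay x" "\<And>x. norm x * cmod (f x) \<le> K * decay x"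
    "\<And>x v. cmod (total_deriv f x v) \<le> K * decay x * norm v" using rapid_bounds[OF f] by blast
  obtain L where L: "L > 0" "\<And>x. cmod (h x) \<le> L * decay x" "\<And>x. norm x * cmod (h x) \<le> L * decay x"
    "\<And>x v. cmod (total_deriv h x v) \<le> L * decay x * norm v" using rapid_bounds[OF h] by blast
  have L1: "L * decay x \<le> L" for x using L(1) decay_le_1[of x] by (simp add: mult_left_le)
  \<comment> \<open>The Peetre constant for base points within distance 1 of \<open>fst p\<close>,
    hence 2 + |fst p|, times the power of 2 for halving t.\<close>
  define Q where "Q = (2 + norm (fst p)) ^ (2 * DIM('a)) * 2 ^ (2 * DIM('a))"
  have "((\<lambda>q. \<integral>t. wigner_integrand f h q t \<partial>lborel) has_derivative (\<lambda>v. \<integral>t. wigner_integrand_deriv f h p t v \<partial>lborel)) (at p)"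
  \<comment> \<open>The 2 counts the derivatives of \<open>f\<close> and \<open>h\<close>;
    \<open>4 * pi\<close> is the phase factor 2 \<pi> times the two shares of |t|.\<close>
  proof (rule has_derivative_integral[where r = 1 and K = "\<lambda>t. ((2 + 4 * pi) * K * L * Q) * decay t"])
    show "((\<lambda>q. wigner_integrand f h q t) has_derivative wigner_integrand_deriv f h q t) (at q)" for q t
      using f h by (intro wigner_integrand_has_derivative rapid_C_infinity)
    show "integrable lborel (wigner_integrand f h q)" for q
      by (intro integrable_wigner_integrand f h)
    show "(\<lambda>t. wigner_integrand_deriv f h p t v) \<in> borel_measurable lborel" for v
    proof -
      obtain a b c d where p: "p = (a, b)" "v = (c, d)" by (meson surj_pair)
      show ?thesis unfolding p wigner_integrand_deriv_def total_deriv_def fst_conv snd_conv by measurable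
    qed
    show "integrable lborel (\<lambda>t::'a. ((2 + 4 * pi) * K * L * Q) * decay t)"
      by (intro integrable_mult_right integrable_decay)
    fix q v :: "'a \<times> 'a" and t :: 'a assume q: "dist q p < 1"
    let ?x = "fst q + t /\<^sub>R 2" and ?y = "fst q - t /\<^sub>R 2"
    have v: "norm (fst v) \<le> norm v" "norm (snd v) \<le> norm v"
      using norm_fst_le[of "fst v" "snd v"] norm_snd_le[of "snd v" "fst v"] by simp_all
    have "dist (fst q) (fst p) < 1" using dist_fst_le[of q p] q by linarith
    then have "norm (fst q) \<le> norm (fst p) + 1"
      using norm_triangle_ineq2[of "fst q" "fst p"] by (simp add: dist_norm)
    then have "decay ?x \<le> Q * decay t"
      unfolding Q_def by (intro order_trans[OF decay_shift_half] mult_right_mono power_mono) auto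
    have 1: "cmod (total_deriv f ?x (fst v) * cnj (h ?y)) \<le> (K * decay ?x * norm v) * L"
      unfolding norm_mult complex_mod_cnj
      using K(1) v by (intro mult_mono order_trans[OF K(4)] order_trans[OF L(2) L1] mult_left_mono) auto
    have 2: "cmod (f ?x * cnj (total_deriv h ?y (fst v))) \<le> (K * decay ?x) * (L * norm v)"
      unfolding norm_mult complex_mod_cnj
      using K(1) v L(1) by (intro mult_mono K(2) order_trans[OF L(4)] L1) auto
    have "norm t \<le> norm ?x + norm ?y"
      using norm_triangle_ineq4[of ?x ?y] by (simp add: algebra_simps flip: scaleR_2)
    then have "norm t * (cmod (f ?x) * cmod (h ?y)) \<le> (norm ?x + norm ?y) * (cmod (f ?x) * cmod (h ?y))"
      by (intro mult_right_mono) auto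
    also have "\<dots> = (norm ?x * cmod (f ?x)) * cmod (h ?y) + cmod (f ?x) * (norm ?y * cmod (h ?y))"
      by (simp add: algebra_simps)
    also have "\<dots> \<le> (K * decay ?x) * L + (K * decay ?x) * L"
      using K(1) by (intro add_mono mult_mono K(2,3) order_trans[OF L(2) L1] order_trans[OF L(3) L1]) auto
    finally have t: "norm t * (cmod (f ?x) * cmod (h ?y)) \<le> 2 * K * L * decay ?x" by (simp add: mult_ac)
    have "cmod (of_real (t \<bullet> snd v) * (2 * pi * \<i>) * (f ?x * cnj (h ?y)))
        = \<bar>t \<bullet> snd v\<bar> * (2 * pi) * (cmod (f ?x) * cmod (h ?y))"
      by (simp add: norm_mult)
    also have "\<dots> \<le> (norm t * norm v) * (2 * pi) * (cmod (f ?x) * cmod (h ?y))"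
      using v by (intro mult_right_mono order_trans[OF Cauchy_Schwarz_ineq2] mult_left_mono) auto
    also have "\<dots> = (2 * pi * norm v) * (norm t * (cmod (f ?x) * cmod (h ?y)))" by (simp add: mult_ac)
    also have "\<dots> \<le> (2 * pi * norm v) * (2 * K * L * decay ?x)"
      using t by (intro mult_left_mono) auto
    finally have 3: "cmod (of_real (t \<bullet> snd v) * (2 * pi * \<i>) * (f ?x * cnj (h ?y))) \<le> (2 * pi * norm v) * (2 * K * L * decay ?x)" .
    have "cmod (wigner_integrand_deriv f h q t v) \<le> (K * decay ?x * norm v) * L + (K * decay ?x) * (L * norm v)
        + (2 * pi * norm v) * (2 * K * L * decay ?x)"
      unfolding wigner_integrand_deriv_def norm_mult[of _ "chr _"] norm_chr mult_1_right
      by (intro order_trans[OF norm_triangle_ineq4] add_mono order_trans[OF norm_triangle_ineq] 1 2 3)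
    also have "\<dots> = ((2 + 4 * pi) * K * L * norm v) * decay ?x" by (simp add: algebra_simps)
    also have "\<dots> \<le> ((2 + 4 * pi) * K * L * norm v) * (Q * decay t)"
      using K(1) L(1) \<open>decay ?x \<le> Q * decay t\<close> by (intro mult_left_mono) (auto simp: pi_ge_zero)
    finally show "cmod (wigner_integrand_deriv f h q t v) \<le> ((2 + 4 * pi) * K * L * Q) * decay t * norm v"
      by (simp add: mult_ac)
  qed simp
  then show ?thesis by (simp add: cross_wigner_eq[abs_def])
qed

lemma total_deriv_basis: "b \<in> Basis \<Longrightarrow> total_deriv f x b = partial_deriv b f x"
  unfolding total_deriv_def by (subst sum.remove[of _ b]) (auto simp: inner_Basis intro!: sum.neutral split: if_splits)

lemma total_deriv_0: "total_deriv f x 0 = 0" by (simp add: total_deriv_def)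

section \<open>Coordinates and derivatives acting on the cross-Wigner distribution\<close>

lemma partial_deriv_cross_wigner_fst:
  assumes f: "rapid f" and h: "rapid h" and b: "b \<in> Basis"
  shows "partial_deriv (b, 0) (cross_wigner f h) p
    = cross_wigner (partial_deriv b f) h p + cross_wigner f (partial_deriv b h) p"
proof -
  have "partial_deriv (b, 0) (cross_wigner f h) p = (\<integral>t. wigner_integrand_deriv f h p t (b, 0) \<partial>lborel)"
    by (rule partial_deriv_eqI[OF cross_wigner_has_derivative[OF f h]])
  also have "(\<lambda>t. wigner_integrand_deriv f h p t (b, 0))
      = (\<lambda>t. wigner_integrand (partial_deriv b f) h p t + wigner_integrand f (partial_deriv b h) p t)"
    by (simp add: wigner_integrand_deriv_def wigner_integrand_def total_deriv_basis b algebra_simps)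
  finally show ?thesis
    unfolding cross_wigner_eq
    using integrable_wigner_integrand[OF rapid_partial_deriv[OF f b] h, of p]
      integrable_wigner_integrand[OF f rapid_partial_deriv[OF h b], of p] by simp
qed

text \<open>The factor t_b from the phase is the difference of the coordinates of x + t/2 and x -
  t/2, the arguments of \<open>f\<close> and \<open>h\<close>.\<close>

lemma partial_deriv_cross_wigner_snd:
  assumes f: "rapid f" and h: "rapid h" and b: "b \<in> Basis"
  shows "partial_deriv (0, b) (cross_wigner f h) p
    = - (2 * pi * \<i>) * cross_wigner (\<lambda>x. of_real (x \<bullet> b) * f x) h p + (2 * pi * \<i>) * cross_wigner f (\<lambda>x. of_real (x \<bullet> b) * h x) p"
proof -
  have "partial_deriv (0, b) (cross_wigner f h) p = (\<integral>t. wigner_integrand_deriv f h p t (0, b) \<partial>lborel)"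
    by (rule partial_deriv_eqI[OF cross_wigner_has_derivative[OF f h]])
  also have "(\<lambda>t. wigner_integrand_deriv f h p t (0, b))
      = (\<lambda>t. - (2 * pi * \<i>) * wigner_integrand (\<lambda>x. of_real (x \<bullet> b) * f x) h p t
        + (2 * pi * \<i>) * wigner_integrand f (\<lambda>x. of_real (x \<bullet> b) * h x) p t)"
  proof
    fix t :: 'a
    let ?x = "fst p + t /\<^sub>R 2" and ?y = "fst p - t /\<^sub>R 2"
    have t: "t \<bullet> b = ?x \<bullet> b - ?y \<bullet> b" by (simp add: algebra_simps)
    show "wigner_integrand_deriv f h p t (0, b) = - (2 * pi * \<i>) * wigner_integrand (\<lambda>x. of_real (x \<bullet> b) * f x) h p t
        + (2 * pi * \<i>) * wigner_integrand f (\<lambda>x. of_real (x \<bullet> b) * h x) p t"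
      unfolding wigner_integrand_deriv_def wigner_integrand_def fst_conv snd_conv total_deriv_0 t of_real_diff
      by (simp add: algebra_simps del: of_real_diff)
  qed
  finally show ?thesis
    unfolding cross_wigner_eq
    using integrable_wigner_integrand[OF rapid_coord_mult[OF f b] h, of p]
      integrable_wigner_integrand[OF f rapid_coord_mult[OF h b], of p] by simp
qed

text \<open>The base point x is the mean of the two arguments x + t/2 and x - t/2.\<close>

lemma fst_mult_cross_wigner:
  assumes f: "rapid f" and h: "rapid h" and b: "b \<in> Basis"
  shows "of_real (fst p \<bullet> b) * cross_wigner f h p
    = (1 / 2) * cross_wigner (\<lambda>x. of_real (x \<bullet> b) * f x) h p + (1 / 2) * cross_wigner f (\<lambda>x. of_real (x \<bullet> b) * h x) p"
proof -
  have "of_real (fst p \<bullet> b) * cross_wigner f h p = (\<integral>t. of_real (fst p \<bullet> b) * wigner_integrand f h p t \<partial>lborel)"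
    by (simp add: cross_wigner_eq)
  also have "(\<lambda>t. of_real (fst p \<bullet> b) * wigner_integrand f h p t)
      = (\<lambda>t. (1 / 2) * wigner_integrand (\<lambda>x. of_real (x \<bullet> b) * f x) h p t
        + (1 / 2) * wigner_integrand f (\<lambda>x. of_real (x \<bullet> b) * h x) p t)"
  proof
    fix t :: 'a
    let ?x = "fst p + t /\<^sub>R 2" and ?y = "fst p - t /\<^sub>R 2"
    have t: "fst p \<bullet> b = (?x \<bullet> b) / 2 + (?y \<bullet> b) / 2" by (simp add: inner_add_left inner_diff_left field_simps)
    show "of_real (fst p \<bullet> b) * wigner_integrand f h p t = (1 / 2) * wigner_integrand (\<lambda>x. of_real (x \<bullet> b) * f x) h p t
        + (1 / 2) * wigner_integrand f (\<lambda>x. of_real (x \<bullet> b) * h x) p t"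
      by (subst t) (simp add: wigner_integrand_def ring_distribs mult_ac)
  qed
  finally show ?thesis
    unfolding cross_wigner_eq
    using integrable_wigner_integrand[OF rapid_coord_mult[OF f b] h, of p]
      integrable_wigner_integrand[OF f rapid_coord_mult[OF h b], of p] by simp
qed

text \<open>Integration by parts in t. The derivative \<open>G'\<close> of the integrand along b has
  integral 0; the inner factors 1/2 and -1/2 act on \<open>f\<close> and \<open>h\<close>, and the
  phase yields the frequency coordinate times -2 \<pi> i.\<close>

lemma snd_mult_cross_wigner:
  fixes f h :: "'a::euclidean_space \<Rightarrow> complex"
  assumes f: "rapid f" and h: "rapid h" and b: "b \<in> Basis"
  shows "of_real (snd p \<bullet> b) * cross_wigner f h p
    = (1 / (4 * pi * \<i>)) * cross_wigner (partial_deriv b f) h p + (- (1 / (4 * pi * \<i>))) * cross_wigner f (partial_deriv b h) p"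
proof -
  let ?f = "partial_deriv b f" and ?h = "partial_deriv b h"
  note int = integrable_wigner_integrand[OF f h, of p] integrable_wigner_integrand[OF rapid_partial_deriv[OF f b] h, of p]
      integrable_wigner_integrand[OF f rapid_partial_deriv[OF h b], of p]
  define G' where "G' t = (1 / 2) * wigner_integrand ?f h p t - (1 / 2) * wigner_integrand f ?h p t
    - (2 * pi * \<i>) * of_real (snd p \<bullet> b) * wigner_integrand f h p t" for t
  obtain C1 where C1: "\<And>t. cmod (wigner_integrand f h p t) \<le> C1 * decay t"
    using wigner_integrand_bound[OF f h] by blast
  obtain C2 where C2: "\<And>t. cmod (wigner_integrand ?f h p t) \<le> C2 * decay t"
    using wigner_integrand_bound[OF rapid_partial_deriv[OF f b] h] by blast
  obtain C3 where C3: "\<And>t. cmod (wigner_integrand f ?h p t) \<le> C3 * decay t"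
    using wigner_integrand_bound[OF f rapid_partial_deriv[OF h b]] by blast
  have "(\<integral>t. G' t \<partial>lborel) = 0"
  proof (rule integral_directional_deriv_eq_0[OF int(1)])
    show "norm b \<le> 1" using b by simp
    have "wigner_integrand f h p \<in> borel_measurable borel" "wigner_integrand ?f h p \<in> borel_measurable borel"
      "wigner_integrand f ?h p \<in> borel_measurable borel"
      using f h b by (auto intro!: wigner_integrand_measurable rapid_C_infinity rapid_partial_deriv)
    then show "G' \<in> borel_measurable borel"
      unfolding G'_def[abs_def] by measurable
    show "((\<lambda>r. wigner_integrand f h p (t + r *\<^sub>R b)) has_vector_derivative G' (t + r *\<^sub>R b)) (at r)" for t r
    proof -
      have aff: "((\<lambda>r. fst p + (t + r *\<^sub>R b) /\<^sub>R 2) has_derivative (\<lambda>v. (v / 2) *\<^sub>R b)) (at r)"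
        "((\<lambda>r. fst p - (t + r *\<^sub>R b) /\<^sub>R 2) has_derivative (\<lambda>v. (- v / 2) *\<^sub>R b)) (at r)"
        "((\<lambda>r. - ((t + r *\<^sub>R b) \<bullet> snd p)) has_derivative (\<lambda>v. - (v * (b \<bullet> snd p)))) (at r)"
        by (auto intro!: derivative_eq_intros simp: algebra_simps)
      have td: "total_deriv k x (a *\<^sub>R b) = a *\<^sub>R partial_deriv b k x" for k x a
        using total_deriv_basis[OF b, of k x] by (simp add: total_deriv_def scaleR_right.sum[symmetric] flip: scaleR_scaleR)
      have td': "total_deriv k x (- (a *\<^sub>R b)) = - (a *\<^sub>R partial_deriv b k x)" for k x a
        using td[of k x "- a"] by simp
      note 1 = has_derivative_compose[OF aff(1) total_deriv_has_derivative[OF rapid_C_infinity[OF f]]]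
      note 2 = bounded_linear.has_derivative[OF bounded_linear_cnj
          has_derivative_compose[OF aff(2) total_deriv_has_derivative[OF rapid_C_infinity[OF h]]]]
      show ?thesis
        unfolding has_vector_derivative_def
        by (rule has_derivative_eq_rhs[OF has_derivative_mult[OF has_derivative_mult[OF 1 2] chr_has_derivative[OF aff(3)]],
            folded wigner_integrand_def])
          (auto simp: G'_def wigner_integrand_def td td' scaleR_conv_of_real inner_commute[of b] algebra_simps)
    qed
    show "cmod (G' t) \<le> ((1 / 2) * C2 + (1 / 2) * C3 + (2 * pi) * \<bar>snd p \<bullet> b\<bar> * C1) * decay (t - 0)" for t
    proof -
      have "cmod (G' t) \<le> cmod ((1 / 2) * wigner_integrand ?f h p t) + cmod ((1 / 2) * wigner_integrand f ?h p t)
          + cmod ((2 * pi * \<i>) * of_real (snd p \<bullet> b) * wigner_integrand f h p t)"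
        unfolding G'_def by (intro order_trans[OF norm_triangle_ineq4] add_mono) auto
      also have "\<dots> = (1 / 2) * cmod (wigner_integrand ?f h p t) + (1 / 2) * cmod (wigner_integrand f ?h p t)
          + (2 * pi) * \<bar>snd p \<bullet> b\<bar> * cmod (wigner_integrand f h p t)"
        by (simp add: norm_mult)
      also have "\<dots> \<le> (1 / 2) * (C2 * decay t) + (1 / 2) * (C3 * decay t) + (2 * pi) * \<bar>snd p \<bullet> b\<bar> * (C1 * decay t)"
        by (intro add_mono mult_left_mono C1 C2 C3) auto
      finally show ?thesis by (simp add: algebra_simps)
    qed
  qed
  moreover have "(\<integral>t. G' t \<partial>lborel) = (1 / 2) * cross_wigner ?f h p - (1 / 2) * cross_wigner f ?h p
      - (2 * pi * \<i>) * of_real (snd p \<bullet> b) * cross_wigner f h p"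
    unfolding G'_def cross_wigner_eq using int by simp
  ultimately have "(2 * pi * \<i>) * of_real (snd p \<bullet> b) * cross_wigner f h p = (1 / 2) * cross_wigner ?f h p - (1 / 2) * cross_wigner f ?h p"
    by simp
  then have "(1 / (2 * pi * \<i>)) * ((2 * pi * \<i>) * of_real (snd p \<bullet> b) * cross_wigner f h p)
      = (1 / (2 * pi * \<i>)) * ((1 / 2) * cross_wigner ?f h p - (1 / 2) * cross_wigner f ?h p)" by simp
  then show ?thesis by (simp add: field_simps)
qed

text \<open>The moduli 1/2, 1, 1/(4 \<pi>) and 2 \<pi> share the crude bound 2 \<pi>. Coefficients
  and letters are fixed before \<open>f\<close> and \<open>h\<close>, so that the rule can be
  iterated along a word.\<close>

lemma op_letter_cross_wigner:
  fixes l :: "bool \<times> ('a::euclidean_space \<times> 'a)"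
  assumes "l \<in> UNIV \<times> Basis"
  obtains c1 c2 and l1 l2 :: "bool \<times> 'a" where "cmod c1 \<le> 2 * pi" "cmod c2 \<le> 2 * pi"
    "l1 \<in> UNIV \<times> Basis" "l2 \<in> UNIV \<times> Basis"
    "\<And>f h. rapid f \<Longrightarrow> rapid h \<Longrightarrow> op_letter l (cross_wigner f h)
      = (\<lambda>p. c1 * cross_wigner (op_letter l1 f) h p + c2 * cross_wigner f (op_letter l2 h) p)"
proof -
  have pi: "2 * pi \<ge> 1" "4 * pi \<ge> 1" using pi_gt3 by linarith+
  then have pi': "1 / (4 * pi) \<le> 2 * pi" by (smt (verit) divide_le_eq_1)
  obtain d e where l: "l = (d, e)" "e \<in> Basis" using assms by (cases l) auto
  from l(2) consider b where "e = (b, 0)" "b \<in> Basis" | b where "e = (0, b)" "b \<in> Basis"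
    by (auto simp: Basis_prod_def)
  then show ?thesis
  proof cases
    case 1
    show ?thesis
    proof (cases d)
      case True
      show ?thesis
        by (rule that[of "1 / 2" "1 / 2" "(True, b)" "(True, b)"])
          (use 1 True l pi in \<open>auto simp: inner_prod_def fst_mult_cross_wigner\<close>)
    next
      case False
      show ?thesis
        by (rule that[of 1 1 "(False, b)" "(False, b)"])
          (use 1 False l pi in \<open>auto simp: partial_deriv_cross_wigner_fst\<close>)
    qed
  next
    case 2
    show ?thesis
    proof (cases d)
      case True
      show ?thesis
        by (rule that[of "1 / (4 * pi * \<i>)" "- (1 / (4 * pi * \<i>))" "(False, b)" "(False, b)"])
          (use 2 True l pi' in \<open>auto simp: inner_prod_def snd_mult_cross_wigner norm_divide norm_mult\<close>)
    next
      case False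
      show ?thesis
        by (rule that[of "- (2 * pi * \<i>)" "2 * pi * \<i>" "(True, b)" "(True, b)"])
          (use 2 False l in \<open>auto simp: partial_deriv_cross_wigner_snd norm_mult\<close>)
    qed
  qed
qed

text \<open>A partial derivative is again a combination of two cross-Wigner distributions of rapidly
  decreasing functions, so the induction on the order passes through
  \<open>C_k_lincomb\<close>.\<close>

lemma C_infinity_cross_wigner:
  fixes f h :: "'a::euclidean_space \<Rightarrow> complex"
  assumes "rapid f" "rapid h"
  shows "cross_wigner f h \<in> C_infinity"
proof -
  have diff: "cross_wigner f h differentiable_on UNIV" if "rapid f" "rapid h" for f h :: "'a \<Rightarrow> complex"
    using cross_wigner_has_derivative[OF that] by (meson differentiable_at_imp_differentiable_on differentiableI)
  have "C_k k (cross_wigner f h)" if "rapid f" "rapid h" for k and f h :: "'a \<Rightarrow> complex"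
    using that
  proof (induction k arbitrary: f h)
    case 0
    then show ?case using diff by (simp add: differentiable_imp_continuous_on)
  next
    case (Suc k)
    have "C_k k (partial_deriv b (cross_wigner f h))" if b: "b \<in> Basis" for b :: "'a \<times> 'a"
    proof -
      have bl: "(False, b) \<in> UNIV \<times> Basis" using b by simp
      obtain c1 c2 and l1 l2 :: "bool \<times> 'a" where c: "cmod c1 \<le> 2 * pi" "cmod c2 \<le> 2 * pi" and
        l: "l1 \<in> UNIV \<times> Basis" "l2 \<in> UNIV \<times> Basis" and
        eq: "\<And>f h. rapid f \<Longrightarrow> rapid h \<Longrightarrow> op_letter (False, b) (cross_wigner f h)
          = (\<lambda>p. c1 * cross_wigner (op_letter l1 f) h p + c2 * cross_wigner f (op_letter l2 h) p)"
        by (rule op_letter_cross_wigner[OF bl]) (rule that)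
      have "C_k k (\<lambda>p. c1 * cross_wigner (op_letter l1 f) h p + c2 * cross_wigner f (op_letter l2 h) p)"
        using Suc.prems l by (intro C_k_lincomb Suc.IH rapid_op_letter)
      then show ?thesis using eq[OF Suc.prems] by simp
    qed
    with Suc.prems diff show ?case by simp
  qed
  with assms show ?thesis by (simp add: C_infinity_def)
qed

text \<open>Every letter turns one term into two, with coefficients of modulus at most 2 \<pi>: a
  factor 4 \<pi> per letter. The words \<open>w1\<close> and \<open>w2\<close> hold the letters
  already transferred to the two factors.\<close>

lemma word_bounded_cross_wigner:
  fixes f h :: "'a::euclidean_space \<Rightarrow> complex"
  assumes f: "rapid f" and h: "rapid h"
    and H: "\<And>w1 w2 p. w1 \<in> words \<Longrightarrow> w2 \<in> words \<Longrightarrow> cmod (cross_wigner (word_op w1 f) (word_op w2 h) p) \<le> H (length w1 + length w2)"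
  shows "word_bounded (\<lambda>n. (4 * pi) ^ n * H n) (cross_wigner f h)"
proof -
  have "cmod (word_op w (cross_wigner (word_op w1 f) (word_op w2 h)) p) \<le> (4 * pi) ^ length w * H (length w + length w1 + length w2)"
    if "w \<in> words" "w1 \<in> words" "w2 \<in> words" for w w1 w2 p
    using that
  proof (induction w arbitrary: w1 w2 rule: rev_induct)
    case Nil
    then show ?case using H by simp
  next
    case (snoc l w)
    then have w: "w \<in> words" and l: "l \<in> UNIV \<times> Basis" by auto
    obtain c1 c2 and l1 l2 :: "bool \<times> 'a" where c: "cmod c1 \<le> 2 * pi" "cmod c2 \<le> 2 * pi"
      and l12: "l1 \<in> UNIV \<times> Basis" "l2 \<in> UNIV \<times> Basis" and
      eq: "\<And>f h. rapid f \<Longrightarrow> rapid h \<Longrightarrow> op_letter l (cross_wigner f h)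
          = (\<lambda>p. c1 * cross_wigner (op_letter l1 f) h p + c2 * cross_wigner f (op_letter l2 h) p)"
      by (rule op_letter_cross_wigner[OF l]) (rule that)
    have r: "rapid (word_op w1 f)" "rapid (word_op w2 h)" using f h snoc.prems by (auto intro: rapid_word_op)
    have lw: "l1 # w1 \<in> words" "l2 # w2 \<in> words" using l12 snoc.prems by auto
    let ?B = "(4 * pi) ^ length w * H (Suc (length w + length w1 + length w2))"
    have IH1: "cmod (word_op w (cross_wigner (word_op (l1 # w1) f) (word_op w2 h)) p) \<le> ?B"
      using snoc.IH[OF w lw(1) snoc.prems(3)] by simp
    have IH2: "cmod (word_op w (cross_wigner (word_op w1 f) (word_op (l2 # w2) h)) p) \<le> ?B"
      using snoc.IH[OF w snoc.prems(2) lw(2)] by simp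
    have B0: "?B \<ge> 0" by (rule order_trans[OF norm_ge_zero IH1])
    have "word_op (w @ [l]) (cross_wigner (word_op w1 f) (word_op w2 h)) p
      = word_op w (\<lambda>p. c1 * cross_wigner (word_op (l1 # w1) f) (word_op w2 h) p + c2 * cross_wigner (word_op w1 f) (word_op (l2 # w2) h) p) p"
      using eq[OF r] by simp
    also have "\<dots> = c1 * word_op w (cross_wigner (word_op (l1 # w1) f) (word_op w2 h)) p
        + c2 * word_op w (cross_wigner (word_op w1 f) (word_op (l2 # w2) h)) p"
      using word_op_lincomb[OF C_infinity_cross_wigner[OF rapid_word_op[OF f lw(1)] r(2)]
          C_infinity_cross_wigner[OF r(1) rapid_word_op[OF h lw(2)]] w] by metis
    also have "cmod \<dots> \<le> cmod c1 * cmod (word_op w (cross_wigner (word_op (l1 # w1) f) (word_op w2 h)) p)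
        + cmod c2 * cmod (word_op w (cross_wigner (word_op w1 f) (word_op (l2 # w2) h)) p)"
      by (rule order_trans[OF norm_triangle_ineq]) (simp add: norm_mult)
    also have "\<dots> \<le> 2 * pi * ?B + 2 * pi * ?B"
      by (intro add_mono mult_mono c IH1 IH2) auto
    finally show ?case by (simp add: mult_ac)
  qed
  from this[of _ "[]" "[]"] f h show ?thesis by (simp add: word_bounded_def C_infinity_cross_wigner)
qed

text \<open>Decay of the first factor costs \<open>2 * DIM('a)\<close> additional letters; splitting
  the factorial of the longer word enlarges the rate from \<open>A\<close> to
  \<open>2 powr s * A\<close>. The new rate is explicit because in \<open>Sigma11_space\<close> it
  must be prescribed.\<close>

lemma cross_wigner_word_bounded:
  fixes g :: "'a::euclidean_space \<Rightarrow> complex"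
  assumes g: "word_bounded (\<lambda>n. c * A ^ n * fact_pow s n) g" and A: "A > 0" and c: "c > 0" and s: "s \<ge> 0"
  obtains C where "C > 0" "word_bounded (\<lambda>n. C * (4 * pi * (2 powr s * A)) ^ n * fact_pow s n) (cross_wigner g g)"
proof -
  let ?M = "2 * DIM('a)"
  define I where "I = 2 ^ DIM('a) * (\<integral>x. decay (x::'a) \<partial>lborel)"
  have I0: "I \<ge> 0" unfolding I_def by (intro mult_nonneg_nonneg integral_nonneg_AE) auto
  have r: "rapid g" using g by (auto simp: rapid_def)
  define E where "E = 2 powr s"
  have E: "E \<ge> 1" using s by (simp add: E_def ge_one_powr_ge_zero)
  define C1 where "C1 = 2 ^ ?M * (c + real DIM('a) ^ ?M * (c * (E * A) ^ ?M * fact_pow s ?M))"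
  have C1: "C1 > 0" unfolding C1_def using c A E by (intro mult_pos_pos add_pos_nonneg) auto
  have "cmod (cross_wigner (word_op w1 g) (word_op w2 g) p)
      \<le> ((I + 1) * C1 * c) * (E * A) ^ (length w1 + length w2) * fact_pow s (length w1 + length w2)"
    if w: "w1 \<in> words" "w2 \<in> words" for w1 w2 p
  proof -
    let ?n = "length w1" and ?k = "length w2"
    have b1: "c * A ^ ?n * fact_pow s ?n \<le> c * (E * A) ^ ?n * fact_pow s ?n"
      unfolding power_mult_distrib using c A E by (intro mult_right_mono mult_left_mono) (auto simp: one_le_power)
    have b2: "c * A ^ (?M + ?n) * fact_pow s (?M + ?n) \<le> (c * (E * A) ^ ?M * fact_pow s ?M) * ((E * A) ^ ?n * fact_pow s ?n)"
    proof -
      have "c * A ^ (?M + ?n) * fact_pow s (?M + ?n) \<le> c * A ^ (?M + ?n) * (E ^ (?M + ?n) * (fact_pow s ?M * fact_pow s ?n))"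
        unfolding E_def using c A s by (intro mult_left_mono fact_pow_add_le) auto
      then show ?thesis by (simp add: power_add power_mult_distrib mult_ac)
    qed
    have k1: "cmod (word_op w1 g x) \<le> (C1 * (E * A) ^ ?n * fact_pow s ?n) * decay x" for x
    proof -
      have "cmod (word_op w1 g x) \<le> 2 ^ ?M * (c * A ^ (0 + ?n) * fact_pow s (0 + ?n)
        + real DIM('a) ^ ?M * (c * A ^ (?M + ?n) * fact_pow s (?M + ?n))) * decay x"
        by (rule word_bounded_decay[OF word_bounded_word_op[OF g w(1)]])
      also have "\<dots> \<le> 2 ^ ?M * (c * (E * A) ^ ?n * fact_pow s ?n
        + real DIM('a) ^ ?M * ((c * (E * A) ^ ?M * fact_pow s ?M) * ((E * A) ^ ?n * fact_pow s ?n))) * decay x"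
        using b1 b2 by (intro mult_right_mono mult_left_mono add_mono) auto
      also have "\<dots> = (C1 * (E * A) ^ ?n * fact_pow s ?n) * decay x"
        by (simp add: C1_def algebra_simps)
      finally show ?thesis .
    qed
    have k2: "cmod (word_op w2 g x) \<le> c * (E * A) ^ ?k * fact_pow s ?k" for x
    proof -
      have "cmod (word_op w2 g x) \<le> c * A ^ ?k * fact_pow s ?k" using g w by (simp add: word_bounded_def)
      also have "\<dots> \<le> c * (E * A) ^ ?k * fact_pow s ?k"
        unfolding power_mult_distrib using c A E by (intro mult_right_mono mult_left_mono) (auto simp: one_le_power)
      finally show ?thesis .
    qed
    have "cmod (cross_wigner (word_op w1 g) (word_op w2 g) p) \<le> I * (C1 * (E * A) ^ ?n * fact_pow s ?n) * (c * (E * A) ^ ?k * fact_pow s ?k)"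
      unfolding I_def by (rule cross_wigner_bound[OF rapid_word_op[OF r w(1)] k1 rapid_word_op[OF r w(2)] k2])
    also have "\<dots> = (I * C1 * c) * (E * A) ^ (?n + ?k) * (fact_pow s ?n * fact_pow s ?k)"
      by (simp add: power_add)
    also have "\<dots> \<le> ((I + 1) * C1 * c) * (E * A) ^ (?n + ?k) * fact_pow s (?n + ?k)"
      using I0 C1 c E A s by (intro mult_mono fact_pow_mult_le) auto
    finally show ?thesis .
  qed
  then have "word_bounded (\<lambda>n. (4 * pi) ^ n * (((I + 1) * C1 * c) * (E * A) ^ n * fact_pow s n)) (cross_wigner g g)"
    by (rule word_bounded_cross_wigner[OF r r])
  also have "(\<lambda>n. (4 * pi) ^ n * (((I + 1) * C1 * c) * (E * A) ^ n * fact_pow s n)) = (\<lambda>n. ((I + 1) * C1 * c) * (4 * pi * (2 powr s * A)) ^ n * fact_pow s n)"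
    unfolding E_def[symmetric] by (simp add: power_mult_distrib mult_ac)
  finally show ?thesis using I0 C1 c by (intro that[of "(I + 1) * C1 * c"]) auto
qed

lemma cross_wigner_GS_space:
  assumes "g \<in> GS_space s s" "s \<ge> 1 / 2"
  obtains C A where "C > 0" "A > 0" "word_bounded (\<lambda>n. C * A ^ n * fact_pow s n) (cross_wigner g g)"
proof -
  obtain A c where *: "A > 0" "c > 0" "word_bounded (\<lambda>n. c * A ^ n * fact_pow s n) g"
    using GS_space_word_bounded[OF assms] by blast
  obtain C where "C > 0" "word_bounded (\<lambda>n. C * (4 * pi * (2 powr s * A)) ^ n * fact_pow s n) (cross_wigner g g)"
    by (rule cross_wigner_word_bounded[OF *(3,1,2)]) (use assms in auto)
  with * show ?thesis by (intro that[of C "4 * pi * (2 powr s * A)"]) auto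
qed

lemma cross_wigner_Sigma11_space:
  assumes "g \<in> Sigma11_space" "A > 0"
  obtains C where "C > 0" "word_bounded (\<lambda>n. C * A ^ n * fact n) (cross_wigner g g)"
proof -
  \<comment> \<open>Chosen so that the rate 4 \<pi> 2^1 B of the Wigner distribution is exactly
    \<open>A\<close>.\<close>
  define B where "B = A / (8 * pi)"
  have B: "B > 0" using assms by (simp add: B_def)
  obtain c where "c > 0" "word_bounded (\<lambda>n. c * B ^ n * fact n) g"
    by (rule Sigma11_space_word_bounded[OF assms(1) B])
  then have *: "c > 0" "word_bounded (\<lambda>n. c * B ^ n * fact_pow 1 n) g" by simp_all
  obtain C where "C > 0" "word_bounded (\<lambda>n. C * (4 * pi * (2 powr 1 * B)) ^ n * fact_pow 1 n) (cross_wigner g g)"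
    by (rule cross_wigner_word_bounded[OF *(2) B *(1)]) auto
  moreover have "4 * pi * (2 powr 1 * B) = A" by (simp add: B_def)
  ultimately show ?thesis using that[of C] by (simp only: fact_pow_1)
qed

text \<open>For fixed x, W(g,g)(x, \<cdot>) is the Fourier transform of a continuous integrable
  function with value |g(x)|^2 at 0; were it zero for a point with g(x) \<noteq> 0, inversion would
  give a contradiction.\<close>

lemma cross_wigner_nonzero:
  fixes g :: "'a::euclidean_space \<Rightarrow> complex"
  assumes g: "rapid g" and "g \<noteq> (\<lambda>t. 0)"
  obtains p where "cross_wigner g g p \<noteq> 0"
proof -
  obtain x where x: "g x \<noteq> 0" using assms(2) by blast
  have "\<exists>p. cross_wigner g g p \<noteq> 0"
  proof (rule ccontr)
    assume neg: "\<not> (\<exists>p. cross_wigner g g p \<noteq> 0)"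
    let ?F = "wigner_integrand g g (x, 0)"
    have "isCont g y" for y by (intro C_infinity_isCont rapid_C_infinity g)
    then have "continuous_on UNIV g" by (simp add: continuous_on_eq_continuous_at)
    then have "continuous_on UNIV ?F"
      unfolding wigner_integrand_def[abs_def] by (auto intro!: continuous_intros continuous_on_compose2[of UNIV g])
    then have cont: "isCont ?F 0" by (simp add: continuous_on_eq_continuous_at)
    have "fourier ?F \<xi> = cross_wigner g g (x, \<xi>)" for \<xi>
      by (simp add: fourier_def cross_wigner_eq wigner_integrand_def)
    then have F0: "fourier ?F = (\<lambda>\<xi>. 0)" using neg by auto
    have "?F 0 = (\<integral>\<xi>. fourier ?F \<xi> * chr (0 \<bullet> \<xi>) \<partial>lborel)"
      by (rule fourier_inversion[OF integrable_wigner_integrand[OF g g] cont]) (simp add: F0)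
    then show False using x by (simp add: F0 wigner_integrand_def)
  qed
  then show ?thesis using that by blast
qed

text \<open>A vanishing integral would make the nonempty open set where \<Phi> is nonzero a null
  set.\<close>

lemma integral_cmod_square_pos:
  fixes \<Phi> :: "'a::euclidean_space \<Rightarrow> complex"
  assumes "continuous_on UNIV \<Phi>" "integrable lborel (\<lambda>x. (cmod (\<Phi> x))\<^sup>2)" "\<Phi> p \<noteq> 0"
  shows "(\<integral>x. (cmod (\<Phi> x))\<^sup>2 \<partial>lborel) > 0"
proof (rule ccontr)
  assume "\<not> ?thesis"
  moreover have "(\<integral>x. (cmod (\<Phi> x))\<^sup>2 \<partial>lborel) \<ge> 0" by (intro integral_nonneg_AE) auto
  ultimately have "(\<integral>x. (cmod (\<Phi> x))\<^sup>2 \<partial>lborel) = 0" by simp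
  then have ae: "AE x in lborel. (cmod (\<Phi> x))\<^sup>2 = 0"
    using integral_nonneg_eq_0_iff_AE[OF assms(2)] by simp
  have op: "open {x. \<Phi> x \<noteq> 0}"
    using assms(1) by (intro open_Collect_neq) (auto intro: continuous_on_const)
  then have [measurable]: "{x. \<Phi> x \<noteq> 0} \<in> sets borel" by simp
  have "emeasure lborel {x. \<Phi> x \<noteq> 0} = emeasure lborel ({} :: 'a set)"
    by (rule emeasure_eq_AE) (use ae in auto)
  then have "{x. \<Phi> x \<noteq> 0} \<in> null_sets lborel" by (simp add: null_setsI)
  then have "negligible {x. \<Phi> x \<noteq> 0}"
    unfolding negligible_iff_null_sets by (rule null_sets_completionI)
  with op assms(3) open_not_negligible show False by blast
qed

section \<open>Covariance under time-frequency shifts\<close>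

lemma tf_shift_eq: "tf_shift z f t = chr (snd z \<bullet> t) * f (t - fst z)"
  by (simp add: tf_shift_def chr_eq_exp)

text \<open>Shifting the integration variable by \<open>fst w - fst z\<close> centres both arguments
  at the midpoint of \<open>w\<close> and \<open>z\<close>. The phases left over are a constant and
  a character in \<open>p\<close>, whose frequency is w - z rotated by the symplectic
  matrix.\<close>

lemma cross_wigner_tf_shift:
  fixes f h :: "'a::euclidean_space \<Rightarrow> complex"
  assumes "f \<in> C_infinity" "h \<in> C_infinity"
  shows "cross_wigner (tf_shift w f) (tf_shift z h) p =
    chr ((fst w - fst z) \<bullet> (snd w + snd z) / 2) * chr (p \<bullet> (snd w - snd z, fst z - fst w))
      * cross_wigner f h (p - (w + z) /\<^sub>R 2)"
proof -
  obtain w1 w2 z1 z2 x \<xi> where wz: "w = (w1, w2)" "z = (z1, z2)" "p = (x, \<xi>)" by (meson surj_pair)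
  define K where "K = chr ((w1 - z1) \<bullet> (w2 + z2) / 2) * chr (p \<bullet> (w2 - z2, z1 - w1))"
  let ?q = "p - (w + z) /\<^sub>R 2" and ?c = "w1 - z1"
  have eq: "wigner_integrand (tf_shift w f) (tf_shift z h) p t = K * wigner_integrand f h ?q (t - ?c)" for t
  proof -
    have half: "a /\<^sub>R 2 + a /\<^sub>R 2 = a" for a :: 'a by (simp flip: scaleR_add_left)
    have a1: "fst ?q + (t - ?c) /\<^sub>R 2 = x + t /\<^sub>R 2 - w1"
      using half[of w1] by (simp add: wz scaleR_diff_right scaleR_add_right algebra_simps)
    have a2: "fst ?q - (t - ?c) /\<^sub>R 2 = x - t /\<^sub>R 2 - z1"
      using half[of z1] by (simp add: wz scaleR_diff_right scaleR_add_right algebra_simps)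
    have ph: "w2 \<bullet> (x + t /\<^sub>R 2) + (- (z2 \<bullet> (x - t /\<^sub>R 2)) + - (t \<bullet> \<xi>))
        = (w1 - z1) \<bullet> (w2 + z2) / 2 + (p \<bullet> (w2 - z2, z1 - w1) + - ((t - ?c) \<bullet> snd ?q))"
      by (simp add: wz inner_simps inner_commute field_simps)
    have "wigner_integrand (tf_shift w f) (tf_shift z h) p t = chr (w2 \<bullet> (x + t /\<^sub>R 2) + (- (z2 \<bullet> (x - t /\<^sub>R 2)) + - (t \<bullet> \<xi>)))
        * (f (x + t /\<^sub>R 2 - w1) * cnj (h (x - t /\<^sub>R 2 - z1)))"
      unfolding chr_add by (simp add: wigner_integrand_def tf_shift_eq cnj_chr wz mult_ac)
    also have "\<dots> = K * wigner_integrand f h ?q (t - ?c)"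
      unfolding ph chr_add K_def wigner_integrand_def a1 a2 by (simp add: mult_ac)
    finally show ?thesis .
  qed
  have "cross_wigner (tf_shift w f) (tf_shift z h) p = (\<integral>t. K * wigner_integrand f h ?q (t - ?c) \<partial>lborel)"
    by (simp add: cross_wigner_eq eq)
  also have "\<dots> = K * cross_wigner f h ?q"
    using lborel_translate_integral(1)[OF wigner_integrand_measurable[OF assms], of ?q ?c]
    by (simp add: cross_wigner_eq)
  finally show ?thesis by (simp add: K_def wz)
qed

lemma weyl_op_tf_shift:
  fixes g :: "'a::euclidean_space \<Rightarrow> complex"
  assumes g: "g \<in> C_infinity"
  shows "cmod (weyl_op (pairing \<sigma>) (tf_shift z g) (tf_shift w g)) =
    cmod (fourier (\<lambda>p. \<sigma> p * cnj (cross_wigner g g (p - (w + z) /\<^sub>R 2))) (snd w - snd z, fst z - fst w))"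
proof -
  let ?c = "chr ((fst w - fst z) \<bullet> (snd w + snd z) / 2)" and ?\<zeta> = "(snd w - snd z, fst z - fst w)"
  have "weyl_op (pairing \<sigma>) (tf_shift z g) (tf_shift w g) =
    (\<integral>p. cnj ?c * (\<sigma> p * cnj (cross_wigner g g (p - (w + z) /\<^sub>R 2)) * chr (- (p \<bullet> ?\<zeta>))) \<partial>lborel)"
    unfolding weyl_op_def pairing_def cross_wigner_tf_shift[OF g g]
    by (simp add: cnj_chr mult_ac)
  then show ?thesis by (simp add: fourier_def norm_mult)
qed

section \<open>Exponential decay and growth of weights\<close>

text \<open>With q = y^(1/s) the (1/s)-th power of the hypothesis bounds q^k F^(1/s) by a geometric
  factor times k!. Summing the exponential series at a q, where a = 1 / (2 A^(1/s)) makes the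
  geometric ratio 1/2, gives a total of 2; taking the s-th power yields \<open>2 powr s\<close> and
  the rate s a.\<close>

lemma exp_decay_of_powers:
  fixes F y c A s :: real
  assumes "F \<ge> 0" "y \<ge> 0" "c \<ge> 0" "A > 0" "s > 0"
    and bd: "\<And>k. y ^ k * F \<le> c * A ^ k * fact_pow s k"
  shows "F \<le> 2 powr s * c * exp (- (s / (2 * A powr (1 / s))) * y powr (1 / s))"
proof (cases "F = 0")
  case False
  then have F: "F > 0" using assms by simp
  define q G a where "q = y powr (1 / s)" and "G = F powr (1 / s)" and "a = 1 / (2 * A powr (1 / s))"
  have a: "a > 0" and G: "G > 0" and q: "q \<ge> 0" using assms F by (auto simp: a_def G_def q_def)
  have summand: "(a * q) ^ k /\<^sub>R fact k * G \<le> c powr (1 / s) * (1 / 2) ^ k" for k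
  proof -
    have "q ^ k * G = (y ^ k * F) powr (1 / s)"
    proof (cases "y = 0")
      case True
      then show ?thesis by (cases k) (auto simp: q_def G_def)
    next
      case False
      then show ?thesis using assms
        by (simp add: q_def G_def powr_mult powr_power powr_powr mult.commute flip: powr_realpow)
    qed
    also have "\<dots> \<le> (c * A ^ k * fact_pow s k) powr (1 / s)"
      using assms bd by (intro powr_mono2) auto
    also have "\<dots> = c powr (1 / s) * (A powr (1 / s)) ^ k * fact k"
      using assms by (simp add: powr_mult powr_power powr_powr mult.commute fact_pow_def flip: powr_realpow)
    finally have "(a ^ k / fact k) * (q ^ k * G) \<le> (a ^ k / fact k) * (c powr (1 / s) * (A powr (1 / s)) ^ k * fact k)"
      using a by (intro mult_left_mono) auto
    also have "\<dots> = c powr (1 / s) * (a * A powr (1 / s)) ^ k" by (simp add: power_mult_distrib)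
    also have "a * A powr (1 / s) = 1 / 2" using assms by (simp add: a_def)
    finally have "(a ^ k / fact k) * (q ^ k * G) \<le> c powr (1 / s) * (1 / 2) ^ k" .
    moreover have "(a * q) ^ k /\<^sub>R fact k * G = (a ^ k / fact k) * (q ^ k * G)"
      by (simp add: power_mult_distrib divide_inverse)
    ultimately show ?thesis by simp
  qed
  have "exp (a * q) * G = (\<Sum>k. (a * q) ^ k /\<^sub>R fact k * G)"
    unfolding exp_def by (intro suminf_mult2 summable_exp_generic)
  also have "\<dots> \<le> (\<Sum>k. c powr (1 / s) * (1 / 2) ^ k)"
    by (intro suminf_le summand summable_mult2 summable_exp_generic summable_mult summable_geometric) auto
  also have "\<dots> = c powr (1 / s) * 2"
    by (subst suminf_mult) (auto simp: suminf_geometric)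
  finally have "(exp (a * q) * G) powr s \<le> (c powr (1 / s) * 2) powr s"
    using G assms by (intro powr_mono2) auto
  then have "exp (s * (a * q)) * F \<le> c * 2 powr s"
    unfolding powr_mult G_def powr_powr exp_powr_real using assms F by (simp add: mult_ac)
  then have "F \<le> c * 2 powr s / exp (s * (a * q))"
    by (simp add: field_simps)
  also have "\<dots> = 2 powr s * c * exp (- (s * (a * q)))"
    by (simp add: exp_minus divide_inverse)
  finally show ?thesis by (simp add: a_def q_def)
qed (use assms in simp)

text \<open>The s-th power of x^k exp(-x) \<le> k! at x = (\<epsilon> / s) y^(1/s).\<close>

lemma power_exp_bound:
  fixes y \<epsilon> s :: real
  assumes "y \<ge> 0" "\<epsilon> > 0" "s > 0"
  shows "y ^ k * exp (- \<epsilon> * y powr (1 / s)) \<le> ((s / \<epsilon>) powr s) ^ k * fact_pow s k"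
proof (cases "y = 0")
  case False
  then have y: "y > 0" using assms by simp
  define x where "x = \<epsilon> / s * y powr (1 / s)"
  have x: "x > 0" using assms y by (simp add: x_def)
  have "x ^ k * exp (- x) \<le> fact k"
    using power_div_fact_le_exp[of x k] x by (simp add: exp_minus field_simps)
  then have "(x ^ k * exp (- x)) powr s \<le> fact_pow s k"
    unfolding fact_pow_def using assms x by (intro powr_mono2) auto
  moreover have "(x ^ k * exp (- x)) powr s = ((\<epsilon> / s) powr s) ^ k * (y ^ k * exp (- \<epsilon> * y powr (1 / s)))"
  proof -
    have "(x ^ k) powr s = (x powr s) ^ k"
      using x by (simp add: powr_power powr_powr mult.commute flip: powr_realpow)
    also have "x powr s = (\<epsilon> / s) powr s * y" using assms y by (simp add: x_def powr_mult powr_powr powr_divide)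
    finally show ?thesis
      using assms x by (simp add: powr_mult power_mult_distrib exp_powr_real x_def)
  qed
  ultimately have "((\<epsilon> / s) powr s) ^ k * (y ^ k * exp (- \<epsilon> * y powr (1 / s))) \<le> fact_pow s k" by simp
  then have "((s / \<epsilon>) powr s) ^ k * (((\<epsilon> / s) powr s) ^ k * (y ^ k * exp (- \<epsilon> * y powr (1 / s)))) \<le> ((s / \<epsilon>) powr s) ^ k * fact_pow s k"
    by (intro mult_left_mono) auto
  moreover have "((s / \<epsilon>) powr s) ^ k * ((\<epsilon> / s) powr s) ^ k = 1"
    using assms by (simp flip: power_mult_distrib powr_mult)
  ultimately show ?thesis by (metis (no_types, lifting) mult.assoc mult_1)
next
  case True
  then show ?thesis using assms by (cases k) auto
qed

lemma exp_le_decay: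
  assumes "\<epsilon> > 0" "s > 0"
  obtains K where "K > 0" "\<And>x::'a::euclidean_space. exp (- \<epsilon> * norm x powr (1 / s)) \<le> K * decay x"
proof -
  let ?M = "2 * DIM('a)"
  define K where "K = 2 ^ ?M * (1 + ((s / \<epsilon>) powr s) ^ ?M * fact_pow s ?M)"
  have "exp (- \<epsilon> * norm x powr (1 / s)) \<le> K * decay x" for x :: 'a
  proof -
    let ?e = "exp (- \<epsilon> * norm x powr (1 / s))"
    have "(1 + norm x) ^ ?M * ?e \<le> 2 ^ ?M * (1 + norm x ^ ?M) * ?e"
      by (intro mult_right_mono one_plus_power_le) auto
    also have "\<dots> = 2 ^ ?M * (?e + norm x ^ ?M * ?e)" by (simp add: algebra_simps)
    also have "\<dots> \<le> K"
      unfolding K_def using assms power_exp_bound[of "norm x" \<epsilon> s ?M]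
      by (intro mult_left_mono add_mono) auto
    finally show ?thesis by (simp add: decay_def divide_simps add_pos_nonneg mult_ac)
  qed
  moreover have "K > 0" unfolding K_def by (intro mult_pos_pos add_pos_nonneg) auto
  ultimately show ?thesis using that by blast
qed

text \<open>The powers of the norm yield an exponential whose rate exceeds \<open>\<delta>\<close>;
  what remains after multiplication by \<open>v\<close> is still exponential and dominated by
  \<open>decay\<close>. The constant \<open>K\<close> is chosen before the function, so the bound is
  linear in \<open>c\<close>.\<close>

lemma weighted_decay:
  assumes "s > 0" "A > 0" "c0 > 0" and \<delta>: "\<delta> < s / (2 * A powr (1 / s))"
  obtains K where "K > 0"
    "\<And>(u::'a::euclidean_space) F c v. F \<ge> 0 \<Longrightarrow> c \<ge> 0 \<Longrightarrow> (\<And>k. norm u ^ k * F \<le> c * A ^ k * fact_pow s k) \<Longrightarrow>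
      v \<le> c0 * exp (\<delta> * norm u powr (1 / s)) \<Longrightarrow> v * F \<le> K * c * decay u"
proof -
  define e where "e = s / (2 * A powr (1 / s))"
  obtain K where K: "K > 0" "\<And>x::'a. exp (- (e - \<delta>) * norm x powr (1 / s)) \<le> K * decay x"
    using exp_le_decay[of "e - \<delta>" s] \<delta> assms(1) by (auto simp: e_def)
  show ?thesis
  proof (rule that[of "c0 * 2 powr s * K"])
    show "c0 * 2 powr s * K > 0" using assms K by simp
    fix u :: 'a and F c v :: real
    assume F: "F \<ge> 0" and c: "c \<ge> 0" and bd: "\<And>k. norm u ^ k * F \<le> c * A ^ k * fact_pow s k"
      and v: "v \<le> c0 * exp (\<delta> * norm u powr (1 / s))"
    have "v * F \<le> (c0 * exp (\<delta> * norm u powr (1 / s))) * F" using F v by (intro mult_right_mono)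
    also have "\<dots> \<le> (c0 * exp (\<delta> * norm u powr (1 / s))) * (2 powr s * c * exp (- e * norm u powr (1 / s)))"
      unfolding e_def using assms F c bd by (intro mult_left_mono exp_decay_of_powers) auto
    also have "\<dots> = (c0 * 2 powr s * c) * exp (- (e - \<delta>) * norm u powr (1 / s))"
      by (simp add: algebra_simps flip: exp_add)
    also have "\<dots> \<le> (c0 * 2 powr s * c) * (K * decay u)"
      using assms c by (intro mult_left_mono K) auto
    finally show "v * F \<le> c0 * 2 powr s * K * c * decay u" by (simp add: mult_ac)
  qed
qed

text \<open>A vector z is n times z / n, and z / n lies in the unit ball for n \<ge> |z|;
  submultiplicativity then gives v(z) \<le> M^n with M bounding v on that compact ball.\<close>

lemma submult_weight_exp:
  fixes v :: "'a::euclidean_space \<Rightarrow> real"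
  assumes v: "submult_weight v"
  obtains C a where "C > 0" "a > 0" "\<And>z. v z \<le> C * exp (a * norm z)"
proof -
  have cont: "continuous_on UNIV v" and pos: "\<And>z. v z > 0" and sub: "\<And>x y. v (x + y) \<le> v x * v y" and v0: "v 0 = 1"
    using v by (auto simp: submult_weight_def)
  have "compact (v ` cball 0 1)"
    by (intro compact_continuous_image compact_cball continuous_on_subset[OF cont]) auto
  then obtain M0 where M0: "\<forall>x\<in>v ` cball 0 1. norm x \<le> M0"
    using compact_imp_bounded[of "v ` cball 0 1"] unfolding bounded_iff by blast
  \<comment> \<open>At least 2, so that the rate ln M is positive.\<close>
  define M where "M = max M0 2"
  have M: "M > 1" "\<And>y. norm y \<le> 1 \<Longrightarrow> v y \<le> M"
    using M0 by (auto simp: M_def le_max_iff_disj abs_le_iff)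
  have pw: "v (real n *\<^sub>R y) \<le> M ^ n" if "norm y \<le> 1" for n y
  proof (induction n)
    case (Suc n)
    have "v (real (Suc n) *\<^sub>R y) = v (y + real n *\<^sub>R y)" by (simp add: algebra_simps)
    also have "\<dots> \<le> v y * v (real n *\<^sub>R y)" by (rule sub)
    also have "\<dots> \<le> M * M ^ n" using Suc M that pos[of "real n *\<^sub>R y"] by (intro mult_mono) (auto simp: less_imp_le)
    finally show ?case by simp
  qed (simp add: v0)
  have "v z \<le> M ^ 2 * exp (ln M * norm z)" for z
  proof -
    \<comment> \<open>The extra 1 keeps n positive at z = 0; it and the rounding account for the
      factor \<open>M ^ 2\<close>.\<close>
    define n where "n = nat \<lceil>norm z\<rceil> + 1"
    have n: "real n \<ge> norm z" "real n \<le> norm z + 2" "real n > 0"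
    proof -
      have "0 \<le> real_of_int \<lceil>norm z\<rceil>" by (rule order_trans[OF norm_ge_zero le_of_int_ceiling])
      then show "real n \<ge> norm z" "real n \<le> norm z + 2" "real n > 0"
        using ceiling_correct[of "norm z"] unfolding n_def by linarith+
    qed
    have "v z = v (real n *\<^sub>R (z /\<^sub>R real n))" using n by simp
    also have "\<dots> \<le> M ^ n" using n by (intro pw) (simp add: divide_simps)
    also have "\<dots> = exp (ln M * real n)" using M by (simp add: exp_of_nat2_mult)
    also have "\<dots> \<le> exp (ln M * (norm z + 2))" using M n by (simp add: mult_left_mono)
    also have "\<dots> = M ^ 2 * exp (ln M * norm z)"
      using M by (simp add: ring_distribs exp_add exp_of_nat2_mult[of _ 2, simplified])
    finally show ?thesis .
  qed
  then show ?thesis using M by (intro that[of "M ^ 2" "ln M"]) auto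
qed

lemma linear_le_powr:
  fixes a \<epsilon> s :: real
  assumes "a > 0" "\<epsilon> > 0" "0 < s" "s < 1"
  obtains C where "\<And>y. y \<ge> 0 \<Longrightarrow> a * y \<le> C + \<epsilon> * y powr (1 / s)"
proof -
  \<comment> \<open>The point where \<epsilon> y^(1/s) overtakes a y: below it the linear term is at
    most a R, above it the power dominates because 1/s > 1.\<close>
  define R where "R = (a / \<epsilon>) powr (1 / (1 / s - 1))"
  have s: "1 / s - 1 > 0" using assms by (simp add: field_simps)
  have R: "R > 0" "R powr (1 / s - 1) = a / \<epsilon>" using assms s by (simp_all add: R_def powr_powr)
  have "a * y \<le> a * R + \<epsilon> * y powr (1 / s)" if "y \<ge> 0" for y
  proof (cases "y \<le> R")
    case True
    then show ?thesis using assms by (intro add_increasing2) auto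
  next
    case False
    then have y: "y > R" by simp
    have "a = \<epsilon> * R powr (1 / s - 1)" using R assms by simp
    also have "\<dots> \<le> \<epsilon> * y powr (1 / s - 1)" using assms s R y by (intro mult_left_mono powr_mono2) auto
    finally have "a * y \<le> \<epsilon> * y powr (1 / s - 1) * y" using that by (intro mult_right_mono)
    also have "\<dots> = \<epsilon> * y powr (1 / s)" using R y by (simp add: powr_diff)
    finally show ?thesis using R assms by (simp add: add_increasing)
  qed
  then show ?thesis using that by blast
qed

text \<open>The growth condition of the theorem as a predicate;
  \<open>submult_weight_subexp_growth\<close> obtains it for s < 1 from submultiplicativity.\<close>

definition subexp_growth :: "real \<Rightarrow> ('a::real_normed_vector \<Rightarrow> real) \<Rightarrow> bool" where
  "subexp_growth s v \<longleftrightarrow> (\<forall>\<epsilon>>0. \<exists>c>0. \<forall>z. v z \<le> c * exp (\<epsilon> * norm z powr (1 / s)))"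

lemma submult_weight_subexp_growth:
  fixes v :: "'a::euclidean_space \<Rightarrow> real"
  assumes v: "submult_weight v" and s: "0 < s" "s < 1"
  shows "subexp_growth s v"
  unfolding subexp_growth_def
proof (intro allI impI)
  fix \<epsilon> :: real assume \<epsilon>: "\<epsilon> > 0"
  obtain C a where C: "C > 0" "a > 0" "\<And>z. v z \<le> C * exp (a * norm z)"
    using submult_weight_exp[OF v] by blast
  obtain D where D: "\<And>y. y \<ge> 0 \<Longrightarrow> a * y \<le> D + \<epsilon> * y powr (1 / s)"
    using linear_le_powr[OF C(2) \<epsilon> s] by blast
  have "v z \<le> (C * exp D) * exp (\<epsilon> * norm z powr (1 / s))" for z
  proof -
    have "v z \<le> C * exp (D + \<epsilon> * norm z powr (1 / s))"
      using C D[of "norm z"] by (intro order_trans[OF C(3)] mult_left_mono) auto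
    then show ?thesis by (simp add: exp_add mult.assoc)
  qed
  then show "\<exists>c>0. \<forall>z. v z \<le> c * exp (\<epsilon> * norm z powr (1 / s))"
    using C by (intro exI[of _ "C * exp D"]) auto
qed

text \<open>The interface between windows and symbol estimates: derivatives of the window absorb
  \<open>v\<close>, grow at the same factorial order as those of the symbol, and leave an integrable
  majorant. All hypotheses on \<open>g\<close> and \<open>v\<close> are brought to this
  form.\<close>

definition admissible_window :: "real \<Rightarrow> ('a::euclidean_space \<Rightarrow> real) \<Rightarrow> ('a \<Rightarrow> complex) \<Rightarrow> bool" where
  "admissible_window s v \<Phi> \<longleftrightarrow> rapid \<Phi> \<and>
     (\<exists>K>0. \<exists>C>0. \<forall>L\<in>lists Basis. \<forall>u. v u * cmod (list_deriv L \<Phi> u) \<le> K * C ^ length L * fact_pow s (length L) * decay u)"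

text \<open>The bound on \<open>\<delta>\<close> is the exponential rate of the derivatives of the
  window, where \<open>2 powr s\<close> comes from splitting factorials and the dimension from
  coordinates versus norm. Two exponents are kept apart because a window in
  \<open>Sigma11_space\<close> decays with exponent 1 while the symbol class has s \<ge> 1.\<close>

lemma word_bounded_admissible:
  fixes \<Phi> :: "'a::euclidean_space \<Rightarrow> complex"
  assumes wb: "word_bounded (\<lambda>n. c * A ^ n * fact_pow s n) \<Phi>" and "c > 0" "A > 0" "s > 0" "s \<le> s'"
    and v: "\<And>z. v z \<le> c0 * exp (\<delta> * norm z powr (1 / s))" "c0 > 0"
    and \<delta>: "\<delta> < s / (2 * (real DIM('a) * (2 powr s * A)) powr (1 / s))"
  shows "admissible_window s' v \<Phi>"
proof -
  define E where "E = 2 powr s * A"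
  have E: "E > 0" using assms by (simp add: E_def)
  obtain K where K: "K > 0" "\<And>(u::'a) F c v. F \<ge> 0 \<Longrightarrow> c \<ge> 0 \<Longrightarrow> (\<And>k. norm u ^ k * F \<le> c * (real DIM('a) * E) ^ k * fact_pow s k) \<Longrightarrow>
      v \<le> c0 * exp (\<delta> * norm u powr (1 / s)) \<Longrightarrow> v * F \<le> K * c * decay u"
    using weighted_decay[of s "real DIM('a) * E" c0 \<delta>, where 'a='a] assms E by (auto simp: E_def)
  have "v u * cmod (list_deriv L \<Phi> u) \<le> (K * c) * E ^ length L * fact_pow s' (length L) * decay u"
    if L: "L \<in> lists Basis" for L u
  proof -
    let ?n = "length L" and ?w = "map (Pair False) L"
    have w: "?w \<in> words" using L by (auto simp: in_lists_conv_set)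
    have "v u * cmod (list_deriv L \<Phi> u) \<le> K * (c * E ^ ?n * fact_pow s ?n) * decay u"
    proof (rule K(2)[OF _ _ _ v(1)])
      fix k
      have "norm u ^ k * cmod (word_op ?w \<Phi> u) \<le> real DIM('a) ^ k * (c * A ^ (k + ?n) * fact_pow s (k + ?n))"
        using word_bounded_norm_power[OF wb w, of u k] by simp
      also have "\<dots> \<le> real DIM('a) ^ k * (c * A ^ (k + ?n) * ((2 powr s) ^ (k + ?n) * (fact_pow s k * fact_pow s ?n)))"
        using assms by (intro mult_left_mono fact_pow_add_le) auto
      also have "\<dots> = (c * E ^ ?n * fact_pow s ?n) * (real DIM('a) * E) ^ k * fact_pow s k"
        by (simp add: E_def power_add power_mult_distrib mult_ac)
      finally show "norm u ^ k * cmod (list_deriv L \<Phi> u) \<le> (c * E ^ ?n * fact_pow s ?n) * (real DIM('a) * E) ^ k * fact_pow s k"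
        by (simp add: word_op_deriv)
    qed (use assms E in auto)
    also have "\<dots> \<le> K * (c * E ^ ?n * fact_pow s' ?n) * decay u"
    proof -
      have "fact_pow s ?n \<le> fact_pow s' ?n"
        unfolding fact_pow_def using assms by (intro powr_mono fact_ge_1)
      then show ?thesis using K assms E by (intro mult_right_mono mult_left_mono) auto
    qed
    finally show ?thesis by (simp add: mult_ac)
  qed
  then show ?thesis
    unfolding admissible_window_def using wb K assms E
    by (intro conjI exI[of _ "K * c"] exI[of _ E]) (auto simp: rapid_def)
qed

lemma admissible_cross_wigner_GS:
  fixes g :: "'a::euclidean_space \<Rightarrow> complex"
  assumes g: "g \<in> GS_space s s" and s: "s \<ge> 1 / 2" and v: "subexp_growth s v"
  shows "admissible_window s v (cross_wigner g g)" "(\<lambda>x. cross_wigner g g (x - z)) \<in> GS_space s s"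
proof -
  obtain C A where *: "C > 0" "A > 0" "word_bounded (\<lambda>n. C * A ^ n * fact_pow s n) (cross_wigner g g)"
    using cross_wigner_GS_space[OF g s] by blast
  \<comment> \<open>Half of the rate that \<open>word_bounded_admissible\<close> allows; positive,
    hence covered by the growth condition.\<close>
  define \<delta> where "\<delta> = s / (2 * (real DIM('a \<times> 'a) * (2 powr s * A)) powr (1 / s)) / 2"
  have \<delta>: "\<delta> > 0" using * s unfolding \<delta>_def by (intro divide_pos_pos mult_pos_pos) auto
  obtain c0 where c0: "c0 > 0" "\<And>z. v z \<le> c0 * exp (\<delta> * norm z powr (1 / s))"
    using v \<delta> unfolding subexp_growth_def by blast
  show "admissible_window s v (cross_wigner g g)"
    by (rule word_bounded_admissible[OF *(3,1,2) _ _ c0(2,1)]) (use s \<delta> in \<open>auto simp: \<delta>_def\<close>)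
  have "cross_wigner g g \<in> GS_space s s" by (rule word_bounded_GS_space[OF *(3)]) (use * s in auto)
  then show "(\<lambda>x. cross_wigner g g (x - z)) \<in> GS_space s s" by (rule GS_space_translate[OF _ s])
qed

lemma admissible_cross_wigner_Sigma11:
  fixes g :: "'a::euclidean_space \<Rightarrow> complex"
  assumes g: "g \<in> Sigma11_space" and s: "s \<ge> 1" and v: "submult_weight v"
  shows "admissible_window s v (cross_wigner g g)" "(\<lambda>x. cross_wigner g g (x - z)) \<in> Sigma11_space"
proof -
  obtain c0 a where c0: "c0 > 0" "a > 0" "\<And>z. v z \<le> c0 * exp (a * norm z)"
    using submult_weight_exp[OF v] by blast
  \<comment> \<open>This rate makes the admissible threshold equal to 2 a, twice the exponential
    rate of the weight.\<close>
  define A where "A = 1 / (2 * (real DIM('a \<times> 'a) * 2) * (2 * a))"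
  have A: "A > 0" unfolding A_def using c0 by (intro divide_pos_pos mult_pos_pos) auto
  obtain C where C: "C > 0" "word_bounded (\<lambda>n. C * A ^ n * fact n) (cross_wigner g g)"
    by (rule cross_wigner_Sigma11_space[OF g A])
  show "admissible_window s v (cross_wigner g g)"
  proof (rule word_bounded_admissible[where s = 1 and c = C and A = A and \<delta> = a and ?c0.0 = c0])
    show "a < 1 / (2 * (real DIM('a \<times> 'a) * (2 powr 1 * A)) powr (1 / 1))"
      using A c0 unfolding A_def by (simp add: field_simps del: DIM_prod)
  qed (use C A c0 s in auto)
  have "cross_wigner g g \<in> Sigma11_space"
    by (rule word_bounded_Sigma11_space) (use cross_wigner_Sigma11_space[OF g] in blast)
  then show "(\<lambda>x. cross_wigner g g (x - z)) \<in> Sigma11_space" by (rule Sigma11_space_translate)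
qed

section \<open>Functions as elements of the dual spaces\<close>

lemma integrable_pairing:
  fixes \<sigma> \<phi> :: "'a::euclidean_space \<Rightarrow> complex"
  assumes "\<sigma> \<in> C_infinity" "\<phi> \<in> C_infinity" "\<And>z. cmod (\<sigma> z) \<le> c * v z" "\<And>z. v z * cmod (\<phi> z) \<le> K * decay z" "c \<ge> 0"
  shows "integrable lborel (\<lambda>z. \<sigma> z * cnj (\<phi> z))"
    and "cmod (pairing \<sigma> \<phi>) \<le> c * K * (\<integral>z. decay (z::'a) \<partial>lborel)"
proof -
  have [measurable]: "\<sigma> \<in> borel_measurable borel" "\<phi> \<in> borel_measurable borel"
    using assms by (auto intro: C_infinity_measurable)
  have bd: "cmod (\<sigma> z * cnj (\<phi> z)) \<le> (c * K) * decay z" for z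
  proof -
    have "cmod (\<sigma> z * cnj (\<phi> z)) \<le> (c * v z) * cmod (\<phi> z)"
      unfolding norm_mult complex_mod_cnj using assms by (intro mult_right_mono) auto
    also have "\<dots> \<le> c * (K * decay z)" using assms by (simp add: mult.assoc mult_left_mono)
    finally show ?thesis by simp
  qed
  show int: "integrable lborel (\<lambda>z. \<sigma> z * cnj (\<phi> z))"
  proof (rule Bochner_Integration.integrable_bound[of lborel "\<lambda>z. (c * K) * decay z"])
    show "AE z in lborel. norm (\<sigma> z * cnj (\<phi> z)) \<le> norm ((c * K) * decay z)"
      by (intro AE_I2) (auto intro: order_trans[OF bd abs_ge_self])
  qed (auto intro!: integrable_mult_right integrable_decay)
  have "cmod (pairing \<sigma> \<phi>) \<le> (\<integral>z. cmod (\<sigma> z * cnj (\<phi> z)) \<partial>lborel)"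
    unfolding pairing_def by (rule integral_norm_bound)
  also have "\<dots> \<le> (\<integral>z. (c * K) * decay (z::'a) \<partial>lborel)"
    by (intro integral_mono integrable_norm int integrable_mult_right integrable_decay bd)
  finally show "cmod (pairing \<sigma> \<phi>) \<le> c * K * (\<integral>z. decay (z::'a) \<partial>lborel)" by simp
qed

lemma pairing_lincomb:
  assumes "integrable lborel (\<lambda>z. \<sigma> z * cnj (f z))" "integrable lborel (\<lambda>z. \<sigma> z * cnj (h z))"
  shows "pairing \<sigma> (\<lambda>x. a * f x + b * h x) = cnj a * pairing \<sigma> f + cnj b * pairing \<sigma> h"
proof -
  have "(\<lambda>z. \<sigma> z * cnj (a * f z + b * h z)) = (\<lambda>z. cnj a * (\<sigma> z * cnj (f z)) + cnj b * (\<sigma> z * cnj (h z)))"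
    by (auto simp: algebra_simps)
  then show ?thesis using assms by (simp add: pairing_def)
qed

text \<open>On each step of the inductive limit the pairing is bounded by a constant, depending on
  the step, times the radius: the growth condition is applied with a \<open>\<delta>\<close> below
  the decay rate that \<open>A\<close> guarantees. The preimage of a small disc is absolutely convex
  and contains a ball of every step, as the topology demands.\<close>

lemma in_dual_GS:
  fixes \<sigma> :: "'a::euclidean_space \<Rightarrow> complex"
  assumes s: "s > 0" and v: "subexp_growth s v" and \<sigma>: "\<sigma> \<in> C_infinity" "\<And>z. cmod (\<sigma> z) \<le> c * v z" "c > 0"
  shows "in_dual (GS_topology s s) \<sigma>"
proof -
  have wd: "\<exists>K>0. \<forall>C\<ge>0. \<forall>\<phi>\<in>gs_ball s s A B C. \<forall>z. v z * cmod (\<phi> z) \<le> K * C * decay z" if AB: "A > 0" "B > 0" for A B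
  proof -
    define \<delta> where "\<delta> = s / (2 * (real DIM('a) * A) powr (1 / s)) / 2"
    have \<delta>: "\<delta> > 0" using AB s unfolding \<delta>_def by (intro divide_pos_pos mult_pos_pos) auto
    obtain c0 where c0: "c0 > 0" "\<And>z. v z \<le> c0 * exp (\<delta> * norm z powr (1 / s))"
      using v \<delta> unfolding subexp_growth_def by blast
    obtain K where K: "K > 0" "\<And>(u::'a) F c v. F \<ge> 0 \<Longrightarrow> c \<ge> 0 \<Longrightarrow> (\<And>k. norm u ^ k * F \<le> c * (real DIM('a) * A) ^ k * fact_pow s k) \<Longrightarrow>
        v \<le> c0 * exp (\<delta> * norm u powr (1 / s)) \<Longrightarrow> v * F \<le> K * c * decay u"
    proof (rule weighted_decay[of s "real DIM('a) * A" c0 \<delta>, where 'a='a])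
      show "\<delta> < s / (2 * (real DIM('a) * A) powr (1 / s))" using \<delta> by (simp add: \<delta>_def)
    qed (use s AB c0 that in auto)
    have "v z * cmod (\<phi> z) \<le> K * C * decay z" if "C \<ge> 0" "\<phi> \<in> gs_ball s s A B C" for C \<phi> z
      by (rule K(2)[OF _ _ gs_ball_norm_power[where B = B] c0(2)]) (use that AB s in auto)
    with K(1) show ?thesis by blast
  qed
  let ?I = "\<integral>z. decay (z::'a) \<partial>lborel"
  have I: "?I \<ge> 0" by (intro integral_nonneg_AE) auto
  have smooth: "\<phi> \<in> C_infinity" if "\<phi> \<in> gs_ball s s A B C" for \<phi> :: "'a \<Rightarrow> complex" and A B C
    using that by (simp add: gs_ball_def schwartz_space_def)
  have bound: "\<exists>K>0. \<forall>C\<ge>0. \<forall>\<phi>\<in>gs_ball s s A B C. integrable lborel (\<lambda>z. \<sigma> z * cnj (\<phi> z)) \<and> cmod (pairing \<sigma> \<phi>) \<le> K * C"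
    if AB: "A > 0" "B > 0" for A B
  proof -
    obtain K where K: "K > 0" "\<forall>C\<ge>0. \<forall>\<phi>\<in>gs_ball s s A B C. \<forall>z. v z * cmod (\<phi> z) \<le> K * C * decay z"
      using wd[OF AB] by blast
    have "integrable lborel (\<lambda>z. \<sigma> z * cnj (\<phi> z)) \<and> cmod (pairing \<sigma> \<phi>) \<le> (c * K * (?I + 1)) * C"
      if "C \<ge> 0" "\<phi> \<in> gs_ball s s A B C" for C \<phi>
    proof
      have bd: "v z * cmod (\<phi> z) \<le> (K * C) * decay z" for z using K that by blast
      show "integrable lborel (\<lambda>z. \<sigma> z * cnj (\<phi> z))"
        using \<sigma> smooth[OF that(2)] bd by (intro integrable_pairing(1)[of \<sigma> \<phi> c v "K * C"]) auto
      have "cmod (pairing \<sigma> \<phi>) \<le> c * (K * C) * ?I"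
        using \<sigma> smooth[OF that(2)] bd by (intro integrable_pairing(2)[of \<sigma> \<phi> c v "K * C"]) auto
      also have "\<dots> \<le> c * (K * C) * (?I + 1)" using \<sigma> K that by (intro mult_left_mono) auto
      finally show "cmod (pairing \<sigma> \<phi>) \<le> (c * K * (?I + 1)) * C" by (simp add: mult_ac)
    qed
    moreover have "c * K * (?I + 1) > 0" using \<sigma> K by (intro mult_pos_pos add_nonneg_pos I) auto
    ultimately show ?thesis by blast
  qed
  have int: "integrable lborel (\<lambda>z. \<sigma> z * cnj (\<phi> z))" if \<phi>: "\<phi> \<in> GS_space s s" for \<phi>
  proof -
    obtain A B C where "A > 0" "B > 0" "C > 0" "\<phi> \<in> gs_ball s s A B C" using \<phi> unfolding GS_space_def by blast
    with bound[of A B] show ?thesis by (meson less_imp_le)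
  qed
  have lin: "pairing \<sigma> (\<lambda>x. a * f x + b * h x) = cnj a * pairing \<sigma> f + cnj b * pairing \<sigma> h"
    if "f \<in> GS_space s s" "h \<in> GS_space s s" for f h a b
    using that by (intro pairing_lincomb int)
  have "continuous_map (GS_topology s s) euclidean (pairing \<sigma>)"
    unfolding continuous_map_def topspace_GS_topology
  proof (intro conjI allI impI)
    fix U :: "complex set" assume "openin euclidean U"
    then have U: "open U" by simp
    show "openin (GS_topology s s) {f \<in> GS_space s s. pairing \<sigma> f \<in> U}"
      unfolding openin_GS_topology
    proof (intro conjI ballI)
      fix f assume f: "f \<in> {f \<in> GS_space s s. pairing \<sigma> f \<in> U}"
      then obtain e where e: "e > 0" "ball (pairing \<sigma> f) e \<subseteq> U" using U open_contains_ball by blast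
      let ?V = "{h \<in> GS_space s s. cmod (pairing \<sigma> h) \<le> e / 2}"
      have "abs_convex ?V"
        unfolding abs_convex_def
      proof (intro ballI allI impI)
        fix k h a b assume kh: "k \<in> ?V" "h \<in> ?V" and ab: "cmod a + cmod b \<le> 1"
        then have "cmod (pairing \<sigma> (\<lambda>x. a * k x + b * h x)) \<le> cmod a * cmod (pairing \<sigma> k) + cmod b * cmod (pairing \<sigma> h)"
          by (simp add: lin) (rule order_trans[OF norm_triangle_ineq], simp add: norm_mult)
        also have "\<dots> \<le> cmod a * (e / 2) + cmod b * (e / 2)" using kh by (intro add_mono mult_left_mono) auto
        also have "\<dots> \<le> 1 * (e / 2)" unfolding distrib_right[symmetric] using ab e by (intro mult_right_mono) auto
        finally show "(\<lambda>x. a * k x + b * h x) \<in> ?V" using kh GS_space_lincomb[of k s s h a b] by simp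
      qed
      moreover have "\<exists>d>0. gs_ball s s A B d \<subseteq> ?V" if AB: "A > 0" "B > 0" for A B
      proof -
        obtain K where K: "K > 0" "\<forall>C\<ge>0. \<forall>\<phi>\<in>gs_ball s s A B C. integrable lborel (\<lambda>z. \<sigma> z * cnj (\<phi> z)) \<and> cmod (pairing \<sigma> \<phi>) \<le> K * C"
          using bound[OF AB] by blast
        define d where "d = e / (2 * K)"
        have d: "d > 0" "K * d = e / 2" using K e by (auto simp: d_def)
        have "gs_ball s s A B d \<subseteq> ?V"
        proof
          fix \<phi> :: "'a \<Rightarrow> complex" assume \<phi>: "\<phi> \<in> gs_ball s s A B d"
          then have "cmod (pairing \<sigma> \<phi>) \<le> K * d" using K d by (simp add: less_imp_le)
          moreover have "\<phi> \<in> GS_space s s" unfolding GS_space_def using \<phi> AB d by blast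
          ultimately show "\<phi> \<in> ?V" using d by simp
        qed
        with d show ?thesis by blast
      qed
      moreover have "(\<lambda>x. f x + h x) \<in> {f \<in> GS_space s s. pairing \<sigma> f \<in> U}" if h: "h \<in> ?V" for h
      proof -
        have "pairing \<sigma> (\<lambda>x. 1 * f x + 1 * h x) = cnj 1 * pairing \<sigma> f + cnj 1 * pairing \<sigma> h"
          using f h by (intro lin) auto
        then have "pairing \<sigma> (\<lambda>x. f x + h x) \<in> ball (pairing \<sigma> f) e" using h e by (simp add: dist_norm)
        moreover have "(\<lambda>x. f x + h x) \<in> GS_space s s" using GS_space_lincomb[of f s s h 1 1] f h by simp
        ultimately show ?thesis using e by blast
      qed
      ultimately show "\<exists>V\<subseteq>GS_space s s. abs_convex V \<and> (\<forall>A>0. \<forall>B>0. \<exists>c>0. gs_ball s s A B c \<subseteq> V) \<and>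
          (\<forall>h\<in>V. (\<lambda>x. f x + h x) \<in> {f \<in> GS_space s s. pairing \<sigma> f \<in> U})"
        by (intro exI[of _ ?V]) auto
    qed auto
  qed auto
  then show ?thesis
    unfolding in_dual_def dual_space_def topspace_GS_topology using int lin by blast
qed

text \<open>For the projective limit a single pair of rates suffices, provided \<open>A\<close> is
  small enough for the exponential decay to beat the weight.\<close>

lemma in_dual_Sigma11:
  fixes \<sigma> :: "'a::euclidean_space \<Rightarrow> complex"
  assumes v: "submult_weight v" and \<sigma>: "\<sigma> \<in> C_infinity" "\<And>z. cmod (\<sigma> z) \<le> c * v z" "c > 0"
  shows "in_dual Sigma11_topology \<sigma>"
proof -
  obtain c0 a where c0: "c0 > 0" "a > 0" "\<And>z. v z \<le> c0 * exp (a * norm z)"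
    using submult_weight_exp[OF v] by blast
  \<comment> \<open>With this value functions in the ball decay at rate 2 a, against growth of the
    weight at rate a.\<close>
  define A where "A = 1 / (2 * real DIM('a) * (2 * a))"
  have A: "A > 0" unfolding A_def using c0 by (intro divide_pos_pos mult_pos_pos) auto
  obtain K where K: "K > 0" "\<And>(u::'a) F c v. F \<ge> 0 \<Longrightarrow> c \<ge> 0 \<Longrightarrow> (\<And>k. norm u ^ k * F \<le> c * (real DIM('a) * A) ^ k * fact_pow 1 k) \<Longrightarrow>
      v \<le> c0 * exp (a * norm u powr (1 / 1)) \<Longrightarrow> v * F \<le> K * c * decay u"
    using weighted_decay[of 1 "real DIM('a) * A" c0 a, where 'a='a] A c0 by (auto simp: A_def field_simps)
  let ?I = "\<integral>z. decay (z::'a) \<partial>lborel"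
  have I: "?I \<ge> 0" by (intro integral_nonneg_AE) auto
  define D where "D = c * K * (?I + 1)"
  have D: "D > 0" unfolding D_def using \<sigma> K by (intro mult_pos_pos add_nonneg_pos I) auto
  have bound: "integrable lborel (\<lambda>z. \<sigma> z * cnj (\<phi> z)) \<and> cmod (pairing \<sigma> \<phi>) \<le> D * C"
    if "C \<ge> 0" "\<phi> \<in> gs_ball 1 1 A A C" for C \<phi>
  proof
    have bd: "v z * cmod (\<phi> z) \<le> (K * C) * decay z" for z
      by (rule K(2)[OF _ _ gs_ball_norm_power]) (use that A c0 in auto)
    have \<phi>: "\<phi> \<in> C_infinity" using that by (simp add: gs_ball_def schwartz_space_def)
    show "integrable lborel (\<lambda>z. \<sigma> z * cnj (\<phi> z))"
      using \<sigma> \<phi> bd by (intro integrable_pairing(1)[of \<sigma> \<phi> c v "K * C"]) auto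
    have "cmod (pairing \<sigma> \<phi>) \<le> c * (K * C) * ?I"
      using \<sigma> \<phi> bd by (intro integrable_pairing(2)[of \<sigma> \<phi> c v "K * C"]) auto
    also have "\<dots> \<le> c * (K * C) * (?I + 1)" using \<sigma> K that by (intro mult_left_mono) auto
    finally show "cmod (pairing \<sigma> \<phi>) \<le> D * C" by (simp add: D_def mult_ac)
  qed
  have int: "integrable lborel (\<lambda>z. \<sigma> z * cnj (\<phi> z))" if \<phi>: "\<phi> \<in> Sigma11_space" for \<phi>
  proof -
    obtain C where "C > 0" "\<phi> \<in> gs_ball 1 1 A A C" using \<phi> A unfolding Sigma11_space_def by blast
    with bound show ?thesis by (meson less_imp_le)
  qed
  have lin: "pairing \<sigma> (\<lambda>x. a * f x + b * h x) = cnj a * pairing \<sigma> f + cnj b * pairing \<sigma> h"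
    if "f \<in> Sigma11_space" "h \<in> Sigma11_space" for f h a b
    using that by (intro pairing_lincomb int)
  have "continuous_map Sigma11_topology euclidean (pairing \<sigma>)"
    unfolding continuous_map_def topspace_Sigma11_topology
  proof (intro conjI allI impI)
    fix U :: "complex set" assume "openin euclidean U"
    then have U: "open U" by simp
    show "openin Sigma11_topology {f \<in> Sigma11_space. pairing \<sigma> f \<in> U}"
      unfolding openin_Sigma11_topology
    proof (intro conjI ballI)
      fix f assume f: "f \<in> {f \<in> Sigma11_space. pairing \<sigma> f \<in> U}"
      then obtain e where e: "e > 0" "ball (pairing \<sigma> f) e \<subseteq> U" using U open_contains_ball by blast
      define d where "d = e / (2 * D)"
      have d: "d > 0" "D * d = e / 2" using D e by (auto simp: d_def)
      have "(\<lambda>x. f x + h x) \<in> {f \<in> Sigma11_space. pairing \<sigma> f \<in> U}" if h: "h \<in> Sigma11_space \<inter> gs_ball 1 1 A A d" for h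
      proof -
        have "cmod (pairing \<sigma> h) \<le> e / 2" using bound[of d h] h d by simp
        moreover have "pairing \<sigma> (\<lambda>x. 1 * f x + 1 * h x) = cnj 1 * pairing \<sigma> f + cnj 1 * pairing \<sigma> h"
          using f h by (intro lin) auto
        ultimately have "pairing \<sigma> (\<lambda>x. f x + h x) \<in> ball (pairing \<sigma> f) e" using e by (simp add: dist_norm)
        moreover have "(\<lambda>x. f x + h x) \<in> Sigma11_space" using Sigma11_space_lincomb[of f h 1 1] f h by simp
        ultimately show ?thesis using e by blast
      qed
      with A d show "\<exists>A>0. \<exists>B>0. \<exists>c>0. \<forall>h\<in>Sigma11_space \<inter> gs_ball 1 1 A B c. (\<lambda>x. f x + h x) \<in> {f \<in> Sigma11_space. pairing \<sigma> f \<in> U}"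
        by blast
    qed auto
  qed auto
  then show ?thesis
    unfolding in_dual_def dual_space_def topspace_Sigma11_topology using int lin by blast
qed

section \<open>Symbol estimates and Fourier transforms of localised symbols\<close>

lemma list_deriv_lincomb:
  assumes "f \<in> C_infinity" "h \<in> C_infinity" "L \<in> lists Basis"
  shows "list_deriv L (\<lambda>x. a * f x + a' * h x) = (\<lambda>x. a * list_deriv L f x + a' * list_deriv L h x)"
proof -
  have "map (Pair False) L \<in> words" using assms(3) by (auto simp: in_lists_conv_set)
  from word_op_lincomb[OF assms(1,2) this, of a a'] show ?thesis by (simp add: word_op_deriv)
qed

lemma list_deriv_add:
  assumes "f \<in> C_infinity" "h \<in> C_infinity" "L \<in> lists Basis"
  shows "list_deriv L (\<lambda>x. f x + h x) = (\<lambda>x. list_deriv L f x + list_deriv L h x)"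
  using list_deriv_lincomb[OF assms, of 1 1] by simp

lemma list_deriv_snoc_mult:
  assumes "f \<in> C_infinity" "h \<in> C_infinity" "L \<in> lists Basis" "b \<in> Basis"
  shows "list_deriv (L @ [b]) (\<lambda>x. f x * h x) t =
    list_deriv L (\<lambda>x. partial_deriv b f x * h x) t + list_deriv L (\<lambda>x. f x * partial_deriv b h x) t"
proof -
  have "partial_deriv b (\<lambda>x. f x * h x) = (\<lambda>x. partial_deriv b f x * h x + f x * partial_deriv b h x)"
    using assms by (intro partial_deriv_mult C_infinity_differentiable)
  then show ?thesis
    using assms by (simp add: list_deriv_add C_infinity_mult C_infinity_partial_deriv)
qed

text \<open>A Leibniz rule without binomial coefficients: each derivative doubles the number of
  terms, and all terms have the same bound because \<open>H\<close> sees only the total order.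
  \<open>P\<close> and \<open>Q\<close> are the derivatives already distributed in the
  induction.\<close>

lemma list_deriv_mult_bound:
  assumes f: "f \<in> C_infinity" and h: "h \<in> C_infinity"
    and H: "\<And>P Q. P \<in> lists Basis \<Longrightarrow> Q \<in> lists Basis \<Longrightarrow>
      cmod (list_deriv P f t) * cmod (list_deriv Q h t) \<le> H (length P + length Q)"
    and L: "L \<in> lists Basis"
  shows "cmod (list_deriv L (\<lambda>x. f x * h x) t) \<le> 2 ^ length L * H (length L)"
proof -
  have "cmod (list_deriv L (\<lambda>x. list_deriv P f x * list_deriv Q h x) t) \<le> 2 ^ length L * H (length L + length P + length Q)"
    if "L \<in> lists Basis" "P \<in> lists Basis" "Q \<in> lists Basis" for L P Q
    using that
  proof (induction L arbitrary: P Q rule: rev_induct)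
    case Nil
    then show ?case using H by (simp add: norm_mult)
  next
    case (snoc b L)
    then have b: "b \<in> Basis" "L \<in> lists Basis" "b # P \<in> lists Basis" "b # Q \<in> lists Basis" by auto
    have "list_deriv (L @ [b]) (\<lambda>x. list_deriv P f x * list_deriv Q h x) t =
      list_deriv L (\<lambda>x. list_deriv (b # P) f x * list_deriv Q h x) t + list_deriv L (\<lambda>x. list_deriv P f x * list_deriv (b # Q) h x) t"
      using list_deriv_snoc_mult[of "list_deriv P f" "list_deriv Q h" L b t] snoc.prems b f h
      by (simp add: C_infinity_list_deriv)
    also have "cmod \<dots> \<le> 2 ^ length L * H (length L + length (b # P) + length Q) + 2 ^ length L * H (length L + length P + length (b # Q))"
      using snoc.prems b by (intro order_trans[OF norm_triangle_ineq] add_mono snoc.IH) auto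
    finally show ?case by simp
  qed
  from this[OF L, of "[]" "[]"] show ?thesis by simp
qed

lemma list_deriv_translate:
  assumes "f \<in> C_infinity" "L \<in> lists Basis"
  shows "list_deriv L (\<lambda>x. f (x - z)) = (\<lambda>x. list_deriv L f (x - z))"
  using assms(2)
proof (induction L rule: list.induct)
  case (Cons b L)
  then show ?case
    using assms(1) by (simp add: partial_deriv_translate C_infinity_differentiable C_infinity_list_deriv)
qed simp

lemma list_deriv_cnj:
  assumes "f \<in> C_infinity" "L \<in> lists Basis"
  shows "list_deriv L (\<lambda>x. cnj (f x)) = (\<lambda>x. cnj (list_deriv L f x))"
  using assms(2)
proof (induction L rule: list.induct)
  case (Cons b L)
  then show ?case
    using assms(1) by (simp add: partial_deriv_cnj C_infinity_differentiable C_infinity_list_deriv)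
qed simp

text \<open>Localised symbols are controlled with one fixed rate of decay and around a moving
  centre, which \<open>rapid\<close> does not express. It is enough for integration by parts and for
  averaging over translations.\<close>

definition decaying :: "'a::euclidean_space \<Rightarrow> ('a \<Rightarrow> complex) \<Rightarrow> bool" where
  "decaying z f \<longleftrightarrow> f \<in> C_infinity \<and> (\<forall>L\<in>lists Basis. \<exists>C. \<forall>t. cmod (list_deriv L f t) \<le> C * decay (t - z))"

lemma decayingD:
  assumes "decaying z f" "L \<in> lists Basis"
  obtains C where "\<And>t. cmod (list_deriv L f t) \<le> C * decay (t - z)"
  using assms unfolding decaying_def by blast

lemma decaying_partial_deriv:
  assumes "decaying z f" "b \<in> Basis"
  shows "decaying z (partial_deriv b f)"
  unfolding decaying_def
proof (intro conjI ballI)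
  show "partial_deriv b f \<in> C_infinity" using assms by (simp add: decaying_def C_infinity_partial_deriv)
  fix L :: "'a list" assume "L \<in> lists Basis"
  with assms have "L @ [b] \<in> lists Basis" by simp
  then obtain C where "\<And>t. cmod (list_deriv (L @ [b]) f t) \<le> C * decay (t - z)"
    using decayingD[OF assms(1)] by blast
  then show "\<exists>C. \<forall>t. cmod (list_deriv L (partial_deriv b f) t) \<le> C * decay (t - z)"
    by auto
qed

lemma decaying_integrable:
  assumes "decaying z f"
  shows "integrable lborel f"
proof -
  obtain C where C: "\<And>t. cmod (list_deriv [] f t) \<le> C * decay (t - z)" using decayingD[OF assms] by blast
  show ?thesis
  proof (rule Bochner_Integration.integrable_bound[of lborel "\<lambda>t. C * decay (t - z)"])
    show "AE t in lborel. norm (f t) \<le> norm (C * decay (t - z))"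
      using C by (intro AE_I2) (auto intro: order_trans[OF _ abs_ge_self])
  qed (use assms in \<open>auto simp: decaying_def intro!: integrable_decay_translate C_infinity_measurable\<close>)
qed

lemma rapid_decaying:
  assumes "rapid f"
  shows "decaying 0 f"
  unfolding decaying_def
proof (intro conjI ballI)
  fix L :: "'a list" assume "L \<in> lists Basis"
  then have "map (Pair False) L \<in> words" by (auto simp: in_lists_conv_set)
  from rapid_word_op[OF assms this] have "rapid (list_deriv L f)" by (simp add: word_op_deriv)
  then show "\<exists>C. \<forall>t. cmod (list_deriv L f t) \<le> C * decay (t - 0)"
    using rapid_decay by (metis diff_zero)
qed (rule rapid_C_infinity[OF assms])

text \<open>The decay is taken from \<open>f\<close>; the derivatives of \<open>h\<close> enter as
  bounded functions.\<close>

lemma decaying_mult: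
  assumes f: "decaying z f" and h: "decaying 0 h"
  shows "decaying z (\<lambda>x. f x * h x)"
proof -
  have fh: "f \<in> C_infinity" "h \<in> C_infinity" using f h by (auto simp: decaying_def)
  have "\<exists>C. \<forall>t. cmod (list_deriv L (\<lambda>x. list_deriv P f x * list_deriv Q h x) t) \<le> C * decay (t - z)"
    if "L \<in> lists Basis" "P \<in> lists Basis" "Q \<in> lists Basis" for L P Q
    using that
  proof (induction L arbitrary: P Q rule: rev_induct)
    case Nil
    obtain C where C: "\<And>t. cmod (list_deriv P f t) \<le> C * decay (t - z)" using decayingD[OF f] Nil by blast
    obtain D where D: "\<And>t. cmod (list_deriv Q h t) \<le> D * decay (t - 0)" using decayingD[OF h] Nil by blast
    have D0: "D \<ge> 0" by (rule decay_bound_nonneg[OF D])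
    have "cmod (list_deriv Q h t) \<le> D" for t
      by (rule order_trans[OF D]) (use D0 decay_le_1[of "t - 0"] in \<open>simp add: mult_left_le\<close>)
    then have "cmod (list_deriv P f t * list_deriv Q h t) \<le> (C * decay (t - z)) * D" for t
      unfolding norm_mult by (intro mult_mono C order_trans[OF norm_ge_zero C]) auto
    then show ?case by (intro exI[of _ "C * D"]) (simp add: mult_ac)
  next
    case (snoc b L)
    then have b: "b \<in> Basis" "L \<in> lists Basis" "b # P \<in> lists Basis" "b # Q \<in> lists Basis" by auto
    obtain C1 where C1: "\<And>t. cmod (list_deriv L (\<lambda>x. list_deriv (b # P) f x * list_deriv Q h x) t) \<le> C1 * decay (t - z)"
      using snoc.IH[OF b(2,3) snoc.prems(3)] by blast
    obtain C2 where C2: "\<And>t. cmod (list_deriv L (\<lambda>x. list_deriv P f x * list_deriv (b # Q) h x) t) \<le> C2 * decay (t - z)"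
      using snoc.IH[OF b(2) snoc.prems(2) b(4)] by blast
    have "list_deriv (L @ [b]) (\<lambda>x. list_deriv P f x * list_deriv Q h x) t =
      list_deriv L (\<lambda>x. list_deriv (b # P) f x * list_deriv Q h x) t + list_deriv L (\<lambda>x. list_deriv P f x * list_deriv (b # Q) h x) t" for t
      using list_deriv_snoc_mult[of "list_deriv P f" "list_deriv Q h" L b t] snoc.prems b fh
      by (simp add: C_infinity_list_deriv)
    then have "cmod (list_deriv (L @ [b]) (\<lambda>x. list_deriv P f x * list_deriv Q h x) t) \<le> C1 * decay (t - z) + C2 * decay (t - z)" for t
      using order_trans[OF norm_triangle_ineq add_mono[OF C1 C2]] by simp
    then show ?case by (intro exI[of _ "C1 + C2"]) (simp add: algebra_simps)
  qed
  from this[of _ "[]" "[]"] fh show ?thesis by (simp add: decaying_def C_infinity_mult)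
qed

text \<open>The derivative of \<open>F\<close> times the character, along \<open>b\<close>, has
  integral 0; its two Leibniz terms are the two sides.\<close>

lemma fourier_partial_deriv:
  fixes F :: "'a::euclidean_space \<Rightarrow> complex"
  assumes F: "decaying z F" and b: "b \<in> Basis"
  shows "fourier (partial_deriv b F) \<zeta> = 2 * pi * \<i> * of_real (\<zeta> \<bullet> b) * fourier F \<zeta>"
proof -
  have Fs: "F \<in> C_infinity" using F by (simp add: decaying_def)
  let ?e = "\<lambda>t. chr (- (t \<bullet> \<zeta>))"
  define k where "k = 2 * pi * \<i> * complex_of_real (\<zeta> \<bullet> b)"
  define G' where "G' t = partial_deriv b F t * ?e t - k * (F t * ?e t)" for t
  have [measurable]: "F \<in> borel_measurable borel" "partial_deriv b F \<in> borel_measurable borel"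
    using Fs b by (auto intro: C_infinity_measurable C_infinity_partial_deriv)
  have int: "integrable lborel (\<lambda>t. h t * ?e t)" if "integrable lborel h" for h :: "'a \<Rightarrow> complex"
  proof (rule Bochner_Integration.integrable_bound[OF that])
    have [measurable]: "h \<in> borel_measurable borel" using that by auto
    show "(\<lambda>t. h t * ?e t) \<in> borel_measurable lborel" by measurable
  qed (simp add: norm_mult)
  note int1 = int[OF decaying_integrable[OF F]] and int2 = int[OF decaying_integrable[OF decaying_partial_deriv[OF F b]]]
  obtain C where C: "\<And>t. cmod (F t) \<le> C * decay (t - z)" using decayingD[OF F, of "[]"] by auto
  obtain D where D: "\<And>t. cmod (partial_deriv b F t) \<le> D * decay (t - z)" using decayingD[OF F, of "[b]"] b by auto
  have "(\<integral>t. G' t \<partial>lborel) = 0"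
  proof (rule integral_directional_deriv_eq_0[OF int1])
    show "norm b \<le> 1" using b by simp
    show "G' \<in> borel_measurable borel" unfolding G'_def[abs_def] by measurable
    show "((\<lambda>r. F (t + r *\<^sub>R b) * ?e (t + r *\<^sub>R b)) has_vector_derivative G' (t + r *\<^sub>R b)) (at r)" for t r
    proof -
      have 1: "((\<lambda>r. F (t + r *\<^sub>R b)) has_derivative (\<lambda>v. v *\<^sub>R partial_deriv b F (t + r *\<^sub>R b))) (at r)"
        using C_infinity_has_vector_derivative[OF Fs b] by (simp add: has_vector_derivative_def)
      have 2: "((\<lambda>r. - ((t + r *\<^sub>R b) \<bullet> \<zeta>)) has_derivative (\<lambda>v. - (v * (b \<bullet> \<zeta>)))) (at r)"
        by (auto intro!: derivative_eq_intros)
      show ?thesis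
        unfolding has_vector_derivative_def
        by (rule has_derivative_eq_rhs[OF has_derivative_mult[OF 1 chr_has_derivative[OF 2]]])
          (auto simp: G'_def k_def scaleR_conv_of_real inner_commute[of b] algebra_simps)
    qed
    show "cmod (G' t) \<le> (D + cmod k * C) * decay (t - z)" for t
    proof -
      have "cmod (G' t) \<le> cmod (partial_deriv b F t) + cmod k * cmod (F t)"
        unfolding G'_def by (rule order_trans[OF norm_triangle_ineq4]) (simp add: norm_mult)
      also have "\<dots> \<le> D * decay (t - z) + cmod k * (C * decay (t - z))"
        by (intro add_mono mult_left_mono C D) auto
      finally show ?thesis by (simp add: algebra_simps)
    qed
  qed
  then have "fourier (partial_deriv b F) \<zeta> - k * fourier F \<zeta> = 0"
    unfolding G'_def fourier_def using int1 int2 by simp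
  then show ?thesis by (simp add: k_def)
qed

lemma fourier_norm_power_bound:
  fixes F :: "'a::euclidean_space \<Rightarrow> complex"
  assumes F: "decaying z F"
    and bd: "\<And>L t. L \<in> lists Basis \<Longrightarrow> cmod (list_deriv L F t) \<le> B (length L) * decay (t - z)"
  shows "norm \<zeta> ^ k * cmod (fourier F \<zeta>) \<le> real DIM('a) ^ k * (B k * (\<integral>t. decay (t::'a) \<partial>lborel))"
proof (rule norm_power_le)
  fix b :: 'a assume b: "b \<in> Basis"
  have "decaying z (list_deriv (replicate n b) F) \<and>
      fourier (list_deriv (replicate n b) F) \<zeta> = (2 * pi * \<i> * of_real (\<zeta> \<bullet> b)) ^ n * fourier F \<zeta>" for n
    by (induction n) (auto simp: F b decaying_partial_deriv fourier_partial_deriv)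
  then have d: "decaying z (list_deriv (replicate k b) F)"
    and eq: "fourier (list_deriv (replicate k b) F) \<zeta> = (2 * pi * \<i> * of_real (\<zeta> \<bullet> b)) ^ k * fourier F \<zeta>" by auto
  \<comment> \<open>The factor (2 \<pi>)^k produced by k derivatives is at least 1 and is given
    away.\<close>
  have "\<bar>\<zeta> \<bullet> b\<bar> ^ k * cmod (fourier F \<zeta>) \<le> (2 * pi * \<bar>\<zeta> \<bullet> b\<bar>) ^ k * cmod (fourier F \<zeta>)"
    using pi_ge_two by (intro mult_right_mono power_mono) (auto intro: mult_right_mono[of 1 "2 * pi", simplified])
  also have "\<dots> = cmod (fourier (list_deriv (replicate k b) F) \<zeta>)"
    by (simp add: eq norm_mult norm_power)
  also have "\<dots> \<le> (\<integral>t. cmod (list_deriv (replicate k b) F t * chr (- (t \<bullet> \<zeta>))) \<partial>lborel)"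
    unfolding fourier_def by (rule integral_norm_bound)
  also have "\<dots> \<le> (\<integral>t. B k * decay (t - z) \<partial>lborel)"
  proof (rule integral_mono)
    show "integrable lborel (\<lambda>t. cmod (list_deriv (replicate k b) F t * chr (- (t \<bullet> \<zeta>))))"
      using decaying_integrable[OF d] by (simp add: norm_mult)
    show "integrable lborel (\<lambda>t. B k * decay (t - z))"
      by (intro integrable_mult_right integrable_decay_translate)
    show "cmod (list_deriv (replicate k b) F t * chr (- (t \<bullet> \<zeta>))) \<le> B k * decay (t - z)" for t
      using bd[of "replicate k b" t] b by (simp add: norm_mult in_lists_conv_set)
  qed
  also have "\<dots> = B k * (\<integral>t. decay (t::'a) \<partial>lborel)" by (simp add: lborel_translate_integral)
  finally show "\<bar>\<zeta> \<bullet> b\<bar> ^ k * cmod (fourier F \<zeta>) \<le> B k * (\<integral>t. decay (t::'a) \<partial>lborel)" .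
qed simp

lemma partial_deriv_inverse_fourier:
  fixes V :: "'a::euclidean_space \<Rightarrow> complex"
  assumes [measurable]: "V \<in> borel_measurable borel" and V: "\<And>k. integrable lborel (\<lambda>\<zeta>. norm \<zeta> ^ k * cmod (V \<zeta>))"
  shows "partial_deriv b (\<lambda>t. \<integral>\<zeta>. V \<zeta> * chr (t \<bullet> \<zeta>) \<partial>lborel) =
    (\<lambda>t. \<integral>\<zeta>. (V \<zeta> * (2 * pi * \<i> * of_real (b \<bullet> \<zeta>))) * chr (t \<bullet> \<zeta>) \<partial>lborel)"
proof
  fix t
  have "((\<lambda>t. \<integral>\<zeta>. V \<zeta> * chr (t \<bullet> \<zeta>) \<partial>lborel) has_derivative
      (\<lambda>v. \<integral>\<zeta>. (V \<zeta> * (2 * pi * \<i> * of_real (v \<bullet> \<zeta>))) * chr (t \<bullet> \<zeta>) \<partial>lborel)) (at t)"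
  proof (rule has_derivative_integral[where r = 1 and K = "\<lambda>\<zeta>. 2 * pi * (norm \<zeta> ^ 1 * cmod (V \<zeta>))"])
    show "((\<lambda>t. V \<zeta> * chr (t \<bullet> \<zeta>)) has_derivative (\<lambda>v. (V \<zeta> * (2 * pi * \<i> * of_real (v \<bullet> \<zeta>))) * chr (x \<bullet> \<zeta>))) (at x)" for \<zeta> x
      by (rule has_derivative_eq_rhs[OF has_derivative_mult_right[OF chr_has_derivative[OF has_derivative_inner_left[OF has_derivative_ident]]]])
        (auto simp: mult_ac)
    show "cmod (V \<zeta> * (2 * pi * \<i> * of_real (v \<bullet> \<zeta>)) * chr (x \<bullet> \<zeta>)) \<le> 2 * pi * (norm \<zeta> ^ 1 * cmod (V \<zeta>)) * norm v" for \<zeta> v x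
    proof -
      have "cmod (V \<zeta> * (2 * pi * \<i> * of_real (v \<bullet> \<zeta>)) * chr (x \<bullet> \<zeta>)) = (2 * pi * cmod (V \<zeta>)) * \<bar>v \<bullet> \<zeta>\<bar>"
        by (simp add: norm_mult)
      also have "\<dots> \<le> (2 * pi * cmod (V \<zeta>)) * (norm v * norm \<zeta>)"
        by (intro mult_left_mono Cauchy_Schwarz_ineq2) auto
      finally show ?thesis by (simp add: mult_ac)
    qed
    show "integrable lborel (\<lambda>\<zeta>. 2 * pi * (norm \<zeta> ^ 1 * cmod (V \<zeta>)))"
      by (intro integrable_mult_right V)
    show "integrable lborel (\<lambda>\<zeta>. V \<zeta> * chr (x \<bullet> \<zeta>))" for x
      by (rule Bochner_Integration.integrable_bound[OF V[of 0]]) (auto simp: norm_mult)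
    show "(\<lambda>\<zeta>. V \<zeta> * (2 * pi * \<i> * of_real (v \<bullet> \<zeta>)) * chr (t \<bullet> \<zeta>)) \<in> borel_measurable lborel" for v
      by measurable
  qed simp
  from partial_deriv_eqI[OF this]
  show "partial_deriv b (\<lambda>t. \<integral>\<zeta>. V \<zeta> * chr (t \<bullet> \<zeta>) \<partial>lborel) t =
    (\<integral>\<zeta>. (V \<zeta> * (2 * pi * \<i> * of_real (b \<bullet> \<zeta>))) * chr (t \<bullet> \<zeta>) \<partial>lborel)" .
qed

text \<open>The innermost derivative is absorbed into the amplitude, replacing \<open>V\<close> by
  \<open>W\<close>, and the moment conditions pass on with one more power of the norm; hence the
  induction generalises over \<open>V\<close>.\<close>

lemma list_deriv_inverse_fourier_bound:
  fixes V :: "'a::euclidean_space \<Rightarrow> complex"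
  assumes V: "V \<in> borel_measurable borel" "\<And>k. integrable lborel (\<lambda>\<zeta>. norm \<zeta> ^ k * cmod (V \<zeta>))" and L: "L \<in> lists Basis"
  shows "cmod (list_deriv L (\<lambda>t. \<integral>\<zeta>. V \<zeta> * chr (t \<bullet> \<zeta>) \<partial>lborel) t)
    \<le> (2 * pi) ^ length L * (\<integral>\<zeta>. norm \<zeta> ^ length L * cmod (V \<zeta>) \<partial>lborel)"
  using L V
proof (induction L arbitrary: V rule: rev_induct)
  case Nil
  have "cmod (\<integral>\<zeta>. V \<zeta> * chr (t \<bullet> \<zeta>) \<partial>lborel) \<le> (\<integral>\<zeta>. cmod (V \<zeta> * chr (t \<bullet> \<zeta>)) \<partial>lborel)"
    by (rule integral_norm_bound)
  then show ?case by (simp add: norm_mult)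
next
  case (snoc b L)
  have [measurable]: "V \<in> borel_measurable borel" by (rule snoc.prems)
  have b: "b \<in> Basis" "L \<in> lists Basis" using snoc.prems by auto
  define W where "W \<zeta> = V \<zeta> * (2 * pi * \<i> * of_real (b \<bullet> \<zeta>))" for \<zeta>
  have Wm [measurable]: "W \<in> borel_measurable borel" unfolding W_def[abs_def] by measurable
  have W: "norm \<zeta> ^ k * cmod (W \<zeta>) \<le> 2 * pi * (norm \<zeta> ^ Suc k * cmod (V \<zeta>))" for k \<zeta>
  proof -
    have "cmod (W \<zeta>) \<le> 2 * pi * (norm \<zeta> * cmod (V \<zeta>))"
      using mult_right_mono[OF Basis_le_norm[OF b(1), of \<zeta>], of "2 * pi * cmod (V \<zeta>)"]
      by (simp add: W_def norm_mult inner_commute[of b] mult_ac)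
    then have "norm \<zeta> ^ k * cmod (W \<zeta>) \<le> norm \<zeta> ^ k * (2 * pi * (norm \<zeta> * cmod (V \<zeta>)))"
      by (intro mult_left_mono) auto
    then show ?thesis by (simp add: mult_ac)
  qed
  have Wi: "integrable lborel (\<lambda>\<zeta>. norm \<zeta> ^ k * cmod (W \<zeta>))" for k
  proof (rule Bochner_Integration.integrable_bound)
    show "integrable lborel (\<lambda>\<zeta>. 2 * pi * (norm \<zeta> ^ Suc k * cmod (V \<zeta>)))"
      by (intro integrable_mult_right snoc.prems)
    show "AE \<zeta> in lborel. norm (norm \<zeta> ^ k * cmod (W \<zeta>)) \<le> norm (2 * pi * (norm \<zeta> ^ Suc k * cmod (V \<zeta>)))"
      using W[of _ k] by (intro AE_I2) (auto simp: abs_mult)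
  qed simp
  have "list_deriv (L @ [b]) (\<lambda>t. \<integral>\<zeta>. V \<zeta> * chr (t \<bullet> \<zeta>) \<partial>lborel) t = list_deriv L (\<lambda>t. \<integral>\<zeta>. W \<zeta> * chr (t \<bullet> \<zeta>) \<partial>lborel) t"
    using partial_deriv_inverse_fourier[OF snoc.prems(2,3), of b] by (simp add: W_def)
  also have "cmod \<dots> \<le> (2 * pi) ^ length L * (\<integral>\<zeta>. norm \<zeta> ^ length L * cmod (W \<zeta>) \<partial>lborel)"
    using b Wm Wi by (intro snoc.IH)
  also have "\<dots> \<le> (2 * pi) ^ length L * (\<integral>\<zeta>. 2 * pi * (norm \<zeta> ^ Suc (length L) * cmod (V \<zeta>)) \<partial>lborel)"
    by (intro mult_left_mono integral_mono Wi integrable_mult_right snoc.prems W) auto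
  also have "\<dots> = (2 * pi) ^ length L * (2 * pi * (\<integral>\<zeta>. norm \<zeta> ^ Suc (length L) * cmod (V \<zeta>) \<partial>lborel))"
    by (simp only: integral_mult_right_zero)
  also have "\<dots> = (2 * pi) ^ length (L @ [b]) * (\<integral>\<zeta>. norm \<zeta> ^ length (L @ [b]) * cmod (V \<zeta>) \<partial>lborel)"
    by (simp add: mult_ac)
  finally show ?case .
qed

text \<open>Integrating over the translation parameter removes all Leibniz terms in which \<open>\<psi>\<close> is differentiated, so
  derivatives of \<open>f\<close> are recovered from those of the localised functions \<open>f \<cdot> \<psi>(\<cdot> - z)\<close>.\<close>

lemma integral_list_deriv_localised:
  fixes f \<psi> :: "'a::euclidean_space \<Rightarrow> complex"
  assumes "f \<in> C_infinity" "decaying 0 \<psi>" "L \<in> lists Basis"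
  shows "integrable lborel (\<lambda>z. list_deriv L (\<lambda>x. f x * \<psi> (x - z)) t)"
    and "(\<integral>z. list_deriv L (\<lambda>x. f x * \<psi> (x - z)) t \<partial>lborel) = list_deriv L f t * (\<integral>x. \<psi> x \<partial>lborel)"
proof -
  have "integrable lborel (\<lambda>z. list_deriv L (\<lambda>x. f x * \<psi> (x - z)) t) \<and>
    (\<integral>z. list_deriv L (\<lambda>x. f x * \<psi> (x - z)) t \<partial>lborel) = list_deriv L f t * (\<integral>x. \<psi> x \<partial>lborel)"
    using assms(3,1,2)
  proof (induction L arbitrary: f \<psi> rule: rev_induct)
    case Nil
    have [measurable]: "\<psi> \<in> borel_measurable borel" using Nil by (auto simp: decaying_def intro: C_infinity_measurable)
    have "integrable lborel (\<lambda>z. \<psi> (t - z))"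
      using decaying_integrable[OF Nil(3)] by (simp add: lborel_translate_integral)
    then show ?case by (simp add: lborel_translate_integral)
  next
    case (snoc b L)
    have b: "b \<in> Basis" "L \<in> lists Basis" using snoc.prems by auto
    have f: "f \<in> C_infinity" "partial_deriv b f \<in> C_infinity" using snoc.prems b by (auto intro: C_infinity_partial_deriv)
    have \<psi>: "\<psi> \<in> C_infinity" "decaying 0 (partial_deriv b \<psi>)" "partial_deriv b \<psi> \<in> C_infinity"
      using snoc.prems(3) decaying_partial_deriv[OF snoc.prems(3) b(1)] by (simp_all add: decaying_def)
    have eq: "list_deriv (L @ [b]) (\<lambda>x. f x * \<psi> (x - z)) t =
      list_deriv L (\<lambda>x. partial_deriv b f x * \<psi> (x - z)) t + list_deriv L (\<lambda>x. f x * partial_deriv b \<psi> (x - z)) t" for z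
      using list_deriv_snoc_mult[OF f(1) C_infinity_translate[OF \<psi>(1)] b(2,1), of z t] \<psi>(1)
      by (simp add: partial_deriv_translate C_infinity_differentiable)
    \<comment> \<open>The induction is used for the pair with \<open>f\<close> differentiated and
      for the pair with \<open>\<psi>\<close> differentiated; the latter contributes a multiple of
      the integral of a derivative.\<close>
    note IH1 = snoc.IH[OF b(2) f(2) snoc.prems(3)] and IH2 = snoc.IH[OF b(2) f(1) \<psi>(2)]
    obtain C where "\<And>t. cmod (list_deriv [b] \<psi> t) \<le> C * decay (t - 0)"
      using decayingD[OF snoc.prems(3), of "[b]"] b by auto
    then have "(\<integral>x. partial_deriv b \<psi> x \<partial>lborel) = 0"
      using b decaying_integrable[OF snoc.prems(3)] by (intro integral_partial_deriv_eq_0[OF \<psi>(1), of b C 0]) auto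
    then show ?case
      unfolding eq using IH1 IH2 by simp
  qed
  then show "integrable lborel (\<lambda>z. list_deriv L (\<lambda>x. f x * \<psi> (x - z)) t)"
    and "(\<integral>z. list_deriv L (\<lambda>x. f x * \<psi> (x - z)) t \<partial>lborel) = list_deriv L f t * (\<integral>x. \<psi> x \<partial>lborel)" by auto
qed

section \<open>The two implications between symbol bounds and Fourier bounds\<close>

lemma fact_pow_geom_mult_le:
  assumes "s \<ge> 0" "0 < A" "A \<le> M" "0 < B" "B \<le> M" "0 \<le> c" "0 \<le> d"
  shows "(c * A ^ a * fact_pow s a) * (d * B ^ b * fact_pow s b) \<le> (c * d) * M ^ (a + b) * fact_pow s (a + b)"
proof -
  have "(c * A ^ a * fact_pow s a) * (d * B ^ b * fact_pow s b) = (c * d) * (A ^ a * B ^ b) * (fact_pow s a * fact_pow s b)"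
    by simp
  also have "\<dots> \<le> (c * d) * (M ^ a * M ^ b) * fact_pow s (a + b)"
    using assms by (intro mult_mono power_mono fact_pow_mult_le) auto
  finally show ?thesis by (simp add: power_add)
qed

text \<open>Moderateness is one inequality, but \<open>v\<close> is even, so exchanging the two
  points gives it in the other direction as well.\<close>

lemma moderate_bounds:
  assumes "submult_weight v" "m \<in> moderate_weights v"
  obtains C where "C > 0" "\<And>z. m z > 0" "\<And>z. v z > 0" "\<And>t z. m t \<le> C * v (t - z) * m z" "\<And>t z. m z \<le> C * v (t - z) * m t"
proof -
  obtain C where C: "C > 0" "\<And>z \<zeta>. m (z + \<zeta>) \<le> C * v z * m \<zeta>" and m: "\<And>z. m z > 0"
    using assms(2) by (auto simp: moderate_weights_def)
  have v: "\<And>z. v z > 0" "\<And>z. v (- z) = v z" using assms(1) by (auto simp: submult_weight_def)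
  have "m z \<le> C * v (t - z) * m t" for t z using C(2)[of "z - t" t] v(2)[of "t - z"] by simp
  moreover have "m t \<le> C * v (t - z) * m z" for t z using C(2)[of "t - z" z] by simp
  ultimately show ?thesis using C m v that by blast
qed

text \<open>In each Leibniz term \<open>m t\<close> is traded for \<open>m z\<close> at the price
  \<open>v (t - z)\<close>, which the differentiated window absorbs. The resulting bound is
  integrable in t and keeps the order of the factorial, so \<open>exp_decay_of_powers\<close>
  applies.\<close>

lemma symbol_bound_imp_fourier_bound:
  fixes \<sigma> \<Phi> :: "'a::euclidean_space \<Rightarrow> complex"
  assumes s: "s > 0" and v: "submult_weight v" and m: "m \<in> moderate_weights v"
    and \<Phi>: "admissible_window s v \<Phi>" and \<sigma>: "\<sigma> \<in> C_infinity"
    and c1: "c1 > 0" "C1 > 0" "\<And>L t. L \<in> lists Basis \<Longrightarrow> cmod (list_deriv L \<sigma> t) \<le> c1 * m t * C1 ^ length L * fact_pow s (length L)"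
  shows "\<exists>c>0. \<exists>\<epsilon>>0. \<forall>z \<zeta>. cmod (fourier (\<lambda>t. \<sigma> t * cnj (\<Phi> (t - z))) \<zeta>) \<le> c * m z * exp (- \<epsilon> * norm \<zeta> powr (1 / s))"
proof -
  obtain C0 where C0: "C0 > 0" and mv: "\<And>z. m z > 0" "\<And>z. v z > 0" "\<And>t z. m t \<le> C0 * v (t - z) * m z"
    using moderate_bounds[OF v m] by metis
  obtain K C2 where K: "K > 0" "C2 > 0" "\<And>L u. L \<in> lists Basis \<Longrightarrow>
      v u * cmod (list_deriv L \<Phi> u) \<le> K * C2 ^ length L * fact_pow s (length L) * decay u"
    using \<Phi> unfolding admissible_window_def by blast
  have \<Phi>s: "\<Phi> \<in> C_infinity" using \<Phi> by (auto simp: admissible_window_def intro: rapid_C_infinity)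
  define M where "M = max C1 C2"
  have M: "M > 0" "C1 \<le> M" "C2 \<le> M" using c1 by (auto simp: M_def)
  define I where "I = (\<integral>t. decay (t::'a) \<partial>lborel)"
  have I: "I \<ge> 0" unfolding I_def by (intro integral_nonneg_AE) auto
  define c where "c = 2 powr s * (C0 * c1 * K * (I + 1))"
  \<comment> \<open>The 2 counts Leibniz terms, the dimension is the price for the norm instead of a
    coordinate, and \<open>M\<close> is the larger of the two rates.\<close>
  define A where "A = real DIM('a) * (2 * M)"
  have A: "A > 0" using M by (simp add: A_def)
  have c: "c > 0" unfolding c_def using C0 c1 K I by (intro mult_pos_pos) auto
  have "cmod (fourier (\<lambda>t. \<sigma> t * cnj (\<Phi> (t - z))) \<zeta>) \<le> c * m z * exp (- (s / (2 * A powr (1 / s))) * norm \<zeta> powr (1 / s))" for z \<zeta>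
  proof -
    let ?F = "\<lambda>t. \<sigma> t * cnj (\<Phi> (t - z))"
    have cs: "(\<lambda>t. cnj (\<Phi> (t - z))) \<in> C_infinity" by (intro C_infinity_cnj C_infinity_translate \<Phi>s)
    define B where "B n = (C0 * c1 * K * m z) * (2 * M) ^ n * fact_pow s n" for n
    have bd: "cmod (list_deriv L ?F t) \<le> B (length L) * decay (t - z)" if L: "L \<in> lists Basis" for L t
    proof -
      have "cmod (list_deriv L ?F t) \<le> 2 ^ length L * ((C0 * c1 * K * m z) * M ^ length L * fact_pow s (length L) * decay (t - z))"
      proof (rule list_deriv_mult_bound[OF \<sigma> cs _ L])
        fix P Q :: "'a list" assume P: "P \<in> lists Basis" and Q: "Q \<in> lists Basis"
        let ?p = "length P" and ?q = "length Q"
        have "cmod (list_deriv Q (\<lambda>t. cnj (\<Phi> (t - z))) t) = cmod (list_deriv Q \<Phi> (t - z))"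
          using Q \<Phi>s by (simp add: list_deriv_cnj[OF C_infinity_translate] list_deriv_translate)
        then have "cmod (list_deriv P \<sigma> t) * cmod (list_deriv Q (\<lambda>t. cnj (\<Phi> (t - z))) t)
            \<le> (c1 * m t * C1 ^ ?p * fact_pow s ?p) * cmod (list_deriv Q \<Phi> (t - z))"
          using c1(3)[OF P] by (simp add: mult_right_mono)
        also have "\<dots> \<le> (c1 * (C0 * v (t - z) * m z) * C1 ^ ?p * fact_pow s ?p) * cmod (list_deriv Q \<Phi> (t - z))"
          using mv c1 by (intro mult_right_mono mult_left_mono) auto
        also have "\<dots> = ((C0 * c1 * m z) * C1 ^ ?p * fact_pow s ?p) * (v (t - z) * cmod (list_deriv Q \<Phi> (t - z)))"
          by (simp add: mult_ac)
        also have "\<dots> \<le> ((C0 * c1 * m z) * C1 ^ ?p * fact_pow s ?p) * (K * C2 ^ ?q * fact_pow s ?q * decay (t - z))"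
          using C0 c1 less_imp_le[OF mv(1)[of z]] by (intro mult_left_mono K(3) Q) auto
        also have "\<dots> = (((C0 * c1 * m z) * C1 ^ ?p * fact_pow s ?p) * (K * C2 ^ ?q * fact_pow s ?q)) * decay (t - z)"
          by simp
        also have "\<dots> \<le> ((C0 * c1 * m z * K) * M ^ (?p + ?q) * fact_pow s (?p + ?q)) * decay (t - z)"
          using s C0 c1 K M less_imp_le[OF mv(1)[of z]] by (intro mult_right_mono fact_pow_geom_mult_le) auto
        finally show "cmod (list_deriv P \<sigma> t) * cmod (list_deriv Q (\<lambda>t. cnj (\<Phi> (t - z))) t)
            \<le> (C0 * c1 * K * m z) * M ^ (?p + ?q) * fact_pow s (?p + ?q) * decay (t - z)" by (simp add: mult_ac)
      qed
      then show ?thesis by (simp add: B_def power_mult_distrib mult_ac)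
    qed
    have dec: "decaying z ?F"
      unfolding decaying_def using bd \<sigma> cs by (auto intro!: C_infinity_mult)
    have "cmod (fourier ?F \<zeta>) \<le> 2 powr s * (C0 * c1 * K * (I + 1) * m z) * exp (- (s / (2 * A powr (1 / s))) * norm \<zeta> powr (1 / s))"
    proof (rule exp_decay_of_powers)
      fix k
      have "norm \<zeta> ^ k * cmod (fourier ?F \<zeta>) \<le> real DIM('a) ^ k * (B k * I)"
        unfolding I_def by (rule fourier_norm_power_bound[OF dec bd])
      also have "\<dots> = (C0 * c1 * K * m z * I) * A ^ k * fact_pow s k"
        by (simp add: B_def A_def power_mult_distrib mult_ac)
      also have "\<dots> \<le> (C0 * c1 * K * m z * (I + 1)) * A ^ k * fact_pow s k"
        using C0 c1 K A less_imp_le[OF mv(1)[of z]] by (intro mult_right_mono mult_left_mono) auto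
      finally show "norm \<zeta> ^ k * cmod (fourier ?F \<zeta>) \<le> C0 * c1 * K * (I + 1) * m z * A ^ k * fact_pow s k"
        by (simp add: mult_ac)
    qed (use A s C0 c1 K I less_imp_le[OF mv(1)[of z]] in auto)
    then show ?thesis by (simp add: c_def mult_ac)
  qed
  moreover have "s / (2 * A powr (1 / s)) > 0" using s A by simp
  ultimately show ?thesis using c by blast
qed

text \<open>The derivatives of the localised symbol obtained by inversion are bounded uniformly in
  t, with no decay away from the centre z. The second window factor supplies that decay and pays for
  returning from \<open>m z\<close> to \<open>m t\<close>. The point \<open>p\<close> makes the
  final division by the squared norm of the window possible.\<close>

lemma fourier_bound_imp_symbol_bound:
  fixes \<sigma> \<Phi> :: "'a::euclidean_space \<Rightarrow> complex"
  assumes s: "s > 0" and v: "submult_weight v" and m: "m \<in> moderate_weights v"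
    and \<Phi>: "admissible_window s v \<Phi>" "\<Phi> p \<noteq> 0" and \<sigma>: "\<sigma> \<in> C_infinity"
    and int: "\<And>z. integrable lborel (\<lambda>t. \<sigma> t * cnj (\<Phi> (t - z)))"
    and c1: "c1 > 0" "\<epsilon> > 0" "\<And>z \<zeta>. cmod (fourier (\<lambda>t. \<sigma> t * cnj (\<Phi> (t - z))) \<zeta>) \<le> c1 * m z * exp (- \<epsilon> * norm \<zeta> powr (1 / s))"
  shows "\<exists>c>0. \<exists>C>0. \<forall>L\<in>lists Basis. \<forall>t. cmod (list_deriv L \<sigma> t) \<le> c * m t * C ^ length L * fact_pow s (length L)"
proof -
  obtain C0 where C0: "C0 > 0" and mv: "\<And>z. m z > 0" "\<And>z. v z > 0" "\<And>t z. m z \<le> C0 * v (t - z) * m t"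
    using moderate_bounds[OF v m] by metis
  obtain K C2 where K: "K > 0" "C2 > 0" "\<And>L u. L \<in> lists Basis \<Longrightarrow>
      v u * cmod (list_deriv L \<Phi> u) \<le> K * C2 ^ length L * fact_pow s (length L) * decay u"
    using \<Phi> unfolding admissible_window_def by blast
  have r: "rapid \<Phi>" using \<Phi> by (auto simp: admissible_window_def)
  have \<Phi>s: "\<Phi> \<in> C_infinity" by (rule rapid_C_infinity[OF r])
  define I where "I = (\<integral>t. decay (t::'a) \<partial>lborel)"
  have I: "I \<ge> 0" unfolding I_def by (intro integral_nonneg_AE) auto
  \<comment> \<open>The exponential is split into halves: one keeps the integrals over \<zeta>
    finite, the other bounds the powers of |\<zeta>|, with the constant \<open>q\<close> of
    \<open>power_exp_bound\<close> at \<epsilon> / 2.\<close>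
  obtain K3 where K3: "K3 > 0" "\<And>x::'a. exp (- (\<epsilon> / 2) * norm x powr (1 / s)) \<le> K3 * decay x"
    using exp_le_decay[of "\<epsilon> / 2" s] c1 s by auto
  define q where "q = (s / (\<epsilon> / 2)) powr s"
  have q: "q > 0" using s c1 by (simp add: q_def)
  define B where "B = 2 * pi * q"
  have B: "B > 0" using q by (simp add: B_def)
  define c2 where "c2 = c1 * K3 * (I + 1)"
  have c2: "c2 > 0" unfolding c2_def using c1 K3 I by (intro mult_pos_pos) auto
  have loc: "cmod (list_deriv L (\<lambda>t. \<sigma> t * cnj (\<Phi> (t - z))) t) \<le> (c2 * m z) * B ^ length L * fact_pow s (length L)"
    if L: "L \<in> lists Basis" for L z t
  proof -
    let ?F = "\<lambda>t. \<sigma> t * cnj (\<Phi> (t - z))"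
    let ?n = "length L"
    have Fs: "?F \<in> C_infinity" by (intro C_infinity_mult \<sigma> C_infinity_cnj C_infinity_translate \<Phi>s)
    have [measurable]: "?F \<in> borel_measurable borel" by (rule C_infinity_measurable[OF Fs])
    have bd: "norm \<zeta> ^ k * cmod (fourier ?F \<zeta>) \<le> (c1 * m z * K3 * q ^ k * fact_pow s k) * decay \<zeta>" for k \<zeta>
    proof -
      let ?e = "exp (- (\<epsilon> / 2) * norm \<zeta> powr (1 / s))"
      have "exp (- \<epsilon> * norm \<zeta> powr (1 / s)) = ?e * ?e" by (simp flip: exp_add)
      then have "norm \<zeta> ^ k * cmod (fourier ?F \<zeta>) \<le> norm \<zeta> ^ k * (c1 * m z * (?e * ?e))"
        using c1(3)[of z \<zeta>] by (intro mult_left_mono) auto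
      also have "\<dots> = (c1 * m z) * ((norm \<zeta> ^ k * ?e) * ?e)" by simp
      also have "\<dots> \<le> (c1 * m z) * ((q ^ k * fact_pow s k) * (K3 * decay \<zeta>))"
        unfolding q_def using c1 s q K3 less_imp_le[OF mv(1)[of z]]
        by (intro mult_left_mono mult_mono power_exp_bound) auto
      finally show ?thesis by (simp add: mult_ac)
    qed
    have Vi: "integrable lborel (\<lambda>\<zeta>. norm \<zeta> ^ k * cmod (fourier ?F \<zeta>))" for k
    proof (rule Bochner_Integration.integrable_bound)
      show "integrable lborel (\<lambda>\<zeta>. (c1 * m z * K3 * q ^ k * fact_pow s k) * decay (\<zeta>::'a))"
        by (intro integrable_mult_right integrable_decay)
      show "AE \<zeta> in lborel. norm (norm \<zeta> ^ k * cmod (fourier ?F \<zeta>)) \<le> norm ((c1 * m z * K3 * q ^ k * fact_pow s k) * decay \<zeta>)"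
        using bd by (intro AE_I2) (auto intro: order_trans[OF _ abs_ge_self])
    qed measurable
    have "integrable lborel (fourier ?F)"
    proof -
      have "integrable lborel (\<lambda>\<zeta>. cmod (fourier ?F \<zeta>))" using Vi[of 0] by simp
      moreover have "fourier ?F \<in> borel_measurable lborel" by measurable
      ultimately show ?thesis by (simp add: integrable_norm_iff)
    qed
    \<comment> \<open>An identity of functions, so every derivative of the localised symbol can be
      computed from the inverse transform.\<close>
    then have inv: "?F = (\<lambda>t. \<integral>\<zeta>. fourier ?F \<zeta> * chr (t \<bullet> \<zeta>) \<partial>lborel)"
      by (intro ext fourier_inversion int C_infinity_isCont Fs)
    have "cmod (list_deriv L (\<lambda>t. \<integral>\<zeta>. fourier ?F \<zeta> * chr (t \<bullet> \<zeta>) \<partial>lborel) t)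
        \<le> (2 * pi) ^ ?n * (\<integral>\<zeta>. norm \<zeta> ^ ?n * cmod (fourier ?F \<zeta>) \<partial>lborel)"
      by (intro list_deriv_inverse_fourier_bound Vi L) measurable
    also have "\<dots> \<le> (2 * pi) ^ ?n * (\<integral>\<zeta>. (c1 * m z * K3 * q ^ ?n * fact_pow s ?n) * decay (\<zeta>::'a) \<partial>lborel)"
      by (intro mult_left_mono integral_mono Vi integrable_mult_right integrable_decay bd) auto
    also have "\<dots> = (c1 * m z * K3 * B ^ ?n * fact_pow s ?n) * I"
      by (simp add: I_def B_def power_mult_distrib mult_ac)
    also have "\<dots> \<le> (c1 * m z * K3 * B ^ ?n * fact_pow s ?n) * (I + 1)"
      using c1 K3 B less_imp_le[OF mv(1)[of z]] by (intro mult_left_mono) auto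
    finally show ?thesis unfolding inv[symmetric] by (simp add: c2_def mult_ac)
  qed
  define M where "M = max B C2"
  have M: "M > 0" "B \<le> M" "C2 \<le> M" using B by (auto simp: M_def)
  define J where "J = (\<integral>x. (cmod (\<Phi> x))\<^sup>2 \<partial>lborel)"
  let ?\<psi> = "\<lambda>x. cnj (\<Phi> x) * \<Phi> x"
  have "decaying 0 (\<lambda>x. cnj (\<Phi> x))"
    using rapid_decaying[OF r] unfolding decaying_def by (auto simp: C_infinity_cnj list_deriv_cnj)
  then have \<psi>: "decaying 0 ?\<psi>" by (rule decaying_mult[OF _ rapid_decaying[OF r]])
  have sq: "?\<psi> x = of_real ((cmod (\<Phi> x))\<^sup>2)" for x
    by (metis complex_norm_square mult.commute)
  have \<psi>i: "integrable lborel (\<lambda>x. (cmod (\<Phi> x))\<^sup>2)"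
    using decaying_integrable[OF \<psi>] unfolding sq by (simp only: complex_of_real_integrable_eq)
  have J: "J > 0"
    unfolding J_def by (rule integral_cmod_square_pos[OF C_infinity_continuous[OF \<Phi>s] \<psi>i \<Phi>(2)])
  have \<psi>J: "(\<integral>x. ?\<psi> x \<partial>lborel) = of_real J" unfolding sq J_def by (rule integral_complex_of_real)
  define c where "c = C0 * c2 * K * (I + 1) / J"
  have c: "c > 0" unfolding c_def using C0 c2 K I J by (intro divide_pos_pos mult_pos_pos) auto
  have "cmod (list_deriv L \<sigma> t) \<le> c * m t * (2 * M) ^ length L * fact_pow s (length L)" if L: "L \<in> lists Basis" for L t
  proof -
    let ?n = "length L"
    define D where "D = (C0 * c2 * K * m t) * (2 * M) ^ ?n * fact_pow s ?n"
    have D0: "D \<ge> 0" unfolding D_def using C0 c2 K M less_imp_le[OF mv(1)[of t]] by (intro mult_nonneg_nonneg) auto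
    have bd: "cmod (list_deriv L (\<lambda>x. \<sigma> x * ?\<psi> (x - z)) t) \<le> D * decay (t - z)" for z
    proof -
      have eq: "(\<lambda>x. \<sigma> x * ?\<psi> (x - z)) = (\<lambda>x. (\<sigma> x * cnj (\<Phi> (x - z))) * \<Phi> (x - z))" by (simp add: mult.assoc)
      have Fs: "(\<lambda>t. \<sigma> t * cnj (\<Phi> (t - z))) \<in> C_infinity" by (intro C_infinity_mult \<sigma> C_infinity_cnj C_infinity_translate \<Phi>s)
      have "cmod (list_deriv L (\<lambda>x. (\<sigma> x * cnj (\<Phi> (x - z))) * \<Phi> (x - z)) t)
          \<le> 2 ^ ?n * ((C0 * c2 * K * m t) * M ^ ?n * fact_pow s ?n * decay (t - z))"
      proof (rule list_deriv_mult_bound[OF Fs C_infinity_translate[OF \<Phi>s] _ L])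
        fix P Q :: "'a list" assume P: "P \<in> lists Basis" and Q: "Q \<in> lists Basis"
        let ?p = "length P" and ?q = "length Q"
        have "cmod (list_deriv P (\<lambda>t. \<sigma> t * cnj (\<Phi> (t - z))) t) * cmod (list_deriv Q (\<lambda>x. \<Phi> (x - z)) t)
            \<le> ((c2 * m z) * B ^ ?p * fact_pow s ?p) * cmod (list_deriv Q \<Phi> (t - z))"
          using loc[OF P, of z t] Q \<Phi>s by (simp add: list_deriv_translate mult_right_mono)
        also have "\<dots> \<le> ((c2 * (C0 * v (t - z) * m t)) * B ^ ?p * fact_pow s ?p) * cmod (list_deriv Q \<Phi> (t - z))"
          using mv c2 B by (intro mult_right_mono mult_left_mono) auto
        also have "\<dots> = ((C0 * c2 * m t) * B ^ ?p * fact_pow s ?p) * (v (t - z) * cmod (list_deriv Q \<Phi> (t - z)))"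
          by (simp add: mult_ac)
        also have "\<dots> \<le> ((C0 * c2 * m t) * B ^ ?p * fact_pow s ?p) * (K * C2 ^ ?q * fact_pow s ?q * decay (t - z))"
          using C0 c2 B less_imp_le[OF mv(1)[of t]] by (intro mult_left_mono K(3) Q) auto
        also have "\<dots> = (((C0 * c2 * m t) * B ^ ?p * fact_pow s ?p) * (K * C2 ^ ?q * fact_pow s ?q)) * decay (t - z)"
          by simp
        also have "\<dots> \<le> ((C0 * c2 * m t * K) * M ^ (?p + ?q) * fact_pow s (?p + ?q)) * decay (t - z)"
          using s C0 c2 K M B less_imp_le[OF mv(1)[of t]] by (intro mult_right_mono fact_pow_geom_mult_le) auto
        finally show "cmod (list_deriv P (\<lambda>t. \<sigma> t * cnj (\<Phi> (t - z))) t) * cmod (list_deriv Q (\<lambda>x. \<Phi> (x - z)) t)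
            \<le> (C0 * c2 * K * m t) * M ^ (?p + ?q) * fact_pow s (?p + ?q) * decay (t - z)" by (simp add: mult_ac)
      qed
      then show ?thesis unfolding eq by (simp add: D_def power_mult_distrib mult_ac)
    qed
    have "cmod (list_deriv L \<sigma> t) * J = cmod (\<integral>z. list_deriv L (\<lambda>x. \<sigma> x * ?\<psi> (x - z)) t \<partial>lborel)"
      using J by (simp add: integral_list_deriv_localised(2)[OF \<sigma> \<psi> L] \<psi>J norm_mult)
    also have "\<dots> \<le> (\<integral>z. cmod (list_deriv L (\<lambda>x. \<sigma> x * ?\<psi> (x - z)) t) \<partial>lborel)"
      by (rule integral_norm_bound)
    also have "\<dots> \<le> (\<integral>z. D * decay (t - z) \<partial>lborel)"
      by (intro integral_mono integrable_norm integral_list_deriv_localised(1)[OF \<sigma> \<psi> L] integrable_mult_right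
          integrable_decay_translate bd)
    also have "\<dots> = D * I" by (simp add: I_def lborel_translate_integral)
    also have "\<dots> \<le> D * (I + 1)" using D0 by (intro mult_left_mono) auto
    finally have "cmod (list_deriv L \<sigma> t) \<le> D * (I + 1) / J" using J by (simp add: field_simps)
    then show ?thesis by (simp add: c_def D_def mult_ac)
  qed
  moreover have "2 * M > 0" using M by simp
  ultimately show ?thesis using c by blast
qed

text \<open>The factorial of a multi-index and that of its size differ by a geometric factor, which
  the existentially quantified \<open>C\<close> absorbs.\<close>

lemma mi_deriv_bound_iff:
  fixes \<sigma> :: "'a::euclidean_space \<Rightarrow> complex"
  assumes \<sigma>: "\<sigma> \<in> C_infinity" and s: "s \<ge> 0" and m: "\<And>z. m z > 0"
  shows "(\<exists>c>0. \<exists>C>0. \<forall>z \<alpha>. cmod (mi_deriv \<alpha> \<sigma> z) \<le> c * m z * C ^ mi_size \<alpha> * mi_fact \<alpha> powr s) \<longleftrightarrow>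
    (\<exists>c>0. \<exists>C>0. \<forall>L\<in>lists Basis. \<forall>t. cmod (list_deriv L \<sigma> t) \<le> c * m t * C ^ length L * fact_pow s (length L))"
    (is "?mi \<longleftrightarrow> ?list")
proof
  assume ?mi
  then obtain c C where c: "c > 0" "C > 0" and bd: "\<And>z \<alpha>. cmod (mi_deriv \<alpha> \<sigma> z) \<le> c * m z * C ^ mi_size \<alpha> * mi_fact \<alpha> powr s"
    by blast
  have "cmod (list_deriv L \<sigma> t) \<le> c * m t * C ^ length L * fact_pow s (length L)" if L: "L \<in> lists Basis" for L t
  proof -
    have "cmod (list_deriv L \<sigma> t) \<le> c * m t * C ^ length L * mi_fact (count_list L) powr s"
      using bd[of "count_list L" t] by (simp add: list_deriv_eq_mi_deriv[OF \<sigma> L] mi_size_count[OF L])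
    also have "\<dots> \<le> c * m t * C ^ length L * fact_pow s (length L)"
      using c less_imp_le[OF m[of t]] by (intro mult_left_mono mi_fact_powr_le[OF s L]) auto
    finally show ?thesis .
  qed
  with c show ?list by blast
next
  assume ?list
  then obtain c C where c: "c > 0" "C > 0" and bd: "\<And>L t. L \<in> lists Basis \<Longrightarrow> cmod (list_deriv L \<sigma> t) \<le> c * m t * C ^ length L * fact_pow s (length L)"
    by blast
  let ?E = "(2 ^ DIM('a)) powr s"
  have "cmod (mi_deriv \<alpha> \<sigma> z) \<le> c * m z * (C * ?E) ^ mi_size \<alpha> * mi_fact \<alpha> powr s" for z \<alpha>
  proof -
    have "c * m z * C ^ mi_size \<alpha> * fact_pow s (mi_size \<alpha>) \<le> c * m z * C ^ mi_size \<alpha> * (?E ^ mi_size \<alpha> * mi_fact \<alpha> powr s)"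
      using c less_imp_le[OF m[of z]] by (intro mult_left_mono fact_pow_mi_size_le[OF s]) auto
    with bd[OF mi_list_in_lists[of \<alpha>], of z] show ?thesis
      by (simp add: mi_deriv_eq_list_deriv length_mi_list power_mult_distrib mult_ac)
  qed
  moreover have "C * ?E > 0" using c by simp
  ultimately show ?mi using c by blast
qed

text \<open>Membership in the dual stands on the right because it gives the brackets there their
  meaning. On the left it is a consequence: the bound without derivatives reads |\<sigma>| \<le> c
  m, and moderateness bounds m by a multiple of v.\<close>

theorem theorem4p2:
  fixes s :: real
    and v m :: "(real^'n) \<times> (real^'n) \<Rightarrow> real"
    and g :: "real^'n \<Rightarrow> complex"
    and \<sigma> :: "(real^'n) \<times> (real^'n) \<Rightarrow> complex"
    and T :: "((real^'n) \<times> (real^'n) \<Rightarrow> complex) topology"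
  assumes "s \<ge> 1 / 2"
    and "submult_weight v"
    and "m \<in> moderate_weights v"
    and "g \<noteq> (\<lambda>t. 0)"
    \<comment> \<open>\<open>T\<close> is the test function space on phase space whose dual contains the symbols\<close>
    and "(s < 1 \<and> g \<in> GS_space s s \<and> T = GS_topology s s) \<or>
         (s \<ge> 1 \<and> g \<in> Sigma11_space \<and> T = Sigma11_topology) \<or>
         (s \<ge> 1 \<and> g \<in> GS_space s s \<and> T = GS_topology s s \<and>
            (\<forall>\<epsilon>>0. \<exists>c\<^sub>\<epsilon>>0. \<forall>z. v z \<le> c\<^sub>\<epsilon> * exp (\<epsilon> * norm z powr (1 / s))))"
    and "\<sigma> \<in> C_infinity"
  shows "(\<exists>c>0. \<exists>C>0. \<forall>z \<alpha>. cmod (mi_deriv \<alpha> \<sigma> z) \<le> c * m z * C ^ mi_size \<alpha> * mi_fact \<alpha> powr s)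
     \<longleftrightarrow>
     in_dual T \<sigma> \<and>
     (\<exists>c>0. \<exists>\<epsilon>>0. \<forall>z w. cmod (weyl_op (pairing \<sigma>) (tf_shift z g) (tf_shift w g))
          \<le> c * m ((w + z) /\<^sub>R 2) * exp (- \<epsilon> * norm (w - z) powr (1 / s)))"
proof -
  note s = assms(1) and v = assms(2) and m = assms(3) and \<sigma> = assms(6)
  have s0: "s > 0" using s by simp
  let ?\<Phi> = "cross_wigner g g"
  obtain C0 where C0: "C0 > 0" "\<And>z. m z > 0" "\<And>z. v z > 0" "\<And>t z. m t \<le> C0 * v (t - z) * m z"
    using moderate_bounds[OF v m] by metis
  \<comment> \<open>All case distinctions on \<open>s\<close>, \<open>g\<close> and \<open>T\<close>
    end here; what follows uses only these four facts.\<close>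
  have window: "admissible_window s v ?\<Phi> \<and> rapid g \<and> (\<forall>z. (\<lambda>x. ?\<Phi> (x - z)) \<in> topspace T) \<and>
      (\<forall>c>0. (\<forall>z. cmod (\<sigma> z) \<le> c * v z) \<longrightarrow> in_dual T \<sigma>)"
  proof -
    have GS: ?thesis if g: "g \<in> GS_space s s" and T: "T = GS_topology s s" and gr: "subexp_growth s v"
      using admissible_cross_wigner_GS[OF g s gr] in_dual_GS[OF s0 gr \<sigma>] GS_space_word_bounded[OF g s, of 0]
      unfolding T topspace_GS_topology rapid_def by metis
    have Sigma: ?thesis if g: "g \<in> Sigma11_space" and T: "T = Sigma11_topology" and s1: "s \<ge> 1"
      using admissible_cross_wigner_Sigma11[OF g s1 v] in_dual_Sigma11[OF v \<sigma>] Sigma11_space_word_bounded[OF g zero_less_one]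
      unfolding T topspace_Sigma11_topology rapid_def by metis
    show ?thesis
      using assms(5) GS Sigma submult_weight_subexp_growth[OF v s0] unfolding subexp_growth_def by blast
  qed
  then have \<Phi>: "admissible_window s v ?\<Phi>" and g: "rapid g" and T: "\<And>z. (\<lambda>x. ?\<Phi> (x - z)) \<in> topspace T"
    and dual: "\<And>c. c > 0 \<Longrightarrow> (\<And>z. cmod (\<sigma> z) \<le> c * v z) \<Longrightarrow> in_dual T \<sigma>" by auto
  obtain p where p: "?\<Phi> p \<noteq> 0" by (rule cross_wigner_nonzero[OF g assms(4)])
  let ?V = "\<lambda>u. fourier (\<lambda>t. \<sigma> t * cnj (?\<Phi> (t - u)))"
  let ?list = "\<exists>c>0. \<exists>C>0. \<forall>L\<in>lists Basis. \<forall>t. cmod (list_deriv L \<sigma> t) \<le> c * m t * C ^ length L * fact_pow s (length L)"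
  \<comment> \<open>The pair (z, w) corresponds bijectively to the midpoint u and the rotated
    difference \<zeta>, and the rotation preserves norms; so the constants carry over
    unchanged.\<close>
  have V: "(\<forall>z w. cmod (weyl_op (pairing \<sigma>) (tf_shift z g) (tf_shift w g))
          \<le> c * m ((w + z) /\<^sub>R 2) * exp (- \<epsilon> * norm (w - z) powr (1 / s))) \<longleftrightarrow>
      (\<forall>u \<zeta>. cmod (?V u \<zeta>) \<le> c * m u * exp (- \<epsilon> * norm \<zeta> powr (1 / s)))" (is "?W \<longleftrightarrow> ?U") for c \<epsilon>
  proof
    assume U: ?U
    have nm: "norm (snd w - snd z, fst z - fst w) = norm (w - z)" for w z :: "(real^'n) \<times> (real^'n)"
      by (cases w; cases z) (simp add: norm_Pair norm_minus_commute add.commute)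
    show ?W
    proof (intro allI)
      fix z w
      show "cmod (weyl_op (pairing \<sigma>) (tf_shift z g) (tf_shift w g))
          \<le> c * m ((w + z) /\<^sub>R 2) * exp (- \<epsilon> * norm (w - z) powr (1 / s))"
        unfolding weyl_op_tf_shift[OF rapid_C_infinity[OF g]]
        using U[rule_format, of "(w + z) /\<^sub>R 2" "(snd w - snd z, fst z - fst w)"] unfolding nm .
    qed
  next
    assume W: ?W
    show ?U
    proof (intro allI)
      fix u \<zeta> :: "(real^'n) \<times> (real^'n)"
      \<comment> \<open>The inverse rotation: the points at u plus and minus half of
        \<open>\<eta>\<close> have midpoint u and rotated difference \<open>\<zeta>\<close>.\<close>
      define \<eta> where "\<eta> = (- snd \<zeta>, fst \<zeta>)"
      let ?w = "u + \<eta> /\<^sub>R 2" and ?z = "u - \<eta> /\<^sub>R 2"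
      have half: "a /\<^sub>R 2 + a /\<^sub>R 2 = a" for a :: "'b::real_vector" by (simp flip: scaleR_add_left)
      have 1: "(?w + ?z) /\<^sub>R 2 = u" using half[of u] by (simp add: scaleR_add_right)
      have 2: "?w - ?z = \<eta>" using half[of \<eta>] by (simp add: algebra_simps)
      have "snd ?w - snd ?z = snd (?w - ?z)" "fst ?z - fst ?w = - fst (?w - ?z)" by simp_all
      then have 3: "(snd ?w - snd ?z, fst ?z - fst ?w) = \<zeta>" unfolding 2 by (simp add: \<eta>_def)
      have 4: "norm \<eta> = norm \<zeta>" by (cases \<zeta>) (simp add: \<eta>_def norm_Pair add.commute)
      from W have "cmod (weyl_op (pairing \<sigma>) (tf_shift ?z g) (tf_shift ?w g))
          \<le> c * m ((?w + ?z) /\<^sub>R 2) * exp (- \<epsilon> * norm (?w - ?z) powr (1 / s))" by blast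
      then show "cmod (?V u \<zeta>) \<le> c * m u * exp (- \<epsilon> * norm \<zeta> powr (1 / s))"
        unfolding weyl_op_tf_shift[OF rapid_C_infinity[OF g]] 1 2 3 4 .
    qed
  qed
  have "?list \<longleftrightarrow> in_dual T \<sigma> \<and> (\<exists>c>0. \<exists>\<epsilon>>0. \<forall>u \<zeta>. cmod (?V u \<zeta>) \<le> c * m u * exp (- \<epsilon> * norm \<zeta> powr (1 / s)))"
  proof (intro iffI conjI)
    assume ?list
    then obtain c C where c: "c > 0" "C > 0" and
      bd: "\<And>L t. L \<in> lists Basis \<Longrightarrow> cmod (list_deriv L \<sigma> t) \<le> c * m t * C ^ length L * fact_pow s (length L)" by blast
    show "in_dual T \<sigma>"
    proof (rule dual)
      show "c * C0 * m 0 > 0" using c C0 by simp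
      fix z
      have "cmod (\<sigma> z) \<le> c * m z" using bd[of "[]" z] by simp
      also have "\<dots> \<le> c * (C0 * v (z - 0) * m 0)" using c by (intro mult_left_mono C0) auto
      finally show "cmod (\<sigma> z) \<le> c * C0 * m 0 * v z" by (simp add: mult_ac)
    qed
    show "\<exists>c>0. \<exists>\<epsilon>>0. \<forall>u \<zeta>. cmod (?V u \<zeta>) \<le> c * m u * exp (- \<epsilon> * norm \<zeta> powr (1 / s))"
      by (rule symbol_bound_imp_fourier_bound[OF s0 v m \<Phi> \<sigma> c bd])
  next
    assume *: "in_dual T \<sigma> \<and> (\<exists>c>0. \<exists>\<epsilon>>0. \<forall>u \<zeta>. cmod (?V u \<zeta>) \<le> c * m u * exp (- \<epsilon> * norm \<zeta> powr (1 / s)))"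
    then obtain c \<epsilon> where c: "c > 0" "\<epsilon> > 0" and bd: "\<And>u \<zeta>. cmod (?V u \<zeta>) \<le> c * m u * exp (- \<epsilon> * norm \<zeta> powr (1 / s))" by blast
    \<comment> \<open>Translates of \<Phi> are test functions, so membership in the dual makes every
      localised symbol integrable, as Fourier inversion requires.\<close>
    have "\<forall>\<phi>\<in>topspace T. integrable lborel (\<lambda>t. \<sigma> t * cnj (\<phi> t))"
      using * unfolding in_dual_def by blast
    from bspec[OF this T] have "integrable lborel (\<lambda>t. \<sigma> t * cnj (?\<Phi> (t - z)))" for z .
    then show ?list by (rule fourier_bound_imp_symbol_bound[OF s0 v m \<Phi> p \<sigma> _ c bd])
  qed
  then show ?thesis
    unfolding mi_deriv_bound_iff[OF \<sigma> less_imp_le[OF s0] C0(2)] V .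
qed

end
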